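(* Let $n\ge 2$, let $\omega$ be the germ of a holomorphic 1-form on $(\mathbb{C}^n,0)$ with isolated singularity at $0$, and let $(X,0)\subset(\mathbb{C}^n,0)$ be the germ of a complex analytic hypersurface with an isolated singularity at $0$. Assume that $X$ is not invariant by $\omega$ (in the sense fixed in the context). Then \[\mu_{BR}(\omega,X)=\operatorname{Ind}_{\operatorname{GSV}}(\omega;X,0)+\mu_0(\omega)-\tau_0(X).\]
   Context: $\mathcal{O}_n$ is the ring of germs of holomorphic functions at $0\in\mathbb{C}^n$ and $\Theta_n$ is the $\mathcal{O}_n$-module of germs of holomorphic vector fields at $0$. Let $I_X\subset\mathcal{O}_n$ be the ideal of germs vanishing on $(X,0)$, $I_X=\langle\phi\rangle$ with $\phi$ a reduced equation of $X$. Put $\Theta_X=\{\xi\in\Theta_n:\ dh(\xi)\in I_X\ \forall h\in I_X\}$. Write $\omega=\sum_{i=1}^n A_i\,dx_i$ with $A_i\in\mathcal{O}_n$; "isolated singularity at $0$" means that $0$ is an isolated common zero of $A_1,\dots,A_n$. With $\omega(\Theta_X)=\{\omega(\xi):\xi\in\Theta_X\}$ (an ideal of $\mathcal{O}_n$), define: - Bruce-Roberts number: $\mu_{BR}(\omega,X)=\dim_{\mathbb{C}}\mathcal{O}_n/\omega(\Theta_X)$. - Milnor number of $\omega$: $\mu_0(\omega)=\dim_{\mathbb{C}}\mathcal{O}_n/\langle A_1,\dots,A_n\rangle$. - Tjurina number: $\tau_0(X)=\dim_{\mathbb{C}}\mathcal{O}_n/\langle\phi,\frac{\partial\phi}{\partial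 x_1},\dots,\frac{\partial\phi}{\partial x_n}\rangle$. - Ebeling--Gusein-Zade (GSV) index: $\operatorname{Ind}_{\operatorname{GSV}}(\omega;X,0)=\dim_{\mathbb{C}}\mathcal{O}_n/\langle\phi,\ \frac{\partial\phi}{\partial x_j}A_k-\frac{\partial\phi}{\partial x_k}A_j\ (1\le j,k\le n,\ j\ne k)\rangle$. Invariance: $X$ is invariant by $\omega$ if $T_pX\subset\ker\omega_p$ for all regular points $p$ of $X$. Standing convention: "$X$ is not invariant by $\omega$" is used as equivalent to $\mu_{BR}(\omega,X)<\infty$, i.e. the restriction of $\omega$ to $X$ has at most an isolated singularity at $0$ (near $0$, $\omega|_{T_pX}\neq 0$ for all $p\in X\setminus\{0\}$). *)

theory Defs
  imports
    "HOL-Complex_Analysis.Cauchy_Integral_Formula"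
    "HOL-Algebra.Algebraic_Closure_Type"
    "HOL-Library.Extended_Real"
begin

(* X is used as a variable below *)
no_notation Polynomials.var (\<open>X\<index>\<close>)

section \<open>Holomorphic functions of several variables near a point\<close>

definition has_complex_derivative_at ::
    "(complex^'n::finite \<Rightarrow> complex) \<Rightarrow> (complex^'n \<Rightarrow> complex) \<Rightarrow> complex^'n \<Rightarrow> bool"
  where "has_complex_derivative_at f D x \<longleftrightarrow>
    (f has_derivative D) (at x) \<and> (\<forall>c v. D (c *s v) = c * D v)"

definition holomorphic_near :: "(complex^'n::finite \<Rightarrow> complex) \<Rightarrow> complex^'n \<Rightarrow> bool"
  where "holomorphic_near f a \<longleftrightarrow> (\<forall>\<^sub>F x in nhds a. \<exists>D. has_complex_derivative_at f D x)"

definition partial_deriv :: "'n::finite \<Rightarrow> (complex^'n \<Rightarrow> complex) \<Rightarrow> complex^'n \<Rightarrow> complex"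
  where "partial_deriv i f x = deriv (\<lambda>z. f (x + axis i z)) 0"

lemma holomorphic_near_const: "holomorphic_near (\<lambda>_. c) a"
  unfolding holomorphic_near_def has_complex_derivative_at_def
  by (intro always_eventually allI exI[of _ "\<lambda>_. 0"]) auto

lemma holomorphic_near_add:
  assumes "holomorphic_near f a" "holomorphic_near g a"
  shows "holomorphic_near (\<lambda>x. f x + g x) a"
  using eventually_conj[OF assms[unfolded holomorphic_near_def]] unfolding holomorphic_near_def
proof (rule eventually_mono, elim conjE exE)
  fix x D E
  assume "has_complex_derivative_at f D x" "has_complex_derivative_at g E x"
  then have "has_complex_derivative_at (\<lambda>x. f x + g x) (\<lambda>v. D v + E v) x"
    unfolding has_complex_derivative_at_def
    by (auto simp: distrib_left intro!: has_derivative_add)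
  then show "\<exists>D. has_complex_derivative_at (\<lambda>x. f x + g x) D x" by blast
qed

lemma holomorphic_near_mult:
  assumes "holomorphic_near f a" "holomorphic_near g a"
  shows "holomorphic_near (\<lambda>x. f x * g x) a"
  using eventually_conj[OF assms[unfolded holomorphic_near_def]] unfolding holomorphic_near_def
proof (rule eventually_mono, elim conjE exE)
  fix x D E
  assume "has_complex_derivative_at f D x" "has_complex_derivative_at g E x"
  then have "has_complex_derivative_at (\<lambda>x. f x * g x) (\<lambda>v. f x * E v + D v * g x) x"
    unfolding has_complex_derivative_at_def
    by (auto simp: distrib_left mult_ac intro: has_derivative_mult[THEN has_derivative_eq_rhs])
  then show "\<exists>D. has_complex_derivative_at (\<lambda>x. f x * g x) D x" by blast
qed

lemma holomorphic_near_uminus: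
  assumes "holomorphic_near f a"
  shows "holomorphic_near (\<lambda>x. - f x) a"
  using holomorphic_near_mult[OF holomorphic_near_const[of "-1"] assms] by simp

lemma norm_axis_complex: "norm (axis i z :: complex^'n::finite) = norm z"
proof -
  have "(\<Sum>j\<in>UNIV. (norm ((axis i z :: complex^'n) $ j))\<^sup>2) = (\<Sum>j\<in>UNIV. if j = i then (norm z)\<^sup>2 else 0)"
    by (rule sum.cong) (auto simp: axis_def)
  then show ?thesis
    by (simp add: norm_vec_def L2_set_def)
qed

lemma bounded_linear_axis_complex: "bounded_linear (\<lambda>z. axis i z :: complex^'n::finite)"
proof (rule bounded_linear_intro[where K=1])
  show "norm (axis i z :: complex^'n) \<le> norm z * 1" for z
    by (simp add: norm_axis_complex)
qed (auto simp: vec_eq_iff axis_def)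

lemma axis_zero: "(axis i 0 :: complex^'n::finite) = 0"
  by (simp add: vec_eq_iff axis_def)

lemma axis_eq_smult: "(axis i z :: complex^'n::finite) = z *s axis i 1"
  by (simp add: vec_eq_iff axis_def)

lemma partial_deriv_eq:
  fixes f :: "complex^'n::finite \<Rightarrow> complex"
  assumes "has_complex_derivative_at f D x"
  shows "((\<lambda>z. f (x + axis i z)) has_field_derivative D (axis i 1)) (at 0)"
    and "partial_deriv i f x = D (axis i 1)"
proof -
  have "((\<lambda>z. x + axis i z) has_derivative axis i) (at 0)"
    using has_derivative_add[OF has_derivative_const bounded_linear_imp_has_derivative[OF bounded_linear_axis_complex]] by auto
  moreover have "(f has_derivative D) (at (x + axis i 0))"
    using assms by (simp add: has_complex_derivative_at_def axis_zero)
  ultimately have "((\<lambda>z. f (x + axis i z)) has_derivative (\<lambda>z. D (axis i z))) (at 0)"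
    by (rule has_derivative_compose)
  moreover have "D (axis i z) = D (axis i 1) * z" for z
    using assms unfolding has_complex_derivative_at_def by (metis axis_eq_smult mult.commute)
  then have "(\<lambda>z. D (axis i z)) = (*) (D (axis i 1))"
    by (rule ext)
  ultimately show "((\<lambda>z. f (x + axis i z)) has_field_derivative D (axis i 1)) (at 0)"
    unfolding has_field_derivative_def by (simp only:)
  then show "partial_deriv i f x = D (axis i 1)"
    unfolding partial_deriv_def by (rule DERIV_imp_deriv)
qed

lemma has_complex_derivative_at_partial:
  fixes f :: "complex^'n::finite \<Rightarrow> complex"
  assumes "has_complex_derivative_at f D x"
  shows "D = (\<lambda>v. \<Sum>i\<in>UNIV. partial_deriv i f x * v $ i)"
proof
  fix v
  have lin: "linear D"
    using assms has_derivative_linear unfolding has_complex_derivative_at_def by blast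
  have "D v = D (\<Sum>i\<in>UNIV. (v $ i) *s axis i 1)"
    by (simp add: basis_expansion)
  also have "\<dots> = (\<Sum>i\<in>UNIV. D ((v $ i) *s axis i 1))"
    by (rule linear_sum[OF lin])
  also have "\<dots> = (\<Sum>i\<in>UNIV. partial_deriv i f x * v $ i)"
    using assms partial_deriv_eq(2)[OF assms]
    by (simp add: has_complex_derivative_at_def mult.commute)
  finally show "D v = (\<Sum>i\<in>UNIV. partial_deriv i f x * v $ i)" .
qed

lemma partial_deriv_integral:
  fixes f :: "complex^'n::finite \<Rightarrow> complex"
  assumes s: "s > 0"
    and f: "\<And>y. y \<in> cball x s \<Longrightarrow> \<exists>D. has_complex_derivative_at f D y"
  defines "w \<equiv> \<lambda>t::real. of_real s * exp (2 * of_real pi * \<i> * of_real t)"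
  shows "partial_deriv i f x = integral {0..1} (\<lambda>t. f (x + axis i (w t)) / w t)"
proof -
  let ?g = "\<lambda>z. f (x + axis i z)"
  have der: "\<exists>d. (?g has_field_derivative d) (at z)" if "z \<in> cball 0 s" for z
  proof -
    have "x + axis i z \<in> cball x s"
      using that by (simp add: dist_norm norm_axis_complex)
    then obtain D where "has_complex_derivative_at f D (x + axis i z)"
      using f by blast
    from partial_deriv_eq(1)[OF this, of i]
    have "((\<lambda>y. f (x + axis i z + axis i y)) has_field_derivative D (axis i 1)) (at (z - z))"
      by simp
    then have "((\<lambda>y. f (x + axis i z + axis i (y - z))) has_field_derivative D (axis i 1)) (at z)"
      using DERIV_shift[of "\<lambda>y. f (x + axis i z + axis i y)" _ z "- z"] by simp
    moreover have "x + axis i z + axis i (y - z) = x + axis i y" for y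
      by (simp add: vec_eq_iff axis_def)
    ultimately show ?thesis by auto
  qed
  have hol: "?g holomorphic_on cball 0 s"
    unfolding holomorphic_on_def field_differentiable_def
    using der by (meson DERIV_subset subset_UNIV)
  have "(?g has_field_derivative (1 / (2 * of_real pi * \<i>) *
      contour_integral (circlepath 0 s) (\<lambda>u. ?g u / (u - 0)^2))) (at 0)"
    by (rule Cauchy_derivative_integral_circlepath)
       (use hol s in \<open>auto intro: holomorphic_on_imp_continuous_on holomorphic_on_subset\<close>)
  then have "partial_deriv i f x = 1 / (2 * of_real pi * \<i>) *
      contour_integral (circlepath 0 s) (\<lambda>u. ?g u / u^2)"
    unfolding partial_deriv_def by (simp add: DERIV_imp_deriv)
  also have "\<dots> = 1 / (2 * of_real pi * \<i>) *
      integral {0..1} (\<lambda>t. ?g (w t) / (w t)^2 * (2 * of_real pi * \<i> * w t))"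
    unfolding contour_integral_integral vector_derivative_circlepath
    by (simp add: circlepath w_def mult_ac)
  also have "\<dots> = integral {0..1}
      (\<lambda>t. 1 / (2 * of_real pi * \<i>) * (?g (w t) / (w t)^2 * (2 * of_real pi * \<i> * w t)))"
    by (rule integral_mult_right[symmetric])
  also have "(\<lambda>t. 1 / (2 * of_real pi * \<i>) * (?g (w t) / (w t)^2 * (2 * of_real pi * \<i> * w t)))
      = (\<lambda>t. ?g (w t) / w t)"
    using s by (auto simp: w_def power2_eq_square)
  finally show ?thesis .
qed

lemma holomorphic_near_partial_deriv:
  fixes f :: "complex^'n::finite \<Rightarrow> complex"
  assumes "holomorphic_near f a"
  shows "holomorphic_near (partial_deriv i f) a"
proof -
  obtain U where U: "open U" "a \<in> U"
    and fU: "\<And>y. y \<in> U \<Longrightarrow> \<exists>D. has_complex_derivative_at f D y"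
    using assms unfolding holomorphic_near_def eventually_nhds by blast
  let ?w = "\<lambda>s t. complex_of_real s * exp (2 * of_real pi * \<i> * complex_of_real t)"
  have contf: "continuous_on U f"
  proof (rule continuous_at_imp_continuous_on, rule ballI)
    fix y assume "y \<in> U"
    with fU show "isCont f y"
      unfolding has_complex_derivative_at_def using has_derivative_continuous by blast
  qed
  have nrm: "norm (?w s t) = s" if "s > 0" for s t
    using that by (simp add: norm_mult)
  have nz: "?w s t \<noteq> 0" if "s > 0" for s t
    using that by simp
  note ax[continuous_intros] = bounded_linear.continuous_on[OF bounded_linear_axis_complex]
  have *: "\<exists>s>0. ball x s \<subseteq> U \<and> (\<forall>y\<in>ball x s. \<forall>t i. y + axis i (?w s t) \<in> U) \<and>
      (\<forall>i. \<forall>y\<in>ball x s. partial_deriv i f y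
        = integral (cbox 0 1) (\<lambda>t. f (y + axis i (?w s t)) / ?w s t))"
    if xU: "x \<in> U" for x
  proof -
    obtain r where r: "r > 0" "ball x r \<subseteq> U"
      using openE[OF U(1) xU] .
    define s where "s = r / 2"
    have s: "s > 0" using r by (simp add: s_def)
    have sub: "cball y s \<subseteq> U" if "y \<in> ball x s" for y
    proof
      fix z assume "z \<in> cball y s"
      with that have "dist x z < r"
        using dist_triangle[of x z y] by (simp add: s_def)
      with r show "z \<in> U" by auto
    qed
    have "y + axis i (?w s t) \<in> U" if "y \<in> ball x s" for y t i
      using sub[OF that] s nrm[OF s, of t] by (auto simp: subset_iff dist_norm norm_axis_complex)
    moreover have "partial_deriv i f y
        = integral (cbox 0 1) (\<lambda>t. f (y + axis i (?w s t)) / ?w s t)" if "y \<in> ball x s" for i y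
      unfolding cbox_interval
      by (rule partial_deriv_integral[OF s]) (use sub[OF that] fU in auto)
    moreover have "ball x s \<subseteq> U"
      using sub s by (metis centre_in_cball less_imp_le subsetD subsetI)
    ultimately show ?thesis using s by blast
  qed
  have contp: "continuous_on U (partial_deriv i f)" for i
  proof (rule continuous_at_imp_continuous_on, rule ballI)
    fix x assume "x \<in> U"
    from *[OF this] obtain s where s: "s > 0"
      and inU: "\<And>y t i. y \<in> ball x s \<Longrightarrow> y + axis i (?w s t) \<in> U"
      and eq: "\<And>y i. y \<in> ball x s \<Longrightarrow> partial_deriv i f y
        = integral (cbox 0 1) (\<lambda>t. f (y + axis i (?w s t)) / ?w s t)"
      by blast
    have "continuous_on (ball x s) (\<lambda>y. integral (cbox 0 1) (\<lambda>t. f (y + axis i (?w s t)) / ?w s t))"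
      by (rule integral_continuous_on_param)
         (use s inU in \<open>auto simp: split_beta intro!: continuous_intros
            continuous_on_compose2[OF contf]\<close>)
    also have "?this \<longleftrightarrow> continuous_on (ball x s) (partial_deriv i f)"
      by (intro continuous_on_cong refl eq[symmetric])
    finally have "continuous_on (ball x s) (partial_deriv i f)" .
    then show "isCont (partial_deriv i f) x"
      using s by (simp add: continuous_on_eq_continuous_at)
  qed
  define F :: "(complex^'n) \<Rightarrow> ((complex^'n) \<Rightarrow>\<^sub>L complex)" where
    "F y = (\<Sum>j\<in>UNIV. blinfun_mult_right (partial_deriv j f y) o\<^sub>L Blinfun (\<lambda>v::complex^'n. v $ j))" for y
  have F_app: "blinfun_apply (F y) v = (\<Sum>j\<in>UNIV. partial_deriv j f y * v $ j)" for y v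
    unfolding F_def
    by (simp add: blinfun.sum_left bounded_linear_Blinfun_apply[OF bounded_linear_vec_nth])
  have contF: "continuous_on U F"
    unfolding F_def
    by (intro continuous_intros bounded_linear.continuous_on[OF bounded_linear_blinfun_mult_right] contp)
  have derf: "(f has_derivative blinfun_apply (F y)) (at y)" if yU: "y \<in> U" for y
  proof -
    obtain D where D: "has_complex_derivative_at f D y" using fU[OF yU] by blast
    have "D = blinfun_apply (F y)"
      using has_complex_derivative_at_partial[OF D] by (simp add: F_app fun_eq_iff)
    with D show ?thesis by (simp add: has_complex_derivative_at_def)
  qed
  have "\<exists>D. has_complex_derivative_at (partial_deriv i f) D x" if "x \<in> U" for x
  proof -
    from *[OF that] obtain s where s: "s > 0"
      and inU: "\<And>y t i. y \<in> ball x s \<Longrightarrow> y + axis i (?w s t) \<in> U"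
      and eq: "\<And>y i. y \<in> ball x s \<Longrightarrow> partial_deriv i f y
        = integral (cbox 0 1) (\<lambda>t. f (y + axis i (?w s t)) / ?w s t)"
      by blast
    let ?G = "\<lambda>y t. blinfun_mult_right (inverse (?w s t)) o\<^sub>L F (y + axis i (?w s t))"
    have G_app: "blinfun_apply (?G y t) v = inverse (?w s t) * blinfun_apply (F (y + axis i (?w s t))) v"
      for y t v by simp
    have contG: "continuous_on (ball x s \<times> cbox 0 1) (\<lambda>(y, t). ?G y t)"
      unfolding split_beta
      by (intro continuous_intros continuous_on_compose2[OF contF]
            bounded_linear.continuous_on[OF bounded_linear_blinfun_mult_right])
         (use s inU in auto)
    have "((\<lambda>y. integral (cbox 0 1) (\<lambda>t. f (y + axis i (?w s t)) / ?w s t)) has_derivative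
        blinfun_apply (integral (cbox 0 1) (?G x))) (at x within ball x s)"
    proof (rule leibniz_rule[OF _ _ contG])
      fix y t assume y: "y \<in> ball x s"
      have "((\<lambda>y. y + axis i (?w s t)) has_derivative (\<lambda>v. v)) (at y)"
        by (auto intro!: derivative_eq_intros)
      from has_derivative_compose[OF this derf[OF inU[OF y]]]
      have "((\<lambda>y. f (y + axis i (?w s t)) * inverse (?w s t)) has_derivative
          (\<lambda>v. blinfun_apply (F (y + axis i (?w s t))) v * inverse (?w s t))) (at y)"
        by (rule has_derivative_mult_left)
      moreover have "blinfun_apply (?G y t)
          = (\<lambda>v. blinfun_apply (F (y + axis i (?w s t))) v * inverse (?w s t))"
        unfolding G_app by (rule ext) (rule mult.commute)
      ultimately show "((\<lambda>y. f (y + axis i (?w s t)) / ?w s t) has_derivative blinfun_apply (?G y t))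
          (at y within ball x s)"
        unfolding divide_inverse by (simp only: has_derivative_at_withinI)
    next
      fix y assume y: "y \<in> ball x s"
      show "(\<lambda>t. f (y + axis i (?w s t)) / ?w s t) integrable_on cbox 0 1"
        by (intro integrable_continuous continuous_intros continuous_on_compose2[OF contf])
           (use s inU[OF y] in auto)
    qed (use s in auto)
    then have "((\<lambda>y. integral (cbox 0 1) (\<lambda>t. f (y + axis i (?w s t)) / ?w s t)) has_derivative
        blinfun_apply (integral (cbox 0 1) (?G x))) (at x)"
      using s by (simp add: at_within_open[of x "ball x s"])
    then have "(partial_deriv i f has_derivative blinfun_apply (integral (cbox 0 1) (?G x))) (at x)"
      by (rule has_derivative_transform_within_open[of _ _ _ _ "ball x s"]) (use s eq in auto)
    moreover have "blinfun_apply (integral (cbox 0 1) (?G x)) (c *s v)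
        = c * blinfun_apply (integral (cbox 0 1) (?G x)) v" for c v
    proof -
      have int: "?G x integrable_on cbox 0 1"
        by (intro integrable_continuous continuous_intros continuous_on_compose2[OF contF]
              bounded_linear.continuous_on[OF bounded_linear_blinfun_mult_right])
           (use s inU in auto)
      have hom: "blinfun_apply (?G x t) (c *s v) = c * blinfun_apply (?G x t) v" for t
        by (simp add: F_app sum_distrib_left mult_ac)
      have "blinfun_apply (integral (cbox 0 1) (?G x)) (c *s v)
          = integral (cbox 0 1) (\<lambda>t. blinfun_apply (?G x t) (c *s v))"
        by (rule blinfun_apply_integral[OF int])
      also have "\<dots> = c * integral (cbox 0 1) (\<lambda>t. blinfun_apply (?G x t) v)"
        unfolding hom by (rule integral_mult_right)
      also have "\<dots> = c * blinfun_apply (integral (cbox 0 1) (?G x)) v"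
        by (simp only: blinfun_apply_integral[OF int])
      finally show ?thesis .
    qed
    ultimately show ?thesis unfolding has_complex_derivative_at_def by blast
  qed
  then show ?thesis
    using U unfolding holomorphic_near_def eventually_nhds by blast
qed

lemma partial_deriv_cong_eventually:
  fixes f g :: "complex^'n::finite \<Rightarrow> complex"
  assumes "\<forall>\<^sub>F x in nhds a. f x = g x"
  shows "\<forall>\<^sub>F x in nhds a. partial_deriv i f x = partial_deriv i g x"
proof -
  have "\<forall>\<^sub>F x in nhds a. \<forall>\<^sub>F y in nhds x. f y = g y"
    using assms by (simp add: eventually_eventually)
  then show ?thesis
  proof (rule eventually_mono)
    fix x assume ev: "\<forall>\<^sub>F y in nhds x. f y = g y"
    have "((\<lambda>z. x + axis i z) \<longlongrightarrow> x + axis i 0) (nhds (0::complex))"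
    proof -
      have "isCont (\<lambda>z. x + axis i z) (0::complex)"
        by (intro continuous_intros bounded_linear.isCont[OF bounded_linear_axis_complex])
      then show ?thesis unfolding continuous_at by (rule tendsto_at_iff_tendsto_nhds[THEN iffD1])
    qed
    moreover have "x + axis i 0 = x" by (simp add: vec_eq_iff axis_def)
    ultimately have "filterlim (\<lambda>z. x + axis i z) (nhds x) (nhds (0::complex))" by simp
    from eventually_compose_filterlim[OF ev this]
    have "\<forall>\<^sub>F z in nhds 0. f (x + axis i z) = g (x + axis i z)" .
    then show "partial_deriv i f x = partial_deriv i g x"
      unfolding partial_deriv_def by (intro deriv_cong_ev) auto
  qed
qed


section \<open>The ring of germs of holomorphic functions at the origin\<close>

definition germ_rel ::
    "(complex^'n::finite \<Rightarrow> complex) \<Rightarrow> (complex^'n \<Rightarrow> complex) \<Rightarrow> bool"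
  where "germ_rel f g \<longleftrightarrow>
    holomorphic_near f 0 \<and> holomorphic_near g 0 \<and> (\<forall>\<^sub>F x in nhds 0. f x = g x)"

quotient_type (overloaded) 'n germ = "complex^'n::finite \<Rightarrow> complex" / partial: germ_rel
proof (rule part_equivpI)
  show "\<exists>f. germ_rel f f"
    by (auto simp: germ_rel_def intro: holomorphic_near_const)
  show "symp germ_rel"
    by (auto simp: symp_def germ_rel_def eq_commute)
  show "transp germ_rel"
    unfolding transp_def germ_rel_def by (auto elim: eventually_elim2)
qed

lift_definition const_germ :: "complex \<Rightarrow> 'n::finite germ" is "\<lambda>c _. c"
  by (simp add: germ_rel_def holomorphic_near_const)

lift_definition partial_germ :: "'n \<Rightarrow> 'n::finite germ \<Rightarrow> 'n germ" is partial_deriv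
  by (auto simp: germ_rel_def holomorphic_near_partial_deriv partial_deriv_cong_eventually)

instantiation germ :: (finite) comm_ring_1
begin

lift_definition zero_germ :: "'a germ" is "\<lambda>_. 0"
  by (simp add: germ_rel_def holomorphic_near_const)

lift_definition one_germ :: "'a germ" is "\<lambda>_. 1"
  by (simp add: germ_rel_def holomorphic_near_const)

lift_definition plus_germ :: "'a germ \<Rightarrow> 'a germ \<Rightarrow> 'a germ" is "\<lambda>f g x. f x + g x"
  by (auto simp: germ_rel_def holomorphic_near_add elim: eventually_elim2)

lift_definition times_germ :: "'a germ \<Rightarrow> 'a germ \<Rightarrow> 'a germ" is "\<lambda>f g x. f x * g x"
  by (auto simp: germ_rel_def holomorphic_near_mult elim: eventually_elim2)

lift_definition uminus_germ :: "'a germ \<Rightarrow> 'a germ" is "\<lambda>f x. - f x"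
  by (auto simp: germ_rel_def holomorphic_near_uminus elim: eventually_mono)

definition minus_germ :: "'a germ \<Rightarrow> 'a germ \<Rightarrow> 'a germ"
  where "minus_germ f g = f + (- g)"

instance
proof
  fix a b c :: "'a germ"
  show "a * b * c = a * (b * c)"
    by transfer (auto simp: germ_rel_def mult.assoc intro!: holomorphic_near_mult)
  show "a * b = b * a"
    by transfer (auto simp: germ_rel_def mult.commute intro!: holomorphic_near_mult)
  show "1 * a = a"
    by transfer (auto simp: germ_rel_def)
  show "(a + b) * c = a * c + b * c"
    by transfer (auto simp: germ_rel_def distrib_right intro!: holomorphic_near_mult holomorphic_near_add)
  show "a + b + c = a + (b + c)"
    by transfer (auto simp: germ_rel_def add.assoc intro!: holomorphic_near_add)
  show "a + b = b + a"
    by transfer (auto simp: germ_rel_def add.commute intro!: holomorphic_near_add)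
  show "0 + a = a"
    by transfer (auto simp: germ_rel_def)
  show "- a + a = 0"
    by transfer (auto simp: germ_rel_def holomorphic_near_const)
  show "a - b = a + - b"
    by (rule minus_germ_def)
  show "(0::'a germ) \<noteq> 1"
    by transfer (auto simp: germ_rel_def)
qed

end

abbreviation germ_ring :: "'n::finite germ ring" (\<open>\<O>\<close>)
  where "\<O> \<equiv> ring_of_type_algebra"

text \<open>
  \<open>rep_germ f\<close> is a chosen representative of \<open>f\<close>. Below it only occurs in ways which do not
  depend on that choice (its value at the origin, or finitely many representatives on an
  unspecified neighbourhood of the origin).
\<close>

definition isolated_common_zero :: "'n::finite germ set \<Rightarrow> bool"
  where "isolated_common_zero S \<longleftrightarrow>
    finite S \<and> (\<forall>\<^sub>F x in nhds 0. (\<forall>f\<in>S. rep_germ f x = 0) \<longleftrightarrow> x = 0)"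

text \<open>
  The complex dimension of \<open>\<O> / I\<close>; the scalars are the classes of the constant germs.
  For \<open>I = UNIV\<close> the quotient is the zero ring, and the dimension is \<open>0\<close>.
\<close>

definition quot_dim :: "'n::finite germ set \<Rightarrow> enat"
  where "quot_dim I =
    (let Q = \<O> Quot I; K = range (\<lambda>c. I +>\<^bsub>\<O>\<^esub> const_germ c)
     in if \<exists>d. ring.dimension Q d K (carrier Q)
        then enat (THE d. ring.dimension Q d K (carrier Q)) else \<infinity>)"


section \<open>One-forms, vector fields and hypersurfaces\<close>

text \<open>
  A germ of a 1-form \<open>\<Sum>i. A i dx i\<close> and a germ of a vector field \<open>\<Sum>i. \<xi> i \<partial>/\<partial>x i\<close> are given by
  their vectors of coefficients. A germ of a set at the origin is given by any representative.
\<close>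

type_synonym 'n one_form = "'n germ ^ 'n"
type_synonym 'n vector_field = "'n germ ^ 'n"

definition contract :: "'n::finite one_form \<Rightarrow> 'n vector_field \<Rightarrow> 'n germ"
  where "contract \<omega> \<xi> = (\<Sum>i\<in>UNIV. \<omega> $ i * \<xi> $ i)"

definition differential :: "'n::finite germ \<Rightarrow> 'n one_form"
  where "differential h = (\<chi> i. partial_germ i h)"

definition hypersurface_germ :: "(complex^'n::finite) set \<Rightarrow> bool"
  where "hypersurface_germ X \<longleftrightarrow>
    (\<exists>f. f \<noteq> 0 \<and> rep_germ f 0 = 0 \<and> (\<forall>\<^sub>F x in nhds 0. x \<in> X \<longleftrightarrow> rep_germ f x = 0))"

definition vanishing_ideal :: "(complex^'n::finite) set \<Rightarrow> 'n germ set"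
  where "vanishing_ideal X = {h. \<forall>\<^sub>F x in nhds 0. x \<in> X \<longrightarrow> rep_germ h x = 0}"

definition reduced_equation :: "(complex^'n::finite) set \<Rightarrow> 'n germ \<Rightarrow> bool"
  where "reduced_equation X \<phi> \<longleftrightarrow> vanishing_ideal X = Idl\<^bsub>\<O>\<^esub> {\<phi>}"

definition log_vector_fields :: "(complex^'n::finite) set \<Rightarrow> 'n vector_field set"
  where "log_vector_fields X =
    {\<xi>. \<forall>h\<in>vanishing_ideal X. contract (differential h) \<xi> \<in> vanishing_ideal X}"


section \<open>Invariants\<close>

definition bruce_roberts_number :: "'n::finite one_form \<Rightarrow> (complex^'n) set \<Rightarrow> enat"
  where "bruce_roberts_number \<omega> X = quot_dim (contract \<omega> ` log_vector_fields X)"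

definition milnor_number :: "'n::finite one_form \<Rightarrow> enat"
  where "milnor_number \<omega> = quot_dim (Idl\<^bsub>\<O>\<^esub> (range (\<lambda>i. \<omega> $ i)))"

definition tjurina_number :: "'n::finite germ \<Rightarrow> enat"
  where "tjurina_number \<phi> = quot_dim (Idl\<^bsub>\<O>\<^esub> (insert \<phi> (range (\<lambda>i. partial_germ i \<phi>))))"

definition gsv_index :: "'n::finite one_form \<Rightarrow> 'n germ \<Rightarrow> enat"
  where "gsv_index \<omega> \<phi> = quot_dim (Idl\<^bsub>\<O>\<^esub> (insert \<phi>
    {partial_germ j \<phi> * \<omega> $ k - partial_germ k \<phi> * \<omega> $ j | j k. j \<noteq> k}))"

text \<open>
  Non-invariance of \<open>X\<close> under \<open>\<omega>\<close> in the sense that the restriction of \<open>\<omega>\<close> to \<open>X\<close> has at most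
  an isolated singularity at the origin, expressed by finiteness of the Bruce-Roberts number.
\<close>

definition not_invariant :: "'n::finite one_form \<Rightarrow> (complex^'n) set \<Rightarrow> bool"
  where "not_invariant \<omega> X \<longleftrightarrow> bruce_roberts_number \<omega> X < \<infinity>"

end

theory Submission
  imports Defs "HOL-Complex_Analysis.Complex_Singularities" "Jordan_Normal_Form.Determinant"
begin

no_notation vec_index (infixl \<open>$\<close> 100)
no_notation fps_nth (infixl \<open>$\<close> 75)

text \<open>
  Let \<open>A\<close>, \<open>T\<close>, \<open>G\<close> be the ideals whose colengths are the Milnor number, the Tjurina number and the
  GSV index. Then \<open>\<omega>(\<Theta>\<^sub>X) \<subseteq> A\<close> and \<open>G \<subseteq> T\<close>, so the formula says that
  \<open>dim A / \<omega>(\<Theta>\<^sub>X) = dim T / G\<close>. Both are quotients of the module of pairs \<open>(\<xi>, a)\<close> of a vector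
  field and a germ, under \<open>\<omega>(\<xi>)\<close> and \<open>d\<phi>(\<xi>) + a \<phi>\<close>, and the kernels agree because every
  \<open>\<xi>\<close> with \<open>\<omega>(\<xi>) = 0\<close> is a combination of the Koszul relations between the coefficients of \<open>\<omega>\<close>.
  The latter holds since \<open>A\<close> has finite colength, so that it contains the regular sequence of powers
  of the coordinates. Finiteness of the Tjurina number is the Nullstellensatz for an isolated zero,
  which follows by eliminating one variable after the other.
\<close>

section \<open>Koszul relations\<close>

text \<open>To show directly that the coefficients of \<open>\<omega>\<close> form a regular
  sequence, one would need that systems of parameters of the ring of germs are regular, that is, its
  Cohen-Macaulay property. Only the vanishing of the first Koszul homology is wanted, however, and
  for that the ideal merely has to contain some regular sequence with as many members as there are
  variables. For powers of the coordinates, regularity is checked by setting one coordinate to zero.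
  Such powers lie in \<open>A\<close> because finitely many powers of a coordinate become dependent
  modulo \<open>A\<close>, and a dependence is its lowest power times a unit.

  The elimination uses contour integrals in place of Weierstrass polynomials. The resultant of two
  functions is assembled from integrals over one fixed circle on which the first of them has no
  zero. The resultant and the cofactors that place it in the ideal are therefore holomorphic in the
  remaining variables at once, and no individual zero has to be followed as the parameters
  move.\<close>

interpretation ideals: Modules.module "(*) :: 'a \<Rightarrow> 'a \<Rightarrow> 'a::comm_ring_1"
  by unfold_locales (auto simp: algebra_simps)

declare ideals.scale_scale [simp del]

text \<open>The ring is a module over itself here, so \<open>ideals.span\<close> is the generated
  ideal. The coefficients are indexed by \<open>I\<close> and not by the values of \<open>f\<close>,
  since \<open>f\<close> need not be injective; hence the update at a single index in the
  induction.\<close>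

lemma span_imageE:
  fixes f :: "'i \<Rightarrow> 'a::comm_ring_1"
  assumes "finite I" "x \<in> ideals.span (f ` I)"
  obtains c where "x = (\<Sum>k\<in>I. c k * f k)"
proof -
  have "\<exists>c. x = (\<Sum>k\<in>I. c k * f k)"
    using assms(2)
  proof (induction rule: ideals.span_induct_alt)
    case base
    then show ?case by (intro exI[of _ "\<lambda>_. 0"]) simp
  next
    case (step a x y)
    then obtain i c where i: "i \<in> I" "x = f i" "y = (\<Sum>k\<in>I. c k * f k)" by auto
    have "(\<Sum>k\<in>I. (c(i := a + c i)) k * f k) = (a + c i) * f i + (\<Sum>k\<in>I - {i}. c k * f k)"
      using i(1) assms(1) by (subst sum.remove[of I i]) simp_all
    also have "\<dots> = a * f i + (\<Sum>k\<in>I. c k * f k)"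
      using sum.remove[of I i "\<lambda>k. c k * f k"] i(1) assms(1) by (simp add: distrib_right add.assoc)
    finally have "a * x + y = (\<Sum>k\<in>I. (c(i := a + c i)) k * f k)"
      using i by simp
    then show ?case by blast
  qed
  with that show ?thesis by blast
qed

section \<open>The Koszul complex of a finite family of ring elements\<close>

definition koszul_sign :: "('i \<Rightarrow> nat) \<Rightarrow> 'i \<Rightarrow> 'i set \<Rightarrow> 'a::comm_ring_1"
  where "koszul_sign ix k S = (-1) ^ card {l\<in>S. ix l < ix k}"

text \<open>The Koszul boundary. A chain is given by its coefficients with respect to the exterior
  basis indexed by subsets, each ordered along \<open>ix\<close>; all degrees are carried at once,
  and the value on \<open>S\<close> involves only sets with one element more.\<close>

definition koszul_d :: "('i \<Rightarrow> nat) \<Rightarrow> ('i::finite \<Rightarrow> 'a::comm_ring_1) \<Rightarrow> ('i set \<Rightarrow> 'a) \<Rightarrow> 'i set \<Rightarrow> 'a"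
  where "koszul_d ix f z S = (\<Sum>k\<in>-S. koszul_sign ix k S * f k * z (insert k S))"

text \<open>Exterior multiplication from the left by the vector with coefficients
  \<open>c\<close>.\<close>

definition koszul_h :: "('i \<Rightarrow> nat) \<Rightarrow> ('i::finite \<Rightarrow> 'a::comm_ring_1) \<Rightarrow> ('i set \<Rightarrow> 'a) \<Rightarrow> 'i set \<Rightarrow> 'a"
  where "koszul_h ix c z S = (\<Sum>k\<in>S. koszul_sign ix k (S - {k}) * c k * z (S - {k}))"

lemma koszul_sign_square: "koszul_sign ix k S * koszul_sign ix k S = (1::'a::comm_ring_1)"
  unfolding koszul_sign_def by (simp only: power_mult_distrib[symmetric]) simp

lemma koszul_sign_cancel: "koszul_sign ix k S * (koszul_sign ix k S * x) = (x::'a::comm_ring_1)"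
  by (simp add: koszul_sign_square flip: mult.assoc)

lemma koszul_sign_insert:
  fixes S :: "'i::finite set"
  assumes "m \<notin> S"
  shows "koszul_sign ix k (insert m S) = (if ix m < ix k then - 1 else 1) * (koszul_sign ix k S :: 'a::comm_ring_1)"
proof -
  have "{l\<in>insert m S. ix l < ix k} = (if ix m < ix k then insert m {l\<in>S. ix l < ix k} else {l\<in>S. ix l < ix k})"
    by auto
  then show ?thesis using assms by (simp add: koszul_sign_def)
qed

text \<open>One of \<open>k\<close> and \<open>m\<close> comes later under \<open>ix\<close>;
  inserting the other one flips its sign, while the sign of the earlier one does not change.\<close>

lemma koszul_sign_anti:
  fixes S :: "'i::finite set"
  assumes "inj ix" "k \<noteq> m" "k \<notin> S" "m \<notin> S"
  shows "koszul_sign ix k (insert m S) * koszul_sign ix m S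
    = - (koszul_sign ix m (insert k S) * koszul_sign ix k S :: 'a::comm_ring_1)"
proof -
  have "ix k \<noteq> ix m" using assms by (auto dest: injD)
  then show ?thesis
    using koszul_sign_insert[of m S ix k, where 'a='a] koszul_sign_insert[of k S ix m, where 'a='a] assms(3,4)
    by (cases "ix k < ix m") (simp_all add: mult.commute)
qed

lemma koszul_d_diff: "koszul_d ix f (\<lambda>S. z S - w S) S = koszul_d ix f z S - koszul_d ix f w S"
  by (simp add: koszul_d_def algebra_simps sum_subtractf)

lemma koszul_d_scale: "koszul_d ix f (\<lambda>S. a * z S) S = a * koszul_d ix f z S"
  by (simp add: koszul_d_def algebra_simps sum_distrib_left)

text \<open>The induction pairs each term with its transpose. Arguing through twice the sum would
  require that 2 can be cancelled, which an arbitrary commutative ring does not allow.\<close>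

lemma sum_antisym_offdiag:
  fixes u :: "'i \<Rightarrow> 'i \<Rightarrow> 'a::comm_ring_1"
  assumes "finite A" "\<And>k m. k \<in> A \<Longrightarrow> m \<in> A \<Longrightarrow> k \<noteq> m \<Longrightarrow> u k m = - u m k"
  shows "(\<Sum>k\<in>A. \<Sum>m\<in>A - {k}. u k m) = 0"
  using assms
proof (induction A rule: finite_induct)
  case (insert a A)
  have "(\<Sum>k\<in>insert a A. \<Sum>m\<in>insert a A - {k}. u k m)
     = (\<Sum>m\<in>insert a A - {a}. u a m) + (\<Sum>k\<in>A. \<Sum>m\<in>insert a A - {k}. u k m)"
    using insert.hyps by simp
  also have "insert a A - {a} = A" using insert.hyps by auto
  also have "(\<Sum>k\<in>A. \<Sum>m\<in>insert a A - {k}. u k m) = (\<Sum>k\<in>A. u k a + (\<Sum>m\<in>A - {k}. u k m))"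
  proof (rule sum.cong[OF refl])
    fix k assume "k \<in> A"
    then have "insert a A - {k} = insert a (A - {k})" using insert.hyps by auto
    then show "(\<Sum>m\<in>insert a A - {k}. u k m) = u k a + (\<Sum>m\<in>A - {k}. u k m)"
      using insert.hyps by simp
  qed
  also have "\<dots> = (\<Sum>k\<in>A. u k a)"
  proof -
    have "(\<Sum>k\<in>A. \<Sum>m\<in>A - {k}. u k m) = 0"
      by (rule insert.IH, rule insert.prems) auto
    then show ?thesis by (simp add: sum.distrib)
  qed
  also have "(\<Sum>m\<in>A. u a m) = (\<Sum>m\<in>A. - u m a)"
    by (rule sum.cong[OF refl], rule insert.prems) (use insert.hyps in auto)
  finally show ?case by (simp add: sum_negf)
qed simp

lemma koszul_d_d:
  fixes f :: "'i::finite \<Rightarrow> 'a::comm_ring_1"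
  assumes "inj ix"
  shows "koszul_d ix f (koszul_d ix f z) S = 0"
proof -
  have "koszul_d ix f (koszul_d ix f z) S
    = (\<Sum>k\<in>-S. \<Sum>m\<in>-S - {k}. koszul_sign ix k S * koszul_sign ix m (insert k S) * f k * f m * z (insert m (insert k S)))"
    by (simp add: koszul_d_def sum_distrib_left Compl_insert mult_ac)
  also have "\<dots> = 0"
  proof (rule sum_antisym_offdiag)
    fix k m assume "k \<in> -S" "m \<in> -S" "k \<noteq> m"
    then have "koszul_sign ix k S * koszul_sign ix m (insert k S) = - (koszul_sign ix m S * koszul_sign ix k (insert m S) :: 'a)"
      using koszul_sign_anti[OF assms, of m k S] by (simp add: mult.commute)
    then show "koszul_sign ix k S * koszul_sign ix m (insert k S) * f k * f m * z (insert m (insert k S))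
     = - (koszul_sign ix m S * koszul_sign ix k (insert m S) * f m * f k * z (insert k (insert m S)))"
      by (simp add: insert_commute mult_ac)
  qed simp
  finally show ?thesis .
qed

text \<open>Signs are their own inverses, so two of them can change sides. The homotopy formula
  needs the sign on \<open>insert k (S - {m})\<close> on the left, whereas
  \<open>koszul_sign_anti\<close> delivers it on the right.\<close>

lemma swap_involutions:
  fixes a b c e :: "'a::comm_ring_1"
  assumes "a * b = - (c * e)" "b * b = 1" "c * c = 1"
  shows "a * c = - (b * e)"
proof -
  have "a * c = a * b * (b * c)"
    using assms(2) by (simp add: mult.assoc flip: mult.assoc[of b b])
  also have "\<dots> = - (b * e) * (c * c)" unfolding assms(1) by (simp add: mult_ac)
  finally show ?thesis using assms(3) by simp
qed

text \<open>Terms in which the same index is inserted and removed contribute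
  \<open>c k * f k\<close>: the first composite does so for \<open>k\<close> outside
  \<open>S\<close>, the second for \<open>k\<close> in \<open>S\<close>. The mixed terms of the two
  composites cancel by the sign rule.\<close>

lemma koszul_homotopy:
  fixes f c :: "'i::finite \<Rightarrow> 'a::comm_ring_1"
  assumes "inj ix"
  shows "koszul_d ix f (koszul_h ix c z) S + koszul_h ix c (koszul_d ix f z) S = (\<Sum>k\<in>UNIV. c k * f k) * z S"
proof -
  let ?t = "\<lambda>k m. koszul_sign ix k S * f k * (koszul_sign ix m (insert k (S - {m})) * c m * z (insert k (S - {m})))"
  let ?t' = "\<lambda>k m. koszul_sign ix m (S - {m}) * c m * (koszul_sign ix k (S - {m}) * f k * z (insert k (S - {m})))"
  have 1: "koszul_d ix f (koszul_h ix c z) S = (\<Sum>k\<in>-S. c k * f k * z S) +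
     (\<Sum>k\<in>-S. \<Sum>m\<in>S. ?t k m)"
  proof -
    have "koszul_sign ix k S * f k * koszul_h ix c z (insert k S) = c k * f k * z S +
      (\<Sum>m\<in>S. ?t k m)"
      if "k \<in> -S" for k
    proof -
      have eq: "insert k S - {m} = insert k (S - {m})" if "m \<in> S" for m
        using that \<open>k \<in> -S\<close> by auto
      have "koszul_h ix c z (insert k S) = koszul_sign ix k S * c k * z S +
         (\<Sum>m\<in>S. koszul_sign ix m (insert k (S - {m})) * c m * z (insert k (S - {m})))"
        using that by (simp add: koszul_h_def eq)
      then show ?thesis
        by (simp add: sum_distrib_left distrib_left mult_ac koszul_sign_cancel koszul_sign_square)
    qed
    then show ?thesis by (simp add: koszul_d_def sum.distrib)
  qed
  have 2: "koszul_h ix c (koszul_d ix f z) S = (\<Sum>m\<in>S. c m * f m * z S) +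
     (\<Sum>m\<in>S. \<Sum>k\<in>-S. ?t' k m)"
  proof -
    have "koszul_sign ix m (S - {m}) * c m * koszul_d ix f z (S - {m}) = c m * f m * z S +
      (\<Sum>k\<in>-S. ?t' k m)"
      if "m \<in> S" for m
    proof -
      have eq: "- (S - {m}) = insert m (-S)" and eq2: "insert m (S - {m}) = S" using that by auto
      have "koszul_d ix f z (S - {m}) = koszul_sign ix m (S - {m}) * f m * z S +
         (\<Sum>k\<in>-S. koszul_sign ix k (S - {m}) * f k * z (insert k (S - {m})))"
        using that unfolding koszul_d_def eq by (subst sum.insert) (auto simp: insert_absorb)
      then show ?thesis
        by (simp add: sum_distrib_left distrib_left mult_ac koszul_sign_cancel koszul_sign_square)
    qed
    then show ?thesis by (simp add: koszul_h_def sum.distrib)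
  qed
  have 3: "(\<Sum>k\<in>-S. \<Sum>m\<in>S. ?t k m)
    = - (\<Sum>m\<in>S. \<Sum>k\<in>-S. ?t' k m)"
  proof -
    have "?t k m
      = - (?t' k m)"
      if "k \<in> -S" "m \<in> S" for k m
    proof -
      have eq: "insert m (S - {m}) = S" using that by auto
      have "k \<noteq> m" using that by auto
      have "koszul_sign ix k S * koszul_sign ix m (S - {m}) = - (koszul_sign ix m (insert k (S - {m})) * koszul_sign ix k (S - {m}) :: 'a)"
        using koszul_sign_anti[OF assms \<open>k \<noteq> m\<close>, of "S - {m}", where 'a='a] that unfolding eq by auto
      then have "koszul_sign ix k S * koszul_sign ix m (insert k (S - {m})) = - (koszul_sign ix m (S - {m}) * koszul_sign ix k (S - {m}) :: 'a)"
        by (rule swap_involutions) (rule koszul_sign_square)+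
      then have "koszul_sign ix k S * koszul_sign ix m (insert k (S - {m})) * (f k * c m * z (insert k (S - {m})))
         = - (koszul_sign ix m (S - {m}) * koszul_sign ix k (S - {m})) * (f k * c m * z (insert k (S - {m})))" by simp
      then show ?thesis by (simp add: mult_ac)
    qed
    then have "(\<Sum>k\<in>-S. \<Sum>m\<in>S. ?t k m)
     = (\<Sum>k\<in>-S. \<Sum>m\<in>S. - (?t' k m))"
      by (intro sum.cong refl) auto
    also have "\<dots> = (\<Sum>m\<in>S. \<Sum>k\<in>-S. - (?t' k m))"
      by (rule sum.swap)
    finally show ?thesis by (simp add: sum_negf)
  qed
  have "(\<Sum>k\<in>UNIV. c k * f k) * z S = (\<Sum>k\<in>S. c k * f k * z S) + (\<Sum>k\<in>-S. c k * f k * z S)"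
    unfolding sum_distrib_right by (subst sum.union_disjoint[symmetric]) auto
  with 1 2 3 show ?thesis by simp
qed

lemma koszul_d_in_ideal:
  assumes "\<And>T. card T = Suc (card S) \<Longrightarrow> z T \<in> ideals.span Y"
  shows "koszul_d ix f z S \<in> ideals.span Y"
  unfolding koszul_d_def by (intro ideals.span_sum ideals.span_scale assms) auto

lemma koszul_h_in_ideal:
  fixes S :: "'i::finite set"
  assumes "\<And>T. Suc (card T) = card S \<Longrightarrow> z T \<in> ideals.span Y"
  shows "koszul_h ix f z S \<in> ideals.span Y"
  unfolding koszul_h_def by (intro ideals.span_sum ideals.span_scale assms card_Suc_Diff1) auto

text \<open>
  Each regular element of the ideal of \<open>f\<close> shifts the vanishing of Koszul homology down by one
  degree; above degree \<open>CARD('i)\<close> there are no chains.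
\<close>

lemma koszul_exact_mod:
  fixes f :: "'i::finite \<Rightarrow> 'a::comm_ring_1" and y :: "nat \<Rightarrow> 'a"
  assumes ix: "inj ix"
    and y: "\<And>j. j < CARD('i) \<Longrightarrow> y j \<in> ideals.span (range f)"
    and reg: "\<And>j g. j < CARD('i) \<Longrightarrow> y j * g \<in> ideals.span (y ` {..<j}) \<Longrightarrow> g \<in> ideals.span (y ` {..<j})"
    and j: "j \<le> CARD('i)"
    and z: "\<And>S. card S = j \<Longrightarrow> koszul_d ix f z S \<in> ideals.span (y ` {..<j})"
  shows "\<exists>u. \<forall>S. card S = Suc j \<longrightarrow> z S - koszul_d ix f u S \<in> ideals.span (y ` {..<j})"
  using j z
proof (induction j arbitrary: z rule: inc_induct)
  case base
  have "card S \<noteq> Suc CARD('i)" for S :: "'i set"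
    using card_mono[of UNIV S] by auto
  then show ?case by blast
next
  case (step j)
  have j: "j < CARD('i)" using step by simp
  obtain c where c: "y j = (\<Sum>k\<in>UNIV. c k * f k)"
    using span_imageE[OF finite y[OF j]] .
  \<comment> \<open>Multiplication by \<open>y j\<close> is null-homotopic, so the boundary of
    \<open>w\<close> is \<open>y j * z\<close> up to the ideal of the earlier members. Hence
    \<open>w\<close> is a cycle one degree higher modulo the ideal enlarged by \<open>y j\<close>,
    and the induction hypothesis applies to it.\<close>
  define w where "w = koszul_h ix c z"
  have w: "koszul_d ix f w S - y j * z S \<in> ideals.span (y ` {..<j})" if "card S = Suc j" for S
  proof -
    have "koszul_h ix c (koszul_d ix f z) S \<in> ideals.span (y ` {..<j})"
      using that step.prems by (intro koszul_h_in_ideal) auto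
    then have "- koszul_h ix c (koszul_d ix f z) S \<in> ideals.span (y ` {..<j})"
      by (rule ideals.span_neg)
    moreover have "koszul_d ix f w S - y j * z S = - koszul_h ix c (koszul_d ix f z) S"
      using koszul_homotopy[OF ix, of f c z S] unfolding w_def c by (simp add: algebra_simps)
    ultimately show ?thesis by simp
  qed
  have sub: "ideals.span (y ` {..<j}) \<subseteq> ideals.span (y ` {..<Suc j})"
    by (rule ideals.span_mono) auto
  have "koszul_d ix f w S \<in> ideals.span (y ` {..<Suc j})" if "card S = Suc j" for S
  proof -
    have "y j * z S \<in> ideals.span (y ` {..<Suc j})"
      by (subst mult.commute) (intro ideals.span_scale ideals.span_base, auto)
    with ideals.span_add[OF _ this, of "koszul_d ix f w S - y j * z S"] w[OF that] sub
    show ?thesis by auto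
  qed
  from step.IH[OF this] obtain v where
    v: "\<And>S. card S = Suc (Suc j) \<Longrightarrow> w S - koszul_d ix f v S \<in> ideals.span (y ` {..<Suc j})"
    by blast
  have "\<exists>k. w S - koszul_d ix f v S - k * y j \<in> ideals.span (y ` {..<j})" if "card S = Suc (Suc j)" for S
    using v[OF that] by (auto simp: lessThan_Suc ideals.span_insert)
  then obtain u where
    u: "\<And>S. card S = Suc (Suc j) \<Longrightarrow> w S - koszul_d ix f v S - u S * y j \<in> ideals.span (y ` {..<j})"
    by metis
  \<comment> \<open>The boundary of \<open>w - koszul_d v - y j * u\<close> loses the middle term
    and leaves \<open>y j\<close> times the wanted difference, up to the ideal of the earlier
    members; regularity cancels \<open>y j\<close>.\<close>
  have "z S - koszul_d ix f u S \<in> ideals.span (y ` {..<j})" if S: "card S = Suc j" for S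
  proof (rule reg[OF j])
    have "koszul_d ix f (\<lambda>S. w S - koszul_d ix f v S - y j * u S) S \<in> ideals.span (y ` {..<j})"
      using u S by (intro koszul_d_in_ideal) (auto simp: mult.commute)
    then have "koszul_d ix f w S - y j * koszul_d ix f u S \<in> ideals.span (y ` {..<j})"
      by (simp add: koszul_d_diff koszul_d_scale koszul_d_d[OF ix])
    from ideals.span_diff[OF this w[OF S]]
    show "y j * (z S - koszul_d ix f u S) \<in> ideals.span (y ` {..<j})"
      by (simp add: algebra_simps)
  qed
  then show ?case by blast
qed

text \<open>This is degree one, where the ideal to be factored out is zero. The family
  \<open>g\<close> is a chain on singletons, and the given relation is its boundary on the empty
  set. A bounding chain has one coefficient for each pair \<open>{k, m}\<close>; the signs turn it
  into an antisymmetric array.\<close>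

theorem koszul_relations:
  fixes f g :: "'i::finite \<Rightarrow> 'a::comm_ring_1" and y :: "nat \<Rightarrow> 'a"
  assumes y: "\<And>j. j < CARD('i) \<Longrightarrow> y j \<in> ideals.span (range f)"
    and reg: "\<And>j g. j < CARD('i) \<Longrightarrow> y j * g \<in> ideals.span (y ` {..<j}) \<Longrightarrow> g \<in> ideals.span (y ` {..<j})"
    and rel: "(\<Sum>k\<in>UNIV. f k * g k) = 0"
  obtains v where "\<And>k m. v k m = - v m k" "\<And>k. v k k = 0" "\<And>k. g k = (\<Sum>m\<in>UNIV. f m * v k m)"
proof -
  obtain ix :: "'i \<Rightarrow> nat" where ix: "inj ix"
    using finite_imp_inj_to_nat_seg[OF finite[of "UNIV :: 'i set"]] by blast
  have "\<exists>u. \<forall>S. card S = Suc 0 \<longrightarrow> g (the_elem S) - koszul_d ix f u S \<in> ideals.span (y ` {..<0})"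
    by (rule koszul_exact_mod[OF ix y reg])
       (auto simp: koszul_d_def koszul_sign_def rel ideals.span_zero)
  then obtain u where "\<And>S. card S = Suc 0 \<Longrightarrow> g (the_elem S) = koszul_d ix f u S"
    by auto
  from this[of "{_}"] have u: "g k = koszul_d ix f u {k}" for k
    by simp
  define v where "v k m = (if k = m then 0 else koszul_sign ix m {k} * u {k, m})" for k m
  have anti: "v k m = - v m k" for k m
    using koszul_sign_anti[OF ix, of k m "{}", where 'a='a]
    by (auto simp: v_def koszul_sign_def[of _ _ "{}"] insert_commute)
  have eq: "g k = (\<Sum>m\<in>UNIV. f m * v k m)" for k
  proof -
    have "(\<Sum>m\<in>UNIV. f m * v k m) = (\<Sum>m\<in>-{k}. f m * v k m)"
      by (rule sum.mono_neutral_right) (auto simp: v_def)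
    also have "\<dots> = koszul_d ix f u {k}"
      unfolding koszul_d_def by (rule sum.cong) (auto simp: v_def insert_commute)
    finally show ?thesis using u by simp
  qed
  show ?thesis
    by (rule that[OF anti _ eq]) (simp add: v_def)
qed

section \<open>Holomorphic functions of several variables\<close>

text \<open>Germs at one point are not enough, because circle integrals evaluate functions away from
  the origin; the domain therefore stays explicit. On open sets this amounts to
  \<open>holomorphic_near\<close> at every point.\<close>

definition cdiff_on :: "(complex^'n::finite \<Rightarrow> complex) \<Rightarrow> (complex^'n) set \<Rightarrow> bool"
  where "cdiff_on f U \<longleftrightarrow> (\<forall>x\<in>U. \<exists>D. has_complex_derivative_at f D x)"

lemma cdiff_on_subset: "cdiff_on f U \<Longrightarrow> V \<subseteq> U \<Longrightarrow> cdiff_on f V"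
  by (auto simp: cdiff_on_def)

lemma holomorphic_near_eq: "holomorphic_near f a \<longleftrightarrow> (\<exists>e>0. cdiff_on f (ball a e))"
  by (simp add: holomorphic_near_def cdiff_on_def eventually_nhds_metric Ball_def dist_commute)

lemma holomorphic_near_if_cdiff_on: "cdiff_on f U \<Longrightarrow> open U \<Longrightarrow> a \<in> U \<Longrightarrow> holomorphic_near f a"
  unfolding holomorphic_near_def cdiff_on_def eventually_nhds by blast

lemma cdiff_on_iff_holomorphic_near: "open U \<Longrightarrow> cdiff_on f U \<longleftrightarrow> (\<forall>a\<in>U. holomorphic_near f a)"
  using holomorphic_near_if_cdiff_on[of f U]
  by (auto simp: cdiff_on_def holomorphic_near_def dest: eventually_nhds_x_imp_x)

lemma cdiff_on_partial_deriv: "open U \<Longrightarrow> cdiff_on f U \<Longrightarrow> cdiff_on (partial_deriv i f) U"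
  by (simp add: cdiff_on_iff_holomorphic_near holomorphic_near_partial_deriv)

lemma cdiff_on_imp_continuous_on: "cdiff_on f U \<Longrightarrow> continuous_on U f"
  unfolding cdiff_on_def has_complex_derivative_at_def
  by (meson continuous_at_imp_continuous_on has_derivative_continuous)

lemma cdiff_on_const: "cdiff_on (\<lambda>_. c) U"
  unfolding cdiff_on_def has_complex_derivative_at_def
  by (intro ballI exI[of _ "\<lambda>_. 0"]) auto

lemma cdiff_on_compose_linear:
  fixes h :: "complex^'m::finite \<Rightarrow> complex^'n::finite"
  assumes f: "cdiff_on f V" and h: "\<And>x. x \<in> U \<Longrightarrow> (h has_derivative L) (at x)" "\<And>x. x \<in> U \<Longrightarrow> h x \<in> V"
    and L: "\<And>c v. L (c *s v) = c *s L v"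
  shows "cdiff_on (\<lambda>x. f (h x)) U"
  unfolding cdiff_on_def
proof
  fix x assume x: "x \<in> U"
  then obtain D where D: "(f has_derivative D) (at (h x))" "\<And>c v. D (c *s v) = c * D v"
    using f h(2) unfolding cdiff_on_def has_complex_derivative_at_def by blast
  have "((\<lambda>x. f (h x)) has_derivative (\<lambda>v. D (L v))) (at x)"
    using h(1)[OF x] D(1) by (rule has_derivative_compose)
  with D(2) L show "\<exists>D. has_complex_derivative_at (\<lambda>x. f (h x)) D x"
    unfolding has_complex_derivative_at_def by (intro exI[of _ "\<lambda>v. D (L v)"]) auto
qed

lemma cdiff_on_compose_field:
  assumes f: "cdiff_on f U" and g: "\<And>x. x \<in> U \<Longrightarrow> g field_differentiable at (f x)"
  shows "cdiff_on (\<lambda>x. g (f x)) U"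
  unfolding cdiff_on_def
proof
  fix x assume x: "x \<in> U"
  then obtain D where D: "(f has_derivative D) (at x)" "\<And>c v. D (c *s v) = c * D v"
    using f unfolding cdiff_on_def has_complex_derivative_at_def by blast
  obtain g' where "(g has_derivative (*) g') (at (f x))"
    using g[OF x] unfolding field_differentiable_def has_field_derivative_def by blast
  from has_derivative_compose[OF D(1) this] D(2)
  show "\<exists>D. has_complex_derivative_at (\<lambda>x. g (f x)) D x"
    unfolding has_complex_derivative_at_def by (intro exI[of _ "\<lambda>v. g' * D v"]) auto
qed

lemma cdiff_on_component: "cdiff_on (\<lambda>x. x $ i) U"
  unfolding cdiff_on_def has_complex_derivative_at_def
  by (intro ballI exI[of _ "\<lambda>v. v $ i"])
     (auto intro: bounded_linear_imp_has_derivative bounded_linear_vec_nth)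

lemma cdiff_on_add: "cdiff_on f U \<Longrightarrow> cdiff_on g U \<Longrightarrow> cdiff_on (\<lambda>x. f x + g x) U"
  unfolding cdiff_on_def
proof
  fix x assume "\<forall>x\<in>U. \<exists>D. has_complex_derivative_at f D x" "\<forall>x\<in>U. \<exists>D. has_complex_derivative_at g D x" "x \<in> U"
  then obtain D E where "has_complex_derivative_at f D x" "has_complex_derivative_at g E x" by blast
  then have "has_complex_derivative_at (\<lambda>x. f x + g x) (\<lambda>v. D v + E v) x"
    unfolding has_complex_derivative_at_def
    by (auto simp: distrib_left intro!: has_derivative_add)
  then show "\<exists>D. has_complex_derivative_at (\<lambda>x. f x + g x) D x" by blast
qed

lemma cdiff_on_mult: "cdiff_on f U \<Longrightarrow> cdiff_on g U \<Longrightarrow> cdiff_on (\<lambda>x. f x * g x) U"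
  unfolding cdiff_on_def
proof
  fix x assume "\<forall>x\<in>U. \<exists>D. has_complex_derivative_at f D x" "\<forall>x\<in>U. \<exists>D. has_complex_derivative_at g D x" "x \<in> U"
  then obtain D E where "has_complex_derivative_at f D x" "has_complex_derivative_at g E x" by blast
  then have "has_complex_derivative_at (\<lambda>x. f x * g x) (\<lambda>v. f x * E v + D v * g x) x"
    unfolding has_complex_derivative_at_def
    by (auto simp: distrib_left mult_ac intro: has_derivative_mult[THEN has_derivative_eq_rhs])
  then show "\<exists>D. has_complex_derivative_at (\<lambda>x. f x * g x) D x" by blast
qed

lemma cdiff_on_uminus: "cdiff_on f U \<Longrightarrow> cdiff_on (\<lambda>x. - f x) U"
  using cdiff_on_mult[OF cdiff_on_const[of "-1"]] by force

lemma cdiff_on_diff: "cdiff_on f U \<Longrightarrow> cdiff_on g U \<Longrightarrow> cdiff_on (\<lambda>x. f x - g x) U"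
  using cdiff_on_add[OF _ cdiff_on_uminus] by force

lemma cdiff_on_power: "cdiff_on f U \<Longrightarrow> cdiff_on (\<lambda>x. f x ^ m) U"
  by (induction m) (auto intro: cdiff_on_const cdiff_on_mult)

lemma cdiff_on_sum: "(\<And>i. i \<in> A \<Longrightarrow> cdiff_on (f i) U) \<Longrightarrow> cdiff_on (\<lambda>x. \<Sum>i\<in>A. f i x) U"
  by (induction A rule: infinite_finite_induct) (auto intro: cdiff_on_const cdiff_on_add)

lemma cdiff_on_prod: "(\<And>i. i \<in> A \<Longrightarrow> cdiff_on (f i) U) \<Longrightarrow> cdiff_on (\<lambda>x. \<Prod>i\<in>A. f i x) U"
  by (induction A rule: infinite_finite_induct) (auto intro: cdiff_on_const cdiff_on_mult)

lemma cdiff_on_divide: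
  assumes "cdiff_on f U" "cdiff_on g U" "\<And>x. x \<in> U \<Longrightarrow> g x \<noteq> 0"
  shows "cdiff_on (\<lambda>x. f x / g x) U"
proof -
  have "cdiff_on (\<lambda>x. inverse (g x)) U"
  proof (rule cdiff_on_compose_field[OF assms(2)])
    show "inverse field_differentiable at (g x)" if "x \<in> U" for x
      using DERIV_inverse[OF assms(3)[OF that]] unfolding field_differentiable_def by blast
  qed
  from cdiff_on_mult[OF assms(1) this] show ?thesis by (simp add: divide_inverse)
qed

lemmas cdiff_on_intros = cdiff_on_const cdiff_on_component cdiff_on_add cdiff_on_mult cdiff_on_uminus
  cdiff_on_diff cdiff_on_power cdiff_on_sum cdiff_on_prod cdiff_on_divide

text \<open>Differentiation under the integral sign asks for a derivative that is jointly continuous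
  in the point and the integration variable. Cauchy's formula writes each partial derivative as an
  integral of \<open>F\<close> over a small circle, so the joint continuity of \<open>F\<close> is
  passed on to it.\<close>

lemma cdiff_on_integral:
  fixes F :: "complex^'n::finite \<Rightarrow> real \<Rightarrow> complex"
  assumes U: "open U"
    and cont: "continuous_on (U \<times> {0..1}) (\<lambda>(x, t). F x t)"
    and hol: "\<And>t. t \<in> {0..1} \<Longrightarrow> cdiff_on (\<lambda>x. F x t) U"
  shows "cdiff_on (\<lambda>x. integral {0..1} (F x)) U"
  unfolding cdiff_on_def
proof
  fix x assume "x \<in> U"
  then obtain r where r: "r > 0" "ball x r \<subseteq> U"
    using openE[OF U] by blast
  \<comment> \<open>Half of the radius keeps every circle of radius \<open>s\<close> around a point
    of \<open>ball x s\<close> inside \<open>U\<close>.\<close>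
  define s where "s = r / 2"
  have s: "s > 0" using r by (simp add: s_def)
  let ?w = "\<lambda>t::real. of_real s * exp (2 * of_real pi * \<i> * of_real t) :: complex"
  note ax[continuous_intros] = bounded_linear.continuous_on[OF bounded_linear_axis_complex]
  have sub: "cball y s \<subseteq> U" if "y \<in> ball x s" for y
  proof
    fix z assume "z \<in> cball y s"
    with that have "dist x z < r"
      using dist_triangle[of x z y] by (simp add: s_def)
    with r show "z \<in> U" by auto
  qed
  have inU: "y + axis i (?w u) \<in> U" if "y \<in> ball x s" for y u i
    using sub[OF that] s by (auto simp: subset_iff dist_norm norm_axis_complex norm_mult)
  have xsU: "y \<in> U" if "y \<in> ball x s" for y
    using sub[OF that] s by (meson centre_in_cball less_imp_le subsetD)
  define P where "P i y t = integral (cbox 0 1) (\<lambda>u. F (y + axis i (?w u)) t / ?w u)" for i y t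
  have P: "partial_deriv i (\<lambda>x. F x t) y = P i y t" if "y \<in> ball x s" "t \<in> {0..1}" for i y t
    unfolding P_def cbox_interval
    by (rule partial_deriv_integral[OF s]) (use sub[OF that(1)] hol[OF that(2)] in \<open>auto simp: cdiff_on_def\<close>)
  have contP: "continuous_on (ball x s \<times> {0..1}) (\<lambda>(y, t). P i y t)" for i
  proof -
    have "continuous_on (ball x s \<times> {0..1}) (\<lambda>p. integral (cbox 0 1) (\<lambda>u. F (fst p + axis i (?w u)) (snd p) / ?w u))"
      by (rule integral_continuous_on_param)
         (use s inU in \<open>auto simp: split_beta intro!: continuous_intros
            continuous_on_compose2[OF cont, where f="\<lambda>z. (fst (fst z) + axis i (?w (snd z)), snd (fst z))", simplified split_beta fst_conv snd_conv]\<close>)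
    then show ?thesis by (simp add: P_def split_beta)
  qed
  define D :: "(complex^'n) \<Rightarrow> real \<Rightarrow> ((complex^'n) \<Rightarrow>\<^sub>L complex)" where
    "D y t = (\<Sum>j\<in>UNIV. blinfun_mult_right (P j y t) o\<^sub>L Blinfun (\<lambda>v::complex^'n. v $ j))" for y t
  have D_app: "blinfun_apply (D y t) v = (\<Sum>j\<in>UNIV. P j y t * v $ j)" for y t v
    unfolding D_def
    by (simp add: blinfun.sum_left bounded_linear_Blinfun_apply[OF bounded_linear_vec_nth])
  have contD: "continuous_on (ball x s \<times> cbox 0 1) (\<lambda>(y, t). D y t)"
    unfolding D_def split_beta
    by (intro continuous_intros bounded_linear.continuous_on[OF bounded_linear_blinfun_mult_right]
         contP[unfolded split_beta, folded cbox_interval])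
  have der: "((\<lambda>y. F y t) has_derivative blinfun_apply (D y t)) (at y)"
    if y: "y \<in> ball x s" and t: "t \<in> {0..1}" for y t
  proof -
    obtain E where E: "has_complex_derivative_at (\<lambda>x. F x t) E y"
      using hol[OF t] xsU[OF y] unfolding cdiff_on_def by blast
    have "E = blinfun_apply (D y t)"
      using has_complex_derivative_at_partial[OF E] P[OF y t] by (simp add: D_app fun_eq_iff)
    with E show ?thesis by (simp add: has_complex_derivative_at_def)
  qed
  have "((\<lambda>y. integral (cbox 0 1) (F y)) has_derivative
      blinfun_apply (integral (cbox 0 1) (D x))) (at x within ball x s)"
  proof (rule leibniz_rule[OF _ _ contD])
    fix y t assume "y \<in> ball x s" "t \<in> cbox (0::real) 1"
    then show "((\<lambda>x. F x t) has_derivative blinfun_apply (D y t)) (at y within ball x s)"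
      using der by (auto intro: has_derivative_at_withinI)
  next
    fix y assume "y \<in> ball x s"
    then show "F y integrable_on cbox 0 1"
      using xsU by (intro integrable_continuous continuous_on_compose2[OF cont, where f="\<lambda>t. (y, t)", simplified])
        (auto intro!: continuous_intros)
  qed (use s in auto)
  then have "((\<lambda>y. integral {0..1} (F y)) has_derivative blinfun_apply (integral (cbox 0 1) (D x))) (at x)"
    using s by (simp add: at_within_open[of x "ball x s"])
  moreover have "blinfun_apply (integral (cbox 0 1) (D x)) (c *s v)
      = c * blinfun_apply (integral (cbox 0 1) (D x)) v" for c v
  proof -
    have int: "D x integrable_on cbox 0 1"
      using s by (intro integrable_continuous continuous_on_compose2[OF contD, where f="\<lambda>t. (x, t)", simplified])
        (auto intro!: continuous_intros)
    have hom: "blinfun_apply (D x t) (c *s v) = c * blinfun_apply (D x t) v" for t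
      by (simp add: D_app sum_distrib_left mult_ac)
    have "blinfun_apply (integral (cbox 0 1) (D x)) (c *s v)
        = integral (cbox 0 1) (\<lambda>t. blinfun_apply (D x t) (c *s v))"
      by (rule blinfun_apply_integral[OF int])
    also have "\<dots> = c * integral (cbox 0 1) (\<lambda>t. blinfun_apply (D x t) v)"
      unfolding hom by (rule integral_mult_right)
    also have "\<dots> = c * blinfun_apply (integral (cbox 0 1) (D x)) v"
      by (simp only: blinfun_apply_integral[OF int])
    finally show ?thesis .
  qed
  ultimately show "\<exists>D. has_complex_derivative_at (\<lambda>x. integral {0..1} (F x)) D x"
    unfolding has_complex_derivative_at_def by blast
qed

lemma contour_integral_circlepath_real:
  "contour_integral (circlepath 0 r) h
    = integral {0..1} (\<lambda>t. h (of_real r * exp (2 * of_real pi * \<i> * of_real t)) *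
        (2 * of_real pi * \<i> * of_real r * exp (2 * of_real pi * \<i> * of_real t)))"
  unfolding contour_integral_integral vector_derivative_circlepath
  by (simp add: circlepath mult_ac)

lemma cdiff_on_contour_integral:
  fixes F :: "complex^'n::finite \<Rightarrow> complex \<Rightarrow> complex"
  assumes U: "open U" and r: "r > 0"
    and cont: "continuous_on (U \<times> sphere 0 r) (\<lambda>(x, w). F x w)"
    and hol: "\<And>w. w \<in> sphere 0 r \<Longrightarrow> cdiff_on (\<lambda>x. F x w) U"
  shows "cdiff_on (\<lambda>x. contour_integral (circlepath 0 r) (F x)) U"
  unfolding contour_integral_circlepath_real
proof (rule cdiff_on_integral[OF U])
  let ?w = "\<lambda>t::real. of_real r * exp (2 * of_real pi * \<i> * of_real t) :: complex"
  have w: "?w t \<in> sphere 0 r" for t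
    using r by (simp add: norm_mult)
  show "cdiff_on (\<lambda>x. F x (?w t) * (2 * of_real pi * \<i> * of_real r * exp (2 * of_real pi * \<i> * of_real t))) U" for t
    by (intro cdiff_on_intros hol w)
  show "continuous_on (U \<times> {0..1}) (\<lambda>(x, t). F x (?w t) * (2 * of_real pi * \<i> * of_real r * exp (2 * of_real pi * \<i> * of_real t)))"
    unfolding split_beta
    by (intro continuous_intros continuous_on_compose2[OF cont, where f="\<lambda>z. (fst z, ?w (snd z))", simplified split_beta fst_conv snd_conv])
       (use w in auto)
qed

section \<open>Zeros of a holomorphic function in a disc\<close>

abbreviation circ :: "real \<Rightarrow> (complex \<Rightarrow> complex) \<Rightarrow> complex"
  where "circ r F \<equiv> contour_integral (circlepath 0 r) F"

lemma holomorphic_divide_zero: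
  assumes "F holomorphic_on S" "open S" "F \<zeta> = 0"
  obtains q where "q holomorphic_on S" "\<And>z. z \<in> S \<Longrightarrow> F z = (z - \<zeta>) * q z"
  using that[OF pole_lemma_open[OF assms(1,2), of \<zeta>]] assms(3) by auto

lemma prod_list_linear_eq_0_iff:
  fixes z :: complex shows "(\<Prod>\<zeta>\<leftarrow>\<zeta>s. z - \<zeta>) = 0 \<longleftrightarrow> z \<in> set \<zeta>s"
  by (induction \<zeta>s) auto

lemma holomorphic_on_prod_list_linear:
  "(\<lambda>z. \<Prod>\<zeta>\<leftarrow>\<zeta>s. z - \<zeta>) holomorphic_on S"
  by (induction \<zeta>s) (auto intro!: holomorphic_intros)

text \<open>A list, so that zeros are recorded with multiplicity. The cofactor \<open>u\<close> is
  holomorphic on all of \<open>S\<close>, in the uses a neighbourhood of the closed disc, but is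
  required to be free of zeros only on that disc.\<close>

definition disc_zeros :: "(complex \<Rightarrow> complex) \<Rightarrow> real \<Rightarrow> complex set \<Rightarrow> complex list \<Rightarrow> bool"
  where "disc_zeros f r S \<zeta>s \<longleftrightarrow> set \<zeta>s \<subseteq> ball 0 r \<and>
    (\<exists>u. u holomorphic_on S \<and> (\<forall>z\<in>cball 0 r. u z \<noteq> 0) \<and> (\<forall>z\<in>S. f z = (\<Prod>\<zeta>\<leftarrow>\<zeta>s. z - \<zeta>) * u z))"

text \<open>Induction on the number of distinct zeros in the closed disc: splitting one off with its
  full multiplicity makes the number drop. Once there is a zero, the nonzero value at
  \<open>of_real r\<close> excludes a constant function, so the zeros are finite in number.\<close>

lemma disc_zeros_exists:
  assumes S: "open S" "connected S" "cball 0 r \<subseteq> S" and r: "r > 0"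
    and f: "f holomorphic_on S" "\<And>z. norm z = r \<Longrightarrow> f z \<noteq> 0"
  obtains \<zeta>s where "disc_zeros f r S \<zeta>s"
proof -
  have "\<exists>\<zeta>s. disc_zeros f r S \<zeta>s"
    using f
  proof (induction "card {z \<in> cball 0 r. f z = 0}" arbitrary: f rule: less_induct)
    case less
    have rS: "of_real r \<in> S" "f (of_real r) \<noteq> 0"
      using S(3) r less.prems(2)[of "of_real r"] by (auto simp: subset_iff)
    show ?case
    proof (cases "\<exists>\<zeta>\<in>cball 0 r. f \<zeta> = 0")
      case False
      then have "disc_zeros f r S []"
        using less.prems by (auto simp: disc_zeros_def)
      then show ?thesis by blast
    next
      case True
      then obtain \<zeta> where \<zeta>: "\<zeta> \<in> cball 0 r" "f \<zeta> = 0" by blast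
      have \<zeta>S: "\<zeta> \<in> S" using \<zeta> S(3) by blast
      have nc: "\<not> f constant_on S"
      proof
        assume "f constant_on S"
        then have "f (of_real r) = f \<zeta>" using rS(1) \<zeta>S by (auto simp: constant_on_def)
        with rS \<zeta> show False by simp
      qed
      have fin: "finite {z \<in> cball 0 r. f z = 0}"
        by (rule holomorphic_compact_finite_zeros[OF less.prems(1) S(1,2) compact_cball S(3) nc])
      obtain g \<rho> n where g: "0 < n" "0 < \<rho>" "ball \<zeta> \<rho> \<subseteq> S" "g holomorphic_on ball \<zeta> \<rho>"
        "\<And>w. w \<in> ball \<zeta> \<rho> \<Longrightarrow> f w = (w - \<zeta>) ^ n * g w" "\<And>w. w \<in> ball \<zeta> \<rho> \<Longrightarrow> g w \<noteq> 0"
        by (rule holomorphic_factor_zero_nonconstant[OF less.prems(1) S(1,2) \<zeta>S \<zeta>(2) nc]) blast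
      define h where "h z = (if z \<in> ball \<zeta> \<rho> then g z else f z / (z - \<zeta>) ^ n)" for z
      have h: "h z = f z / (z - \<zeta>) ^ n" if "z \<noteq> \<zeta>" for z
        using that g(5) by (auto simp: h_def)
      have "h holomorphic_on ball \<zeta> \<rho> \<union> (S - {\<zeta>})"
      proof (rule holomorphic_on_Un)
        show "h holomorphic_on ball \<zeta> \<rho>"
          by (rule holomorphic_transform[OF g(4)]) (simp add: h_def)
        have "(\<lambda>z. f z / (z - \<zeta>) ^ n) holomorphic_on S - {\<zeta>}"
          by (auto intro!: holomorphic_intros holomorphic_on_subset[OF less.prems(1)])
        then show "h holomorphic_on S - {\<zeta>}"
          by (rule holomorphic_transform) (auto simp: h)
      qed (use S in auto)
      moreover have "ball \<zeta> \<rho> \<union> (S - {\<zeta>}) = S" using g(2,3) by auto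
      ultimately have hol: "h holomorphic_on S" by simp
      have fh: "f z = (z - \<zeta>) ^ n * h z" for z
        using \<zeta> g(1) by (cases "z = \<zeta>") (auto simp: h)
      have h\<zeta>: "h \<zeta> \<noteq> 0" using g(2,6) by (simp add: h_def)
      have "{z \<in> cball 0 r. h z = 0} \<subset> {z \<in> cball 0 r. f z = 0}"
        using \<zeta> h\<zeta> fh by auto
      then have "card {z \<in> cball 0 r. h z = 0} < card {z \<in> cball 0 r. f z = 0}"
        by (rule psubset_card_mono[OF fin])
      moreover have "h z \<noteq> 0" if "norm z = r" for z
        using less.prems(2)[OF that] fh[of z] by auto
      ultimately obtain \<zeta>s where "disc_zeros h r S \<zeta>s"
        using less.hyps[OF _ hol] by blast
      then obtain u where u: "set \<zeta>s \<subseteq> ball 0 r" "u holomorphic_on S" "\<And>z. z \<in> cball 0 r \<Longrightarrow> u z \<noteq> 0"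
        "\<And>z. z \<in> S \<Longrightarrow> h z = (\<Prod>\<zeta>\<leftarrow>\<zeta>s. z - \<zeta>) * u z"
        unfolding disc_zeros_def by blast
      have "norm \<zeta> \<noteq> r" using less.prems(2) \<zeta> by blast
      then have "\<zeta> \<in> ball 0 r" using \<zeta> by auto
      have "disc_zeros f r S (replicate n \<zeta> @ \<zeta>s)"
        unfolding disc_zeros_def
      proof (intro conjI exI ballI)
        show "set (replicate n \<zeta> @ \<zeta>s) \<subseteq> ball 0 r" using u(1) \<open>\<zeta> \<in> ball 0 r\<close> by auto
        show "f z = (\<Prod>\<zeta>\<leftarrow>replicate n \<zeta> @ \<zeta>s. z - \<zeta>) * u z" if "z \<in> S" for z
          using that by (simp add: fh u(4) prod_list_replicate mult.assoc)
      qed (use u in auto)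
      then show ?thesis by blast
    qed
  qed
  with that show ?thesis by blast
qed

lemma contour_integral_cauchy:
  assumes "F holomorphic_on cball 0 r" "\<zeta> \<in> ball 0 r"
  shows "((\<lambda>z. F z / (z - \<zeta>)) has_contour_integral 2 * of_real pi * \<i> * F \<zeta>) (circlepath 0 r)"
  using Cauchy_integral_circlepath_simple[OF assms(1), of \<zeta>] assms(2) by simp

lemma circ_cong:
  assumes "\<And>z. norm z = r \<Longrightarrow> F z = G z" "r > 0"
  shows "circ r F = circ r G"
  by (rule contour_integral_cong) (use assms in auto)

lemma circ_integrable:
  assumes "continuous_on (sphere 0 r) F" "r > 0"
  shows "F contour_integrable_on circlepath 0 r"
  by (rule contour_integrable_continuous_circlepath) (use assms in simp)

text \<open>The argument principle. Each linear factor adds a simple pole with residue 1 to the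
  logarithmic derivative, and the part without zeros contributes nothing by Cauchy's
  theorem.\<close>

lemma disc_zeros_count:
  assumes S: "open S" "cball 0 r \<subseteq> S" and r: "r > 0" and f: "f holomorphic_on S"
    and \<zeta>s: "disc_zeros f r S \<zeta>s"
  shows "circ r (\<lambda>z. deriv f z / f z) = 2 * of_real pi * \<i> * of_nat (length \<zeta>s)"
  using f \<zeta>s
proof (induction \<zeta>s arbitrary: f)
  case Nil
  then have nz: "f z \<noteq> 0" if "z \<in> cball 0 r" for z
    using that S(2) by (auto simp: disc_zeros_def subset_iff)
  have "(\<lambda>z. deriv f z / f z) holomorphic_on cball 0 r"
    using nz by (intro holomorphic_on_divide holomorphic_on_subset[OF holomorphic_deriv[OF Nil.prems(1) S(1)] S(2)]
       holomorphic_on_subset[OF Nil.prems(1) S(2)])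
  then have "((\<lambda>z. deriv f z / f z) has_contour_integral 0) (circlepath 0 r)"
    by (rule Cauchy_theorem_convex_simple) (use r in auto)
  then show ?case by (simp add: contour_integral_unique)
next
  case (Cons \<zeta> \<zeta>s)
  then obtain u where u: "set (\<zeta> # \<zeta>s) \<subseteq> ball 0 r" "u holomorphic_on S" "\<And>z. z \<in> cball 0 r \<Longrightarrow> u z \<noteq> 0"
    "\<And>z. z \<in> S \<Longrightarrow> f z = (\<Prod>\<zeta>\<leftarrow>\<zeta> # \<zeta>s. z - \<zeta>) * u z"
    unfolding disc_zeros_def by blast
  define g where "g z = (\<Prod>\<zeta>\<leftarrow>\<zeta>s. z - \<zeta>) * u z" for z
  have g: "g holomorphic_on S"
    unfolding g_def by (intro holomorphic_intros holomorphic_on_prod_list_linear u)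
  have "disc_zeros g r S \<zeta>s"
    using u unfolding disc_zeros_def g_def by auto
  from Cons.IH[OF g this] have IH: "circ r (\<lambda>z. deriv g z / g z) = 2 * of_real pi * \<i> * of_nat (length \<zeta>s)" .
  have on: "z \<in> S \<and> z \<noteq> \<zeta> \<and> g z \<noteq> 0" if "norm z = r" for z
    using that u(1) u(3)[of z] S(2) by (auto simp: g_def prod_list_linear_eq_0_iff)
  have "deriv f z / f z = 1 / (z - \<zeta>) + deriv g z / g z" if "norm z = r" for z
  proof -
    have z: "z \<in> S" "z \<noteq> \<zeta>" "g z \<noteq> 0" using on[OF that] by auto
    have "(g has_field_derivative deriv g z) (at z)"
      using g S(1) z(1) holomorphic_derivI by blast
    then have "((\<lambda>z. (z - \<zeta>) * g z) has_field_derivative g z + (z - \<zeta>) * deriv g z) (at z)"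
      by (auto intro!: derivative_eq_intros)
    then have "(f has_field_derivative g z + (z - \<zeta>) * deriv g z) (at z)"
      by (rule has_field_derivative_transform_within_open[OF _ S(1) z(1)]) (simp add: u(4) g_def)
    then have "deriv f z = g z + (z - \<zeta>) * deriv g z" by (rule DERIV_imp_deriv)
    moreover have "f z = (z - \<zeta>) * g z" using u(4) z by (simp add: g_def)
    ultimately have "deriv f z / f z = (g z + (z - \<zeta>) * deriv g z) / ((z - \<zeta>) * g z)" by simp
    also have "\<dots> = 1 / (z - \<zeta>) + deriv g z / g z"
      using z by (simp add: add_divide_distrib)
    finally show ?thesis .
  qed
  then have "circ r (\<lambda>z. deriv f z / f z) = circ r (\<lambda>z. 1 / (z - \<zeta>) + deriv g z / g z)"
    by (intro circ_cong r) auto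
  also have "\<dots> = circ r (\<lambda>z. 1 / (z - \<zeta>)) + circ r (\<lambda>z. deriv g z / g z)"
  proof (rule contour_integral_add)
    show "(\<lambda>z. 1 / (z - \<zeta>)) contour_integrable_on circlepath 0 r"
      by (rule circ_integrable) (use r on in \<open>auto intro!: continuous_intros\<close>)
    have "continuous_on S (deriv g)" "continuous_on S g"
      using g S(1) by (auto intro: holomorphic_on_imp_continuous_on holomorphic_deriv)
    then show "(\<lambda>z. deriv g z / g z) contour_integrable_on circlepath 0 r"
      using on by (intro circ_integrable r continuous_on_divide) (auto intro: continuous_on_subset)
  qed
  also have "circ r (\<lambda>z. 1 / (z - \<zeta>)) = 2 * of_real pi * \<i>"
    using contour_integral_cauchy[of "\<lambda>_. 1" r \<zeta>] u(1) by (simp add: contour_integral_unique)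
  finally show ?case by (simp add: IH algebra_simps)
qed

text \<open>One-variable residue duality: integrals against polynomials of degree below the number
  of zeros detect divisibility. Testing with the product of all linear factors but one leaves
  Cauchy's integral for the value of \<open>F\<close> at the remaining zero; that value is therefore
  0, and one factor can be divided out.\<close>

lemma holomorphic_divide_zeros:
  assumes S: "open S" "cball 0 r \<subseteq> S" and r: "r > 0" and "F holomorphic_on S" "set \<zeta>s \<subseteq> ball 0 r"
    and "\<And>p. Polynomial.degree p < length \<zeta>s \<Longrightarrow> circ r (\<lambda>z. F z * poly p z / (\<Prod>\<zeta>\<leftarrow>\<zeta>s. z - \<zeta>)) = 0"
  shows "\<exists>q. q holomorphic_on S \<and> (\<forall>z\<in>S. F z = (\<Prod>\<zeta>\<leftarrow>\<zeta>s. z - \<zeta>) * q z)"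
  using assms(4-)
proof (induction \<zeta>s arbitrary: F)
  case (Cons \<zeta> \<zeta>s)
  define p where "p = (\<Prod>\<zeta>\<leftarrow>\<zeta>s. [:- \<zeta>, 1:])"
  have poly_p: "poly p z = (\<Prod>\<zeta>\<leftarrow>\<zeta>s. z - \<zeta>)" for z
    unfolding p_def by (induction \<zeta>s) (auto simp: algebra_simps)
  have "Polynomial.degree p \<le> length \<zeta>s"
    unfolding p_def
  proof (induction \<zeta>s)
    case (Cons a \<zeta>s)
    then show ?case
      using degree_mult_le[of "[:- a, 1:]" "\<Prod>\<zeta>\<leftarrow>\<zeta>s. [:- \<zeta>, 1:]"] by simp
  qed simp
  have nz: "(\<Prod>\<zeta>\<leftarrow>\<zeta>s. z - \<zeta>) \<noteq> 0" "z \<noteq> \<zeta>" if "norm z = r" for z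
    using that Cons.prems(2) by (auto simp: prod_list_linear_eq_0_iff)
  have "circ r (\<lambda>z. F z / (z - \<zeta>)) = circ r (\<lambda>z. F z * poly p z / (\<Prod>\<zeta>\<leftarrow>\<zeta> # \<zeta>s. z - \<zeta>))"
    using nz by (intro circ_cong r) (auto simp: poly_p)
  also have "\<dots> = 0"
    using \<open>Polynomial.degree p \<le> length \<zeta>s\<close> by (intro Cons.prems) auto
  finally have "circ r (\<lambda>z. F z / (z - \<zeta>)) = 0" .
  moreover have "circ r (\<lambda>z. F z / (z - \<zeta>)) = 2 * of_real pi * \<i> * F \<zeta>"
    using Cons.prems(2)
    by (intro contour_integral_unique contour_integral_cauchy holomorphic_on_subset[OF Cons.prems(1) S(2)]) auto
  ultimately have "F \<zeta> = 0" by simp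
  then obtain F1 where F1: "F1 holomorphic_on S" "\<And>z. z \<in> S \<Longrightarrow> F z = (z - \<zeta>) * F1 z"
    using holomorphic_divide_zero[OF Cons.prems(1) S(1)] by blast
  have "\<exists>q. q holomorphic_on S \<and> (\<forall>z\<in>S. F1 z = (\<Prod>\<zeta>\<leftarrow>\<zeta>s. z - \<zeta>) * q z)"
  proof (rule Cons.IH[OF F1(1)])
    fix p :: "complex poly" assume p: "Polynomial.degree p < length \<zeta>s"
    have "circ r (\<lambda>z. F1 z * poly p z / (\<Prod>\<zeta>\<leftarrow>\<zeta>s. z - \<zeta>)) = circ r (\<lambda>z. F z * poly p z / (\<Prod>\<zeta>\<leftarrow>\<zeta> # \<zeta>s. z - \<zeta>))"
      using nz S(2) by (intro circ_cong r) (auto simp: F1(2) subset_iff)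
    also have "\<dots> = 0" using p by (intro Cons.prems) auto
    finally show "circ r (\<lambda>z. F1 z * poly p z / (\<Prod>\<zeta>\<leftarrow>\<zeta>s. z - \<zeta>)) = 0" .
  qed (use Cons.prems in auto)
  then show ?case using F1(2) by (auto simp: mult.assoc)
qed auto

text \<open>Division by the cofactor without zeros reduces this to
  \<open>holomorphic_divide_zeros\<close>, and by linearity monomials suffice as tests. The last
  clause writes the quotient as a circle integral of the data, which later makes it holomorphic in
  parameters.\<close>

lemma disc_zeros_division:
  assumes S: "open S" "cball 0 r \<subseteq> S" and r: "r > 0" and F: "F holomorphic_on S"
    and \<zeta>s: "disc_zeros f r S \<zeta>s"
    and zero: "\<And>i. i < length \<zeta>s \<Longrightarrow> circ r (\<lambda>z. F z * z ^ i / f z) = 0"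
  shows "\<exists>q. q holomorphic_on cball 0 r \<and> (\<forall>z\<in>cball 0 r. F z = f z * q z) \<and>
    (\<forall>z\<in>ball 0 r. q z = circ r (\<lambda>w. F w / f w / (w - z)) / (2 * of_real pi * \<i>))"
proof -
  obtain u where u: "set \<zeta>s \<subseteq> ball 0 r" "u holomorphic_on S" "\<And>z. z \<in> cball 0 r \<Longrightarrow> u z \<noteq> 0"
    "\<And>z. z \<in> S \<Longrightarrow> f z = (\<Prod>\<zeta>\<leftarrow>\<zeta>s. z - \<zeta>) * u z"
    using \<zeta>s unfolding disc_zeros_def by blast
  \<comment> \<open>On this smaller open set \<open>F / u\<close> is holomorphic, and it still
    contains the closed disc.\<close>
  define S' where "S' = {z\<in>S. u z \<noteq> 0}"
  have S': "open S'" "cball 0 r \<subseteq> S'" "S' \<subseteq> S"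
  proof -
    have "S' = S \<inter> u -` (- {0})" by (auto simp: S'_def)
    then show "open S'"
      using continuous_open_preimage[OF holomorphic_on_imp_continuous_on[OF u(2)] S(1), of "- {0}"] by auto
  qed (use S u in \<open>auto simp: S'_def\<close>)
  have contf: "continuous_on (cball 0 r) f"
  proof -
    have "continuous_on S (\<lambda>z. (\<Prod>\<zeta>\<leftarrow>\<zeta>s. z - \<zeta>) * u z)"
      by (intro holomorphic_on_imp_continuous_on holomorphic_intros holomorphic_on_prod_list_linear u)
    then have "continuous_on S f" using u(4) by (subst continuous_on_cong[OF refl]) auto
    then show ?thesis using S(2) by (rule continuous_on_subset)
  qed
  have contf_sphere: "continuous_on (sphere 0 r) f"
    by (rule continuous_on_subset[OF contf]) auto
  have contF_sphere: "continuous_on (sphere 0 r) F"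
    using S(2) by (intro continuous_on_subset[OF holomorphic_on_imp_continuous_on[OF F]]) auto
  have fnz: "f z \<noteq> 0" if "norm z = r" for z
    using that u(1) u(3,4)[of z] S(2) by (auto simp: prod_list_linear_eq_0_iff subset_iff)
  have "\<exists>q. q holomorphic_on S' \<and> (\<forall>z\<in>S'. F z / u z = (\<Prod>\<zeta>\<leftarrow>\<zeta>s. z - \<zeta>) * q z)"
  proof (rule holomorphic_divide_zeros[OF S'(1,2) r _ u(1)])
    show "(\<lambda>z. F z / u z) holomorphic_on S'"
      by (intro holomorphic_on_divide holomorphic_on_subset[OF F S'(3)] holomorphic_on_subset[OF u(2) S'(3)])
         (simp add: S'_def)
    fix p :: "complex poly" assume p: "Polynomial.degree p < length \<zeta>s"
    have "circ r (\<lambda>z. F z / u z * poly p z / (\<Prod>\<zeta>\<leftarrow>\<zeta>s. z - \<zeta>))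
        = circ r (\<lambda>z. \<Sum>i\<le>Polynomial.degree p. Polynomial.coeff p i * (F z * z ^ i / f z))"
    proof (rule circ_cong[OF _ r])
      fix z :: complex assume z: "norm z = r"
      then have "z \<in> S" using S(2) by auto
      then have "F z / u z * poly p z / (\<Prod>\<zeta>\<leftarrow>\<zeta>s. z - \<zeta>) = F z / f z * poly p z"
        using u(4)[of z] by (simp add: mult.commute)
      also have "\<dots> = (\<Sum>i\<le>Polynomial.degree p. Polynomial.coeff p i * (F z * z ^ i / f z))"
        by (simp add: poly_altdef sum_distrib_left mult_ac)
      finally show "F z / u z * poly p z / (\<Prod>\<zeta>\<leftarrow>\<zeta>s. z - \<zeta>) = (\<Sum>i\<le>Polynomial.degree p. Polynomial.coeff p i * (F z * z ^ i / f z))" .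
    qed
    also have "\<dots> = (\<Sum>i\<le>Polynomial.degree p. circ r (\<lambda>z. Polynomial.coeff p i * (F z * z ^ i / f z)))"
    proof (rule contour_integral_sum)
      fix i
      show "(\<lambda>z. Polynomial.coeff p i * (F z * z ^ i / f z)) contour_integrable_on circlepath 0 r"
        using fnz by (intro circ_integrable r continuous_intros contF_sphere contf_sphere) auto
    qed simp
    also have "\<dots> = 0"
    proof (rule sum.neutral, rule ballI)
      fix i assume "i \<in> {..Polynomial.degree p}"
      then have "circ r (\<lambda>z. F z * z ^ i / f z) = 0" using p by (intro zero) auto
      moreover have "(\<lambda>z. F z * z ^ i / f z) contour_integrable_on circlepath 0 r"
        using fnz by (intro circ_integrable r continuous_intros contF_sphere contf_sphere) auto
      ultimately show "circ r (\<lambda>z. Polynomial.coeff p i * (F z * z ^ i / f z)) = 0"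
        by (subst contour_integral_lmul) auto
    qed
    finally show "circ r (\<lambda>z. F z / u z * poly p z / (\<Prod>\<zeta>\<leftarrow>\<zeta>s. z - \<zeta>)) = 0" .
  qed
  then obtain q where q: "q holomorphic_on S'" "\<And>z. z \<in> S' \<Longrightarrow> F z / u z = (\<Prod>\<zeta>\<leftarrow>\<zeta>s. z - \<zeta>) * q z" by blast
  have eq: "F z = f z * q z" if "z \<in> S'" for z
    using q(2)[OF that] that u(4)[of z] by (auto simp: S'_def field_simps)
  show ?thesis
  proof (intro exI[of _ q] conjI ballI)
    show "q holomorphic_on cball 0 r" by (rule holomorphic_on_subset[OF q(1) S'(2)])
    show "F z = f z * q z" if "z \<in> cball 0 r" for z
      using that S'(2) by (intro eq) auto
    show "q z = circ r (\<lambda>w. F w / f w / (w - z)) / (2 * of_real pi * \<i>)" if z: "z \<in> ball 0 r" for z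
    proof -
      have "circ r (\<lambda>w. F w / f w / (w - z)) = circ r (\<lambda>w. q w / (w - z))"
      proof (rule circ_cong[OF _ r])
        fix w :: complex assume w: "norm w = r"
        then have "F w = f w * q w" using S'(2) by (intro eq) auto
        then show "F w / f w / (w - z) = q w / (w - z)" using fnz[OF w] by simp
      qed
      also have "\<dots> = 2 * of_real pi * \<i> * q z"
        by (intro contour_integral_unique contour_integral_cauchy holomorphic_on_subset[OF q(1) S'(2)] z)
      finally show ?thesis by simp
    qed
  qed
qed

text \<open>Since \<open>g\<close> does not vanish at the listed points, all of them are zeros of
  \<open>p\<close> with multiplicity, more than its degree permits. After a factor is cancelled, the
  identity is known only away from \<open>\<zeta>\<close>; continuity restores it there, which a
  repeated zero requires.\<close>

lemma poly_eq_0_if_divisible_by_zeros: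
  fixes p :: "complex poly"
  assumes "\<And>z. z \<in> ball 0 r \<Longrightarrow> poly p z * g z = (\<Prod>\<zeta>\<leftarrow>\<zeta>s. z - \<zeta>) * h z"
    and cont: "continuous_on (ball 0 r) g" "continuous_on (ball 0 r) h"
    and "set \<zeta>s \<subseteq> ball 0 r" "\<And>\<zeta>. \<zeta> \<in> set \<zeta>s \<Longrightarrow> g \<zeta> \<noteq> 0" "Polynomial.degree p < length \<zeta>s"
  shows "p = 0"
  using assms(1,4-)
proof (induction \<zeta>s arbitrary: p)
  case (Cons \<zeta> \<zeta>s)
  have "poly p \<zeta> = 0"
    using Cons.prems(1)[of \<zeta>] Cons.prems(2) Cons.prems(3)[of \<zeta>] by auto
  then obtain p' where p': "p = [:- \<zeta>, 1:] * p'"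
    by (auto simp: poly_eq_0_iff_dvd)
  have eq: "poly p' z * g z = (\<Prod>\<zeta>\<leftarrow>\<zeta>s. z - \<zeta>) * h z" if "z \<in> ball 0 r" for z
  proof -
    define k where "k z = poly p' z * g z - (\<Prod>\<zeta>\<leftarrow>\<zeta>s. z - \<zeta>) * h z" for z
    have k0: "k z = 0" if "z \<in> ball 0 r" "z \<noteq> \<zeta>" for z
    proof -
      have "(z - \<zeta>) * k z = 0"
        using Cons.prems(1)[OF that(1)] by (simp add: p' k_def algebra_simps)
      with that show ?thesis by simp
    qed
    have kc: "continuous_on (ball 0 r) k"
      unfolding k_def by (intro continuous_intros cont holomorphic_on_imp_continuous_on holomorphic_on_prod_list_linear)
    have "k z = 0" if zb: "z \<in> ball 0 r" for z
    proof (cases "z = \<zeta>")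
      case True
      have "isCont k \<zeta>"
        using kc zb True by (simp add: continuous_on_eq_continuous_at)
      then have "(k \<longlongrightarrow> k \<zeta>) (at \<zeta>)" by (simp add: isCont_def)
      moreover have "\<forall>\<^sub>F z in at \<zeta>. k z = 0"
        unfolding eventually_at_topological
        using zb True k0 by (intro exI[of _ "ball 0 r"]) auto
      then have "(k \<longlongrightarrow> 0) (at \<zeta>)" by (rule tendsto_eventually)
      ultimately show ?thesis using True tendsto_unique[of "at \<zeta>" k] by auto
    qed (use zb k0 in simp)
    then show ?thesis using that by (simp add: k_def)
  qed
  have "p' = 0"
  proof (rule ccontr)
    assume p'0: "p' \<noteq> 0"
    have "Polynomial.degree p = Suc (Polynomial.degree p')"
      using degree_mult_eq[of "[:- \<zeta>, 1:]" p'] p'0 by (simp add: p' del: mult_pCons_left)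
    then have "Polynomial.degree p' < length \<zeta>s"
      using Cons.prems(4) by simp
    from Cons.IH[OF eq _ _ this] Cons.prems(2,3) p'0 show False by auto
  qed
  then show ?case by (simp add: p')
qed simp

section \<open>Determinants of square arrays\<close>

definition mdet :: "nat \<Rightarrow> (nat \<Rightarrow> nat \<Rightarrow> 'a::comm_ring_1) \<Rightarrow> 'a"
  where "mdet d E = Determinant.det (Matrix.mat d d (\<lambda>(i, j). E i j))"

text \<open>The adjugate array, with the transposition built into the order of the indices: the case
  distinctions skip row \<open>l\<close> and column \<open>j\<close>.\<close>

definition madj :: "nat \<Rightarrow> (nat \<Rightarrow> nat \<Rightarrow> 'a::comm_ring_1) \<Rightarrow> nat \<Rightarrow> nat \<Rightarrow> 'a"
  where "madj d E j l = (-1) ^ (l + j) *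
    mdet (d - 1) (\<lambda>i' j'. E (if i' < l then i' else Suc i') (if j' < j then j' else Suc j'))"

lemma mdet_madj:
  assumes "i < d" "l < d"
  shows "(\<Sum>j<d. E i j * madj d E j l) = (if i = l then mdet d E else 0)"
proof -
  define A where "A = Matrix.mat d d (\<lambda>(i, j). E i j)"
  have A: "A \<in> carrier_mat d d" by (simp add: A_def)
  have adj: "adj_mat A $$ (j, l) = madj d E j l" if "j < d" for j
  proof -
    have "mat_delete A l j = Matrix.mat (d - 1) (d - 1)
        (\<lambda>(i', j'). E (if i' < l then i' else Suc i') (if j' < j then j' else Suc j'))"
      by (rule eq_matI) (auto simp: mat_delete_def A_def)
    then show ?thesis
      using that assms by (simp add: adj_mat_def cofactor_def madj_def mdet_def A_def[symmetric])
        (simp add: A_def)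
  qed
  have "(\<Sum>j<d. E i j * madj d E j l) = (A * adj_mat A) $$ (i, l)"
    using assms A adj_mat(1)[OF A]
    by (simp add: scalar_prod_def atLeast0LessThan adj) (simp add: A_def)
  also have "\<dots> = (if i = l then mdet d E else 0)"
    unfolding adj_mat(2)[OF A] using assms by (simp add: mdet_def A_def)
  finally show ?thesis .
qed

lemma mdet_eq_0_imp_kernel:
  fixes E :: "nat \<Rightarrow> nat \<Rightarrow> 'a::field"
  assumes "mdet d E = 0"
  shows "\<exists>v. (\<exists>j<d. v j \<noteq> 0) \<and> (\<forall>i<d. (\<Sum>j<d. E i j * v j) = 0)"
proof -
  define A where "A = Matrix.mat d d (\<lambda>(i, j). E i j)"
  have A: "A \<in> carrier_mat d d" by (simp add: A_def)
  obtain v where v: "v \<in> carrier_vec d" "v \<noteq> 0\<^sub>v d" "A *\<^sub>v v = 0\<^sub>v d"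
    using assms det_0_iff_vec_prod_zero_field[OF A] by (auto simp: mdet_def A_def)
  have "\<exists>j<d. vec_index v j \<noteq> 0"
  proof (rule ccontr)
    assume "\<not> ?thesis"
    then have "v = 0\<^sub>v d" using v(1) by (intro eq_vecI) auto
    with v(2) show False by simp
  qed
  moreover have "(\<Sum>j<d. E i j * vec_index v j) = 0" if "i < d" for i
  proof -
    have "(\<Sum>j<d. E i j * vec_index v j) = vec_index (A *\<^sub>v v) i"
      using that v(1) A by (simp add: scalar_prod_def atLeast0LessThan) (simp add: A_def)
    then show ?thesis using v(3) that by simp
  qed
  ultimately show ?thesis by blast
qed

lemma mdet_leibniz: "mdet d E = (\<Sum>p\<in>{p. p permutes {0..<d}}. signof p * (\<Prod>i=0..<d. E i (p i)))"
proof -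
  have "mdet d E = (\<Sum>p\<in>{p. p permutes {0..<d}}. signof p *
      (\<Prod>i=0..<d. Matrix.mat d d (\<lambda>(i, j). E i j) $$ (i, p i)))"
    unfolding mdet_def by (rule det_def') simp
  also have "\<dots> = (\<Sum>p\<in>{p. p permutes {0..<d}}. signof p * (\<Prod>i=0..<d. E i (p i)))"
    by (intro sum.cong refl arg_cong2[of _ _ _ _ "(*)"] prod.cong)
       (auto simp: permutes_in_image[of _ "{0..<d}"])
  finally show ?thesis .
qed

lemma mdet_zero_row:
  assumes "k < d" "\<And>j. E k j = 0"
  shows "mdet d E = 0"
  unfolding mdet_leibniz
proof (rule sum.neutral, rule ballI)
  fix p
  have "(\<Prod>i=0..<d. E i (p i)) = 0"
    using assms by (intro prod_zero bexI[of _ k]) auto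
  then show "signof p * (\<Prod>i=0..<d. E i (p i)) = 0" by simp
qed

lemma cdiff_on_mdet:
  assumes "\<And>i j. i < d \<Longrightarrow> j < d \<Longrightarrow> cdiff_on (\<lambda>x. E x i j) U"
  shows "cdiff_on (\<lambda>x. mdet d (E x)) U"
  unfolding mdet_leibniz
  by (intro cdiff_on_intros assms) (auto simp: permutes_in_image[of _ "{0..<d}"])

lemma cdiff_on_madj:
  assumes "\<And>i j. i < d \<Longrightarrow> j < d \<Longrightarrow> cdiff_on (\<lambda>x. E x i j) U"
  shows "cdiff_on (\<lambda>x. madj d (E x) j l) U"
  unfolding madj_def by (intro cdiff_on_intros cdiff_on_mdet assms) auto

section \<open>Eliminating a variable\<close>

definition upd :: "'n::finite \<Rightarrow> complex^'n \<Rightarrow> complex \<Rightarrow> complex^'n"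
  where "upd k x w = (\<chi> i. if i = k then w else x $ i)"

definition restr :: "'n::finite set \<Rightarrow> complex^'n \<Rightarrow> complex^'n"
  where "restr B x = (\<chi> i. if i \<in> B then x $ i else 0)"

lemmas cart_eq_iff = Finite_Cartesian_Product.vec_eq_iff

lemma upd_nth: "upd k x w $ i = (if i = k then w else x $ i)"
  by (simp add: upd_def)

lemma restr_nth: "restr B x $ i = (if i \<in> B then x $ i else 0)"
  by (simp add: restr_def)

lemma upd_self: "upd k x (x $ k) = x"
  by (simp add: cart_eq_iff upd_nth)

lemma norm_restr_le: "norm (restr B x) \<le> norm x"
  by (rule norm_le_componentwise_cart) (simp add: restr_nth)

lemma upd_eq: "upd k x w = restr (-{k}) x + axis k w"
  by (simp add: cart_eq_iff upd_nth restr_nth axis_def)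

lemma norm_upd_le: "norm (upd k x w) \<le> norm x + norm w"
  unfolding upd_eq using norm_triangle_ineq[of "restr (-{k}) x" "axis k w"] norm_restr_le[of "-{k}" x]
  by (simp add: norm_axis_complex)

lemma dist_upd_axis_le: "dist (upd k x w) (axis k w) \<le> norm x"
  by (simp add: upd_eq dist_norm norm_restr_le)

lemma linear_restr: "linear (restr B)"
  by (rule linearI) (simp_all add: cart_eq_iff restr_nth)

lemma restr_smult: "restr B (c *s v) = c *s restr B v"
  by (simp add: cart_eq_iff restr_nth)

lemma has_derivative_restr: "(restr B has_derivative restr B) (at x)"
  by (intro bounded_linear_imp_has_derivative linear_conv_bounded_linear[THEN iffD1] linear_restr)

lemma has_derivative_upd: "((\<lambda>x. upd k x w) has_derivative restr (-{k})) (at x)"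
  unfolding upd_eq using has_derivative_add[OF has_derivative_restr has_derivative_const] by simp

lemma continuous_on_upd [continuous_intros]:
  assumes "continuous_on S f" "continuous_on S g"
  shows "continuous_on S (\<lambda>p. upd k (f p) (g p))"
  unfolding upd_def
proof (rule continuous_on_vec_lambda)
  fix i show "continuous_on S (\<lambda>p. if i = k then g p else f p $ i)"
    using assms by (cases "i = k") (auto intro!: continuous_intros)
qed

lemma cdiff_on_upd:
  assumes "cdiff_on f V" "\<And>x. x \<in> U \<Longrightarrow> upd k x w \<in> V"
  shows "cdiff_on (\<lambda>x. f (upd k x w)) U"
  using cdiff_on_compose_linear[OF assms(1) has_derivative_upd assms(2) restr_smult] .

lemma has_field_derivative_upd:
  fixes f :: "complex^'n::finite \<Rightarrow> complex"
  assumes "cdiff_on f V" "upd k x w \<in> V"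
  shows "((\<lambda>w. f (upd k x w)) has_field_derivative partial_deriv k f (upd k x w)) (at w)"
proof -
  obtain D where D: "has_complex_derivative_at f D (upd k x w)"
    using assms unfolding cdiff_on_def by blast
  have "((\<lambda>z. f (upd k x w + axis k z)) has_field_derivative partial_deriv k f (upd k x w)) (at (w - w))"
    using partial_deriv_eq[OF D, of k] by simp
  then have "((\<lambda>z. f (upd k x w + axis k (z - w))) has_field_derivative partial_deriv k f (upd k x w)) (at w)"
    using DERIV_shift[of "\<lambda>z. f (upd k x w + axis k z)" _ w "- w"] by simp
  moreover have "upd k x w + axis k (z - w) = upd k x z" for z
    by (simp add: cart_eq_iff upd_nth axis_def)
  ultimately show ?thesis by simp
qed

lemma holomorphic_on_upd:
  assumes "cdiff_on f V" "\<And>w. w \<in> S \<Longrightarrow> upd k x w \<in> V"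
  shows "(\<lambda>w. f (upd k x w)) holomorphic_on S"
  using has_field_derivative_upd[OF assms(1)] assms(2)
  by (meson field_differentiable_at_within field_differentiable_def holomorphic_on_def)

lemma open_norm_nth_less:
  fixes U :: "(complex^'n::finite) set"
  assumes "open U" shows "open {x\<in>U. norm (x $ k) < r}"
proof -
  have "{x\<in>U. norm (x $ k) < r} = U \<inter> (\<lambda>x. x $ k) -` ball 0 r" by auto
  then show ?thesis
    using continuous_open_preimage[OF _ assms open_ball, of "\<lambda>x. x $ k" 0 r] by (simp add: continuous_intros)
qed

text \<open>Functions of the variables in \<open>B\<close> are encoded as functions of all variables that \<open>restr B\<close> does not change.\<close>

definition isolated_family :: "'n::finite set \<Rightarrow> nat \<Rightarrow> (nat \<Rightarrow> complex^'n \<Rightarrow> complex) \<Rightarrow> bool"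
  where "isolated_family B m F \<longleftrightarrow> (\<exists>\<delta>>0. (\<forall>a<m. cdiff_on (F a) (ball 0 \<delta>)) \<and>
    (\<forall>a<m. \<forall>x\<in>ball 0 \<delta>. F a (restr B x) = F a x) \<and>
    (\<forall>x\<in>ball 0 \<delta>. (\<forall>i. i \<notin> B \<longrightarrow> x $ i = 0) \<longrightarrow> (\<forall>a<m. F a x = 0) \<longrightarrow> x = 0))"

lemma axis_eq_upd: "axis k z = upd k 0 z"
  by (simp add: cart_eq_iff upd_nth axis_def)

lemma isolated_family_axis:
  fixes F :: "nat \<Rightarrow> complex^'n::finite \<Rightarrow> complex" and \<delta> :: real
  assumes \<delta>: "\<delta> > 0"
    and iso: "\<And>x. x \<in> ball 0 \<delta> \<Longrightarrow> (\<And>i. i \<notin> B \<Longrightarrow> x $ i = 0) \<Longrightarrow> (\<And>a. a < m \<Longrightarrow> F a x = 0) \<Longrightarrow> x = 0"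
    and k: "k \<in> B"
  shows "\<exists>a<m. F a (axis k (of_real (\<delta> / 2))) \<noteq> 0"
proof -
  define z0 where "z0 = complex_of_real (\<delta> / 2)"
  have "axis k z0 \<noteq> (0::complex^'n)"
    using \<delta> norm_axis_complex[of k z0] by (auto simp: z0_def)
  moreover have "axis k z0 \<in> ball (0::complex^'n) \<delta>"
    using \<delta> by (simp add: norm_axis_complex z0_def)
  moreover have "axis k z0 $ i = 0" if "i \<notin> B" for i
    using that k by (auto simp: axis_def)
  ultimately have "\<exists>a<m. F a (axis k z0) \<noteq> 0"
    using iso[of "axis k z0"] by blast
  then show ?thesis by (simp only: z0_def)
qed

text \<open>Some member is nonzero somewhere on the \<open>k\<close>-axis, so its restriction to the
  axis has no zero on small circles around the origin. A positive minimum on such a circle and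
  uniform continuity carry this over to nearby values of the other coordinates.\<close>

lemma isolated_family_regular:
  fixes F :: "nat \<Rightarrow> complex^'n::finite \<Rightarrow> complex"
  assumes \<delta>: "\<delta> > 0" and F: "\<And>a. a < m \<Longrightarrow> cdiff_on (F a) (ball 0 \<delta>)"
    and iso: "\<And>x. x \<in> ball 0 \<delta> \<Longrightarrow> (\<And>i. i \<notin> B \<Longrightarrow> x $ i = 0) \<Longrightarrow> (\<And>a. a < m \<Longrightarrow> F a x = 0) \<Longrightarrow> x = 0"
    and k: "k \<in> B"
  shows "\<exists>a r \<epsilon>. a < m \<and> 0 < r \<and> r < \<delta> / 2 \<and> 0 < \<epsilon> \<and> \<epsilon> \<le> \<delta> / 4 \<and>
    (\<forall>x\<in>ball 0 \<epsilon>. \<forall>w. norm w = r \<longrightarrow> F a (upd k x w) \<noteq> 0)"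
proof -
  define z0 where "z0 = complex_of_real (\<delta> / 2)"
  obtain a where a: "a < m" "F a (axis k z0) \<noteq> 0"
    using isolated_family_axis[of \<delta> B m F k, OF \<delta> iso k] unfolding z0_def by blast
  define g where "g z = F a (axis k z)" for z
  have "g holomorphic_on ball 0 \<delta>"
    unfolding g_def axis_eq_upd by (rule holomorphic_on_upd[OF F[OF a(1)]]) (simp add: axis_eq_upd[symmetric] norm_axis_complex)
  then have "\<forall>\<^sub>F w in at 0. g w \<noteq> 0 \<and> w \<in> ball 0 \<delta>"
    by (rule non_zero_neighbour_alt[of _ _ _ z0]) (use \<delta> a in \<open>auto simp: g_def z0_def\<close>)
  then obtain \<rho> where \<rho>: "\<rho> > 0" "\<And>w. w \<noteq> 0 \<Longrightarrow> norm w < \<rho> \<Longrightarrow> g w \<noteq> 0"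
    unfolding eventually_at by auto
  \<comment> \<open>A third keeps \<open>r\<close> below both \<open>\<rho>\<close> and
    \<open>\<delta> / 2\<close>. Together with the bound \<open>\<delta> / 4\<close> on
    \<open>\<epsilon>\<close> this leaves all points \<open>upd k x w\<close> within radius
    \<open>3 / 4 * \<delta>\<close>, where \<open>F a\<close> is uniformly continuous.\<close>
  define r where "r = min \<rho> \<delta> / 3"
  have r: "0 < r" "r < \<rho>" "r < \<delta> / 2" using \<rho> \<delta> by (auto simp: r_def min_def)
  have contF: "continuous_on (ball 0 \<delta>) (F a)"
    by (rule cdiff_on_imp_continuous_on[OF F[OF a(1)]])
  have sph: "compact (sphere (0::complex) r)" "sphere (0::complex) r \<noteq> {}" using r by auto
  have "continuous_on (sphere 0 r) g"
    unfolding g_def axis_eq_upd using r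
    by (intro continuous_on_compose2[OF contF] continuous_intros) (auto simp: axis_eq_upd[symmetric] norm_axis_complex)
  then have "continuous_on (sphere 0 r) (\<lambda>w. norm (g w))" by (rule continuous_on_norm)
  from continuous_attains_inf[OF sph this] obtain w0 where
    w0: "w0 \<in> sphere 0 r" "\<And>w. w \<in> sphere 0 r \<Longrightarrow> norm (g w0) \<le> norm (g w)" by auto
  define \<mu> where "\<mu> = norm (g w0)"
  have \<mu>: "\<mu> > 0" using \<rho>(2)[of w0] w0(1) r by (auto simp: \<mu>_def)
  have "uniformly_continuous_on (cball 0 (3 / 4 * \<delta>)) (F a)"
    using \<delta> by (intro compact_uniformly_continuous continuous_on_subset[OF contF]) auto
  then obtain d where d: "d > 0" "\<And>x y. x \<in> cball 0 (3 / 4 * \<delta>) \<Longrightarrow> y \<in> cball 0 (3 / 4 * \<delta>) \<Longrightarrow>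
      dist y x < d \<Longrightarrow> dist (F a y) (F a x) < \<mu>"
    unfolding uniformly_continuous_on_def using \<mu> by metis
  define \<epsilon> where "\<epsilon> = min d (\<delta> / 4)"
  have \<epsilon>: "0 < \<epsilon>" "\<epsilon> \<le> \<delta> / 4" "\<epsilon> \<le> d" using d \<delta> by (auto simp: \<epsilon>_def)
  have "F a (upd k x w) \<noteq> 0" if x: "x \<in> ball 0 \<epsilon>" and w: "norm w = r" for x w
  proof
    assume 0: "F a (upd k x w) = 0"
    have "norm (upd k x w) \<le> 3 / 4 * \<delta>"
      using norm_upd_le[of k x w] x w r \<epsilon> by auto
    moreover have "norm (axis k w :: complex^'n) \<le> 3 / 4 * \<delta>"
      using w r by (simp add: norm_axis_complex)
    moreover have "dist (upd k x w) (axis k w) < d"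
      using dist_upd_axis_le[of k x w] x \<epsilon> by auto
    ultimately have "dist (F a (upd k x w)) (F a (axis k w)) < \<mu>"
      by (intro d) auto
    with 0 w0(2)[of w] w show False by (simp add: \<mu>_def g_def)
  qed
  with a(1) r(1,3) \<epsilon>(1,2) show ?thesis by blast
qed

text \<open>By the argument principle the number of zeros is, up to a constant factor, a circle
  integral that depends continuously on \<open>x\<close>. Its values are discrete, and
  \<open>U\<close> is connected.\<close>

lemma disc_zeros_count_constant:
  fixes f :: "complex^'n::finite \<Rightarrow> complex"
  assumes f: "cdiff_on f V" and V: "open V" and U: "open U" "connected U" and S: "open S" "connected S" "cball 0 r \<subseteq> S"
    and r: "r > 0"
    and inV: "\<And>x w. x \<in> U \<Longrightarrow> w \<in> S \<Longrightarrow> upd k x w \<in> V"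
    and nz: "\<And>x w. x \<in> U \<Longrightarrow> norm w = r \<Longrightarrow> f (upd k x w) \<noteq> 0"
  shows "\<exists>d. \<forall>x\<in>U. \<exists>\<zeta>s. disc_zeros (\<lambda>w. f (upd k x w)) r S \<zeta>s \<and> length \<zeta>s = d"
proof -
  have hol: "(\<lambda>w. f (upd k x w)) holomorphic_on S" if "x \<in> U" for x
    by (rule holomorphic_on_upd[OF f]) (use inV that in auto)
  have "\<exists>\<zeta>s. disc_zeros (\<lambda>w. f (upd k x w)) r S \<zeta>s" if "x \<in> U" for x
    using disc_zeros_exists[OF S r hol[OF that] nz[OF that]] by blast
  then obtain Z where Z: "\<And>x. x \<in> U \<Longrightarrow> disc_zeros (\<lambda>w. f (upd k x w)) r S (Z x)" by metis
  define N where "N x = circ r (\<lambda>w. partial_deriv k f (upd k x w) / f (upd k x w))" for x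
  have pd: "cdiff_on (partial_deriv k f) V" by (rule cdiff_on_partial_deriv[OF V f])
  have sphS: "w \<in> S" if "norm w = r" for w using that S(3) by auto
  have N: "N x = 2 * of_real pi * \<i> * of_nat (length (Z x))" if x: "x \<in> U" for x
  proof -
    have "N x = circ r (\<lambda>w. deriv (\<lambda>w. f (upd k x w)) w / f (upd k x w))"
      unfolding N_def
      by (rule circ_cong[OF _ r])
         (simp add: DERIV_imp_deriv[OF has_field_derivative_upd[OF f inV[OF x sphS]]])
    also have "\<dots> = 2 * of_real pi * \<i> * of_nat (length (Z x))"
      by (rule disc_zeros_count[OF S(1,3) r hol[OF x] Z[OF x]])
    finally show ?thesis .
  qed
  have "cdiff_on N U"
    unfolding N_def
  proof (rule cdiff_on_contour_integral[OF U(1) r])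
    show "cdiff_on (\<lambda>x. partial_deriv k f (upd k x w) / f (upd k x w)) U" if "w \<in> sphere 0 r" for w
      using that inV nz sphS by (intro cdiff_on_divide cdiff_on_upd[OF f] cdiff_on_upd[OF pd]) auto
    show "continuous_on (U \<times> sphere 0 r) (\<lambda>(x, w). partial_deriv k f (upd k x w) / f (upd k x w))"
      unfolding split_beta using inV nz sphS
      by (intro continuous_on_divide continuous_on_compose2[OF cdiff_on_imp_continuous_on[OF f]]
          continuous_on_compose2[OF cdiff_on_imp_continuous_on[OF pd]] continuous_intros) auto
  qed
  then have "continuous_on U N" by (rule cdiff_on_imp_continuous_on)
  then have "N constant_on U"
  proof (rule continuous_discrete_range_constant[OF U(2)])
    fix x assume x: "x \<in> U"
    \<comment> \<open>Different values are at least \<open>2 * pi\<close> apart, so 1 serves as the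
      gap.\<close>
    show "\<exists>e>0. \<forall>y. y \<in> U \<and> N y \<noteq> N x \<longrightarrow> e \<le> norm (N y - N x)"
    proof (intro exI conjI allI impI)
      fix y assume y: "y \<in> U \<and> N y \<noteq> N x"
      have "N y - N x = 2 * of_real pi * \<i> * of_int (int (length (Z y)) - int (length (Z x)))"
        using y x by (simp add: N algebra_simps)
      then have "norm (N y - N x) = 2 * pi * of_int \<bar>int (length (Z y)) - int (length (Z x))\<bar>"
        by (simp add: norm_mult del: of_int_diff)
      moreover have "length (Z y) \<noteq> length (Z x)" using y x N by auto
      then have "1 \<le> \<bar>int (length (Z y)) - int (length (Z x))\<bar>" by linarith
      then have "(1::real) \<le> of_int \<bar>int (length (Z y)) - int (length (Z x))\<bar>" by linarith
      ultimately show "1 \<le> norm (N y - N x)"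
        using pi_gt3 mult_mono[of 1 "2 * pi" 1 "of_int \<bar>int (length (Z y)) - int (length (Z x))\<bar>"] by simp
    qed simp
  qed
  then obtain c where c: "\<And>x. x \<in> U \<Longrightarrow> N x = c" by (auto simp: constant_on_def)
  have "length (Z x) = length (Z y)" if "x \<in> U" "y \<in> U" for x y
  proof -
    have "2 * of_real pi * \<i> * of_nat (length (Z x)) = (2 * of_real pi * \<i> * of_nat (length (Z y)) :: complex)"
      using that c N by metis
    then show ?thesis by simp
  qed
  then have "\<exists>d. \<forall>x\<in>U. length (Z x) = d" by blast
  with Z show ?thesis by blast
qed

lemma circ_lincomb:
  assumes "\<And>j. j < d \<Longrightarrow> continuous_on (sphere 0 r) (h j)" "r > 0"
  shows "circ r (\<lambda>w. \<Sum>j<d. c j * h j w) = (\<Sum>j<(d::nat). c j * circ r (h j))"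
proof -
  have int: "h j contour_integrable_on circlepath 0 r" if "j < d" for j
    using assms that by (intro circ_integrable) auto
  have "circ r (\<lambda>w. \<Sum>j<d. c j * h j w) = (\<Sum>j<d. circ r (\<lambda>w. c j * h j w))"
    by (rule contour_integral_sum) (auto intro: contour_integrable_lmul int)
  also have "\<dots> = (\<Sum>j<d. c j * circ r (h j))"
    by (intro sum.cong refl contour_integral_lmul int) auto
  finally show ?thesis .
qed

lemma mult_sum_powers_expand:
  fixes a b w :: complex
  shows "a * (\<Sum>j<d. c j * w ^ j) * w ^ i / b = (\<Sum>j<d. c j * (a * w ^ (i + j) / b))"
  unfolding sum_distrib_left sum_distrib_right sum_divide_distrib
  by (rule sum.cong) (simp_all add: power_add)

text \<open>
  If \<open>f\<close> has \<open>d\<close> zeros in the disc, then the determinant of the \<open>d \<times> d\<close> Hankel array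
  of the moments of \<open>g / f\<close> is a resultant of \<open>f\<close> and \<open>g\<close>: it vanishes only if the two
  functions have a common zero, and it lies in the ideal generated by them.
\<close>

definition moment :: "real \<Rightarrow> (complex \<Rightarrow> complex) \<Rightarrow> (complex \<Rightarrow> complex) \<Rightarrow> nat \<Rightarrow> complex"
  where "moment r f g i = circ r (\<lambda>w. g w * w ^ i / f w)"

definition hankel :: "real \<Rightarrow> nat \<Rightarrow> (complex \<Rightarrow> complex) \<Rightarrow> (complex \<Rightarrow> complex) \<Rightarrow> complex"
  where "hankel r d f g = mdet d (\<lambda>i j. moment r f g (i + j))"

text \<open>Cramer's rule: the coefficients are the adjugate of the Hankel array applied to the
  moments of the constant 1. Hence \<open>g\<close> times this polynomial has the same first
  \<open>d\<close> moments as the constant \<open>hankel r d f g\<close>, and the difference is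
  divisible by \<open>f\<close>.\<close>

definition hankel_cofactor :: "real \<Rightarrow> nat \<Rightarrow> (complex \<Rightarrow> complex) \<Rightarrow> (complex \<Rightarrow> complex) \<Rightarrow> complex \<Rightarrow> complex"
  where "hankel_cofactor r d f g z =
    (\<Sum>j<d. (\<Sum>l<d. madj d (\<lambda>i j. moment r f g (i + j)) j l * moment r f (\<lambda>_. 1) l) * z ^ j)"

lemma disc_zeros_nonzero_on_circle:
  assumes "disc_zeros f r S \<zeta>s" "cball 0 r \<subseteq> S" "norm z = r"
  shows "f z \<noteq> 0"
proof -
  have z: "z \<in> cball 0 r" "z \<notin> ball 0 r" using assms(3) by auto
  then have "z \<in> S" "z \<notin> set \<zeta>s" using assms(1,2) unfolding disc_zeros_def by blast+
  then show ?thesis using assms(1) z by (auto simp: disc_zeros_def prod_list_linear_eq_0_iff)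
qed

text \<open>A kernel vector of the Hankel array is a nonzero polynomial \<open>p\<close> of degree
  below the number of zeros such that the relevant moments of \<open>g * p\<close> vanish, so
  \<open>f\<close> divides \<open>g * p\<close>. Without a common zero, every zero of
  \<open>f\<close> in the disc would be one of \<open>p\<close>.\<close>

lemma hankel_eq_0_imp_common_zero:
  assumes S: "open S" "cball 0 r \<subseteq> S" and r: "r > 0" and f: "f holomorphic_on S" and g: "g holomorphic_on S"
    and \<zeta>s: "disc_zeros f r S \<zeta>s" and zero: "hankel r (length \<zeta>s) f g = 0"
  shows "\<exists>\<zeta>\<in>set \<zeta>s. g \<zeta> = 0"
proof (rule ccontr)
  assume nz: "\<not> ?thesis"
  let ?d = "length \<zeta>s"
  from mdet_eq_0_imp_kernel[OF zero[unfolded hankel_def]]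
  obtain v j where v: "j < ?d" "v j \<noteq> 0" "\<And>i. i < ?d \<Longrightarrow> (\<Sum>j<?d. moment r f g (i + j) * v j) = 0"
    by blast
  define p where "p = (\<Sum>j<?d. Polynomial.monom (v j) j)"
  have coeff_p: "Polynomial.coeff p i = (if i < ?d then v i else 0)" for i
    by (simp add: p_def coeff_sum)
  have "p \<noteq> 0" using coeff_p[of j] v by auto
  have deg: "Polynomial.degree p < ?d"
    using v(1) by (intro degree_lessI) (auto simp: coeff_p)
  have poly_p: "poly p w = (\<Sum>j<?d. v j * w ^ j)" for w
    by (simp add: p_def poly_sum poly_monom)
  have sph: "sphere 0 r \<subseteq> S" using S(2) by auto
  have cf: "continuous_on (sphere 0 r) f" and cg: "continuous_on (sphere 0 r) g"
    using f g by (auto intro!: continuous_on_subset[OF holomorphic_on_imp_continuous_on sph])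
  have fnz: "f z \<noteq> 0" if "z \<in> sphere 0 r" for z
    using disc_zeros_nonzero_on_circle[OF \<zeta>s S(2)] that by simp
  have zero: "circ r (\<lambda>w. g w * poly p w * w ^ i / f w) = 0" if "i < ?d" for i
  proof -
    have "circ r (\<lambda>w. g w * poly p w * w ^ i / f w) = circ r (\<lambda>w. \<Sum>j<?d. v j * (g w * w ^ (i + j) / f w))"
      by (simp only: poly_p mult_sum_powers_expand)
    also have "\<dots> = (\<Sum>j<?d. v j * moment r f g (i + j))"
      unfolding moment_def by (intro circ_lincomb r continuous_intros cf cg) (use fnz in auto)
    also have "\<dots> = 0" using v(3)[OF that] by (simp add: mult.commute)
    finally show ?thesis .
  qed
  have "(\<lambda>w. g w * poly p w) holomorphic_on S"
    unfolding poly_p by (intro holomorphic_intros g)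
  from disc_zeros_division[OF S r this \<zeta>s zero]
  obtain q where q: "q holomorphic_on cball 0 r" "\<And>z. z \<in> cball 0 r \<Longrightarrow> g z * poly p z = f z * q z"
    by blast
  obtain u where u: "set \<zeta>s \<subseteq> ball 0 r" "u holomorphic_on S" "\<And>z. z \<in> S \<Longrightarrow> f z = (\<Prod>\<zeta>\<leftarrow>\<zeta>s. z - \<zeta>) * u z"
    using \<zeta>s unfolding disc_zeros_def by blast
  have "p = 0"
  proof (rule poly_eq_0_if_divisible_by_zeros[of r p g \<zeta>s "\<lambda>z. u z * q z"])
    fix z assume "z \<in> ball (0::complex) r"
    then show "poly p z * g z = (\<Prod>\<zeta>\<leftarrow>\<zeta>s. z - \<zeta>) * (u z * q z)"
      using q(2)[of z] u(3)[of z] S(2) by (auto simp: mult_ac subset_iff)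
  next
    have b: "ball 0 r \<subseteq> cball (0::complex) r" "ball 0 r \<subseteq> S" using S(2) by auto
    show "continuous_on (ball 0 r) g"
      by (rule continuous_on_subset[OF holomorphic_on_imp_continuous_on[OF g] b(2)])
    show "continuous_on (ball 0 r) (\<lambda>z. u z * q z)"
      by (intro continuous_on_mult continuous_on_subset[OF holomorphic_on_imp_continuous_on[OF u(2)] b(2)]
         continuous_on_subset[OF holomorphic_on_imp_continuous_on[OF q(1)] b(1)])
  qed (use u deg nz in auto)
  with \<open>p \<noteq> 0\<close> show False by simp
qed

text \<open>The coefficient of \<open>f\<close> is written out as a circle integral instead of being
  asserted to exist, because it has to be holomorphic in parameters as well.\<close>

lemma hankel_membership:
  assumes S: "open S" "cball 0 r \<subseteq> S" and r: "r > 0" and f: "f holomorphic_on S" and g: "g holomorphic_on S"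
    and \<zeta>s: "disc_zeros f r S \<zeta>s" "length \<zeta>s = d" and z: "z \<in> ball 0 r"
  shows "hankel r d f g = g z * hankel_cofactor r d f g z -
    f z * (circ r (\<lambda>w. (g w * hankel_cofactor r d f g w - hankel r d f g) / f w / (w - z)) / (2 * of_real pi * \<i>))"
proof -
  let ?m = "moment r f g" and ?adj = "madj d (\<lambda>i j. moment r f g (i + j))"
  define c where "c j = (\<Sum>l<d. ?adj j l * moment r f (\<lambda>_. 1) l)" for j
  define D where "D = hankel r d f g"
  define F where "F w = g w * hankel_cofactor r d f g w - D" for w
  have cof: "hankel_cofactor r d f g w = (\<Sum>j<d. c j * w ^ j)" for w
    by (simp add: hankel_cofactor_def c_def)
  have F: "F holomorphic_on S"
    unfolding F_def cof by (intro holomorphic_intros g)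
  have sph: "sphere 0 r \<subseteq> S" using S(2) by auto
  have cf: "continuous_on (sphere 0 r) f" and cg: "continuous_on (sphere 0 r) g"
    using f g by (auto intro!: continuous_on_subset[OF holomorphic_on_imp_continuous_on sph])
  have fnz: "f z \<noteq> 0" if "z \<in> sphere 0 r" for z
    using disc_zeros_nonzero_on_circle[OF \<zeta>s(1) S(2)] that by simp
  have zero: "circ r (\<lambda>w. F w * w ^ i / f w) = 0" if i: "i < d" for i
  proof -
    have adj: "(\<Sum>j<d. ?m (i + j) * ?adj j l) = (if i = l then D else 0)"
      if "l < d" for l
      using mdet_madj[OF i that, of "\<lambda>i j. ?m (i + j)"] by (simp add: D_def hankel_def)
    have "circ r (\<lambda>w. F w * w ^ i / f w) =
        circ r (\<lambda>w. (\<Sum>j<d. c j * (g w * w ^ (i + j) / f w)) - D * (1 * w ^ i / f w))"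
      by (simp only: F_def cof left_diff_distrib diff_divide_distrib mult_sum_powers_expand) simp
    also have "\<dots> = circ r (\<lambda>w. \<Sum>j<d. c j * (g w * w ^ (i + j) / f w)) - circ r (\<lambda>w. D * (1 * w ^ i / f w))"
      by (intro contour_integral_diff circ_integrable r continuous_intros cf cg) (use fnz in auto)
    also have "circ r (\<lambda>w. \<Sum>j<d. c j * (g w * w ^ (i + j) / f w)) = (\<Sum>j<d. c j * ?m (i + j))"
      unfolding moment_def by (intro circ_lincomb r continuous_intros cf cg) (use fnz in auto)
    also have "circ r (\<lambda>w. D * (1 * w ^ i / f w)) = D * moment r f (\<lambda>_. 1) i"
      unfolding moment_def by (intro contour_integral_lmul circ_integrable r continuous_intros cf) (use fnz in auto)
    \<comment> \<open>The Hankel array times its adjugate is \<open>D\<close> times the identity,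
      which leaves exactly the moment that is subtracted.\<close>
    also have "(\<Sum>j<d. c j * ?m (i + j))
      = (\<Sum>j<d. \<Sum>l<d. ?m (i + j) * ?adj j l * moment r f (\<lambda>_. 1) l)"
      by (simp add: c_def sum_distrib_left sum_distrib_right mult_ac)
    also have "\<dots> = (\<Sum>l<d. \<Sum>j<d. ?m (i + j) * ?adj j l * moment r f (\<lambda>_. 1) l)"
      by (rule sum.swap)
    also have "\<dots> = (\<Sum>l<d. (if i = l then D else 0) * moment r f (\<lambda>_. 1) l)"
      unfolding sum_distrib_right[symmetric]
      using adj by (intro sum.cong refl) auto
    also have "\<dots> = D * moment r f (\<lambda>_. 1) i"
      using i by (simp add: if_distrib[of "\<lambda>t. t * moment r f (\<lambda>_. 1) _"] cong: if_cong)
    finally show ?thesis by simp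
  qed
  from disc_zeros_division[OF S r F \<zeta>s(1), unfolded \<zeta>s(2), OF zero]
  obtain q where q: "\<And>z. z \<in> cball 0 r \<Longrightarrow> F z = f z * q z"
    "\<And>z. z \<in> ball 0 r \<Longrightarrow> q z = circ r (\<lambda>w. F w / f w / (w - z)) / (2 * of_real pi * \<i>)"
    by blast
  have "F z = f z * (circ r (\<lambda>w. F w / f w / (w - z)) / (2 * of_real pi * \<i>))"
    using q[of z] z by simp
  then show ?thesis by (simp add: F_def D_def algebra_simps)
qed

lemma cdiff_on_moment:
  fixes f g :: "complex^'n::finite \<Rightarrow> complex"
  assumes f: "cdiff_on f V" and g: "cdiff_on g V" and U: "open U" and r: "r > 0"
    and inV: "\<And>x w. x \<in> U \<Longrightarrow> norm w = r \<Longrightarrow> upd k x w \<in> V"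
    and nz: "\<And>x w. x \<in> U \<Longrightarrow> norm w = r \<Longrightarrow> f (upd k x w) \<noteq> 0"
  shows "cdiff_on (\<lambda>x. moment r (\<lambda>w. f (upd k x w)) (\<lambda>w. g (upd k x w)) i) U"
  unfolding moment_def
proof (rule cdiff_on_contour_integral[OF U r])
  show "cdiff_on (\<lambda>x. g (upd k x w) * w ^ i / f (upd k x w)) U" if "w \<in> sphere 0 r" for w
    using that inV nz by (intro cdiff_on_intros cdiff_on_upd[OF f] cdiff_on_upd[OF g]) auto
  show "continuous_on (U \<times> sphere 0 r) (\<lambda>(x, w). g (upd k x w) * w ^ i / f (upd k x w))"
    unfolding split_beta using inV nz
    by (intro continuous_intros continuous_on_compose2[OF cdiff_on_imp_continuous_on[OF f]]
        continuous_on_compose2[OF cdiff_on_imp_continuous_on[OF g]]) auto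
qed

lemma cdiff_on_hankel:
  fixes f g :: "complex^'n::finite \<Rightarrow> complex"
  assumes f: "cdiff_on f V" and g: "cdiff_on g V" and U: "open U" and r: "r > 0"
    and inV: "\<And>x w. x \<in> U \<Longrightarrow> norm w = r \<Longrightarrow> upd k x w \<in> V"
    and nz: "\<And>x w. x \<in> U \<Longrightarrow> norm w = r \<Longrightarrow> f (upd k x w) \<noteq> 0"
  shows "cdiff_on (\<lambda>x. hankel r d (\<lambda>w. f (upd k x w)) (\<lambda>w. g (upd k x w))) U"
  unfolding hankel_def by (intro cdiff_on_mdet cdiff_on_moment[OF f g U r inV nz]) auto

text \<open>The membership is evaluated at \<open>z = x $ k\<close>, where \<open>upd k x z\<close>
  is \<open>x\<close> itself. This needs \<open>x $ k\<close> inside the circle, hence the smaller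
  set \<open>W\<close>; the resultant on the left does not involve \<open>x $ k\<close>.\<close>

lemma hankel_in_ideal:
  fixes f g :: "complex^'n::finite \<Rightarrow> complex"
  assumes f: "cdiff_on f V" and g: "cdiff_on g V" and U: "open U" and S: "open S" "cball 0 r \<subseteq> S" and r: "r > 0"
    and inV: "\<And>x w. x \<in> U \<Longrightarrow> w \<in> S \<Longrightarrow> upd k x w \<in> V"
    and nz: "\<And>x w. x \<in> U \<Longrightarrow> norm w = r \<Longrightarrow> f (upd k x w) \<noteq> 0"
    and d: "\<And>x. x \<in> U \<Longrightarrow> \<exists>\<zeta>s. disc_zeros (\<lambda>w. f (upd k x w)) r S \<zeta>s \<and> length \<zeta>s = d"
  defines "W \<equiv> {x\<in>U. norm (x $ k) < r}"
  shows "\<exists>p q. cdiff_on p W \<and> cdiff_on q W \<and>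
    (\<forall>x\<in>W. hankel r d (\<lambda>w. f (upd k x w)) (\<lambda>w. g (upd k x w)) = g x * p x - f x * q x)"
proof -
  let ?f = "\<lambda>x w. f (upd k x w)" and ?g = "\<lambda>x w. g (upd k x w)"
  have inV': "upd k x w \<in> V" if "x \<in> U" "norm w = r" for x w
    using that S(2) by (intro inV) auto
  note mom = cdiff_on_moment[OF f _ U r inV' nz]
  define c where "c x j = (\<Sum>l<d. madj d (\<lambda>i j. moment r (?f x) (?g x) (i + j)) j l * moment r (?f x) (\<lambda>_. 1) l)" for x j
  have c: "cdiff_on (\<lambda>x. c x j) U" for j
    unfolding c_def by (intro cdiff_on_intros cdiff_on_madj mom[OF g] mom[OF cdiff_on_const]) auto
  have cof: "hankel_cofactor r d (?f x) (?g x) z = (\<Sum>j<d. c x j * z ^ j)" for x z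
    by (simp add: hankel_cofactor_def c_def)
  define D where "D x = hankel r d (?f x) (?g x)" for x
  have D: "cdiff_on D U"
    unfolding D_def by (rule cdiff_on_hankel[OF f g U r inV' nz])
  define p where "p x = (\<Sum>j<d. c x j * (x $ k) ^ j)" for x
  define q where "q x = circ r (\<lambda>w. (?g x w * (\<Sum>j<d. c x j * w ^ j) - D x) / ?f x w / (w - x $ k)) / (2 * of_real pi * \<i>)" for x
  have WU: "W \<subseteq> U" by (auto simp: W_def)
  have W: "open W" unfolding W_def by (rule open_norm_nth_less[OF U])
  have wk: "w \<noteq> x $ k" if "x \<in> W" "norm w = r" for x w
    using that by (auto simp: W_def)
  have "cdiff_on q W"
    unfolding q_def
  proof (rule cdiff_on_divide[OF _ cdiff_on_const], rule cdiff_on_contour_integral[OF W r])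
    show "cdiff_on (\<lambda>x. (?g x w * (\<Sum>j<d. c x j * w ^ j) - D x) / ?f x w / (w - x $ k)) W" if "w \<in> sphere 0 r" for w
      using that wk nz inV' WU
      by (intro cdiff_on_intros cdiff_on_upd[OF f] cdiff_on_upd[OF g] cdiff_on_subset[OF c WU] cdiff_on_subset[OF D WU])
         auto
    have cc: "continuous_on (W \<times> sphere 0 r) (\<lambda>p. c (fst p) j)" for j
      by (rule continuous_on_compose2[OF cdiff_on_imp_continuous_on[OF c]]) (use WU in \<open>auto intro!: continuous_intros\<close>)
    have cD: "continuous_on (W \<times> sphere 0 r) (\<lambda>p. D (fst p))"
      by (rule continuous_on_compose2[OF cdiff_on_imp_continuous_on[OF D]]) (use WU in \<open>auto intro!: continuous_intros\<close>)
    show "continuous_on (W \<times> sphere 0 r) (\<lambda>(x, w). (?g x w * (\<Sum>j<d. c x j * w ^ j) - D x) / ?f x w / (w - x $ k))"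
      unfolding split_beta using inV' nz WU wk
      by (intro continuous_intros cc cD continuous_on_compose2[OF cdiff_on_imp_continuous_on[OF f]]
          continuous_on_compose2[OF cdiff_on_imp_continuous_on[OF g]]) auto
  qed simp
  moreover have "cdiff_on p W"
    unfolding p_def by (intro cdiff_on_intros cdiff_on_subset[OF c WU])
  moreover have "hankel r d (?f x) (?g x) = g x * p x - f x * q x" if x: "x \<in> W" for x
  proof -
    have xU: "x \<in> U" using x WU by auto
    obtain \<zeta>s where \<zeta>s: "disc_zeros (?f x) r S \<zeta>s" "length \<zeta>s = d" using d[OF xU] by blast
    have "x $ k \<in> ball 0 r" using x by (simp add: W_def)
    from hankel_membership[OF S r holomorphic_on_upd[OF f inV[OF xU]] holomorphic_on_upd[OF g inV[OF xU]] \<zeta>s this]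
    show ?thesis by (simp add: cof upd_self p_def q_def D_def)
  qed
  ultimately show ?thesis by blast
qed

lemma hankel_cong:
  assumes "\<And>w. norm w = r \<Longrightarrow> f w = f' w" "\<And>w. norm w = r \<Longrightarrow> g w = g' w" "r > 0"
  shows "hankel r d f g = hankel r d f' g'"
proof -
  have "moment r f g i = moment r f' g' i" for i
    unfolding moment_def by (rule circ_cong) (use assms in auto)
  then show ?thesis by (simp add: hankel_def)
qed

text \<open>The product of the polynomials has at most \<open>length zs * m\<close> roots, one fewer
  than there are candidates.\<close>

lemma exists_nat_not_root:
  fixes P :: "'b \<Rightarrow> complex poly"
  assumes "\<And>z. z \<in> set zs \<Longrightarrow> P z \<noteq> 0" "\<And>z. z \<in> set zs \<Longrightarrow> Polynomial.degree (P z) \<le> m"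
  shows "\<exists>s<length zs * m + 1. \<forall>z\<in>set zs. poly (P z) (of_nat s) \<noteq> 0"
proof (rule ccontr)
  assume neg: "\<not> ?thesis"
  define Q where "Q = (\<Prod>z\<leftarrow>zs. P z)"
  have "Q \<noteq> 0" unfolding Q_def using assms(1) by (induction zs) auto
  have "Polynomial.degree Q \<le> length zs * m"
    unfolding Q_def using assms(2)
  proof (induction zs)
    case (Cons z zs)
    have "Polynomial.degree (P z * (\<Prod>z\<leftarrow>zs. P z)) \<le> m + length zs * m"
      by (rule order_trans[OF degree_mult_le]) (use Cons in \<open>auto intro: add_mono\<close>)
    then show ?case by simp
  qed simp
  have root: "poly Q x = 0" if "\<exists>z\<in>set zs. poly (P z) x = 0" for x
    unfolding Q_def using that by (induction zs) auto
  have sub: "of_nat ` {..length zs * m} \<subseteq> {x. poly Q x = 0}"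
    using neg by (auto intro!: root simp: less_Suc_eq_le)
  have "card (of_nat ` {..length zs * m} :: complex set) = length zs * m + 1"
    by (subst card_image) (auto simp: inj_on_def)
  moreover have "card (of_nat ` {..length zs * m} :: complex set) \<le> card {x. poly Q x = 0}"
    by (rule card_mono[OF poly_roots_finite[OF \<open>Q \<noteq> 0\<close>] sub])
  moreover have "card {x. poly Q x = 0} \<le> Polynomial.degree Q"
    by (rule card_poly_roots_bound[OF \<open>Q \<noteq> 0\<close>])
  ultimately show False using \<open>Polynomial.degree Q \<le> length zs * m\<close> by linarith
qed

text \<open>
  One member of the family does not vanish identically on the \<open>k\<close>-th axis. It is eliminated against
  sufficiently many members of the pencil \<open>\<Sum>a<m. s ^ a * F a\<close>: at a point over which there is no
  common zero, only finitely many \<open>s\<close> give a zero in common with it.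
\<close>

theorem eliminate_variable:
  fixes F :: "nat \<Rightarrow> complex^'n::finite \<Rightarrow> complex"
  assumes fam: "isolated_family B m F" and k: "k \<in> B"
  shows "\<exists>m' H. isolated_family (B - {k}) m' H \<and> (\<forall>s<m'. \<exists>c. (\<forall>a<m. holomorphic_near (c a) 0) \<and>
    (\<forall>\<^sub>F x in nhds 0. H s x = (\<Sum>a<m. c a x * F a x)))"
proof -
  obtain \<delta> where \<delta>: "\<delta> > 0" and F: "\<And>a. a < m \<Longrightarrow> cdiff_on (F a) (ball 0 \<delta>)"
    and FB: "\<And>a x. a < m \<Longrightarrow> x \<in> ball 0 \<delta> \<Longrightarrow> F a (restr B x) = F a x"
    and iso: "\<And>x. x \<in> ball 0 \<delta> \<Longrightarrow> (\<And>i. i \<notin> B \<Longrightarrow> x $ i = 0) \<Longrightarrow> (\<And>a. a < m \<Longrightarrow> F a x = 0) \<Longrightarrow> x = 0"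
    using fam unfolding isolated_family_def by blast
  from isolated_family_regular[of \<delta> m F B k, OF \<delta> F iso k]
  obtain a0 r \<epsilon> where a0: "a0 < m" and r: "0 < r" "r < \<delta> / 2" and \<epsilon>: "0 < \<epsilon>" "\<epsilon> \<le> \<delta> / 4"
    and nz: "\<And>x w. x \<in> ball 0 \<epsilon> \<Longrightarrow> norm w = r \<Longrightarrow> F a0 (upd k x w) \<noteq> 0"
    by blast
  define V where "V = ball (0::complex^'n) \<delta>"
  define U where "U = ball (0::complex^'n) \<epsilon>"
  \<comment> \<open>The radius exceeds \<open>r\<close>, and with \<open>\<epsilon>\<close> at most
    \<open>\<delta> / 4\<close> it keeps \<open>upd k x w\<close> inside \<open>V\<close>.\<close>
  define S where "S = ball (0::complex) (3 / 4 * \<delta>)"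
  have S: "open S" "connected S" "cball 0 r \<subseteq> S" using r by (auto simp: S_def)
  have U: "open U" "connected U" by (auto simp: U_def)
  have inV: "upd k x w \<in> V" if "x \<in> U" "w \<in> S" for x w
    using that norm_upd_le[of k x w] \<epsilon> by (auto simp: U_def V_def S_def)
  have inV': "upd k x w \<in> V" if "x \<in> U" "norm w = r" for x w
    using that S(3) by (intro inV) auto
  have nzU: "F a0 (upd k x w) \<noteq> 0" if "x \<in> U" "norm w = r" for x w
    using nz that by (simp add: U_def)
  have FV: "cdiff_on (F a) V" if "a < m" for a using F[OF that] by (simp add: V_def)
  have "open V" by (simp add: V_def)
  from disc_zeros_count_constant[OF FV[OF a0] this U S r(1) inV nzU]
  obtain d where d: "\<And>x. x \<in> U \<Longrightarrow> \<exists>\<zeta>s. disc_zeros (\<lambda>w. F a0 (upd k x w)) r S \<zeta>s \<and> length \<zeta>s = d"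
    by blast
  define g where "g s y = (\<Sum>a<m. of_nat s ^ a * F a y)" for s :: nat and y
  have g: "cdiff_on (g s) V" for s
    unfolding g_def by (intro cdiff_on_intros FV) auto
  define H where "H s x = hankel r d (\<lambda>w. F a0 (upd k x w)) (\<lambda>w. g s (upd k x w))" for s x
  \<comment> \<open>At each of the \<open>d\<close> zeros the pencil is a polynomial in
    \<open>s\<close> of degree at most \<open>m\<close>, so one of \<open>d * m + 1\<close> values
    of \<open>s\<close> avoids all roots.\<close>
  define m' where "m' = d * m + 1"
  have "isolated_family (B - {k}) m' H"
    unfolding isolated_family_def
  proof (intro exI[of _ \<epsilon>] conjI allI ballI impI \<epsilon>(1))
    show "cdiff_on (H s) (ball 0 \<epsilon>)" for s
      unfolding H_def U_def[symmetric] by (rule cdiff_on_hankel[OF FV[OF a0] g U(1) r(1) inV' nzU])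
    fix s and x :: "complex^'n" assume x: "x \<in> ball 0 \<epsilon>"
    then have xU: "x \<in> U" by (simp add: U_def)
    have upd_restr: "upd k (restr (B - {k}) x) w = restr B (upd k x w)" for w
      using k by (simp add: cart_eq_iff upd_nth restr_nth)
    have *: "F a (upd k (restr (B - {k}) x) w) = F a (upd k x w)" if "a < m" "norm w = r" for a w
      unfolding upd_restr using FB[OF that(1)] inV'[OF xU that(2)] by (simp add: V_def)
    show "H s (restr (B - {k}) x) = H s x"
      unfolding H_def by (rule hankel_cong[OF _ _ r(1)]) (auto simp: g_def * a0)
  next
    fix x :: "complex^'n"
    assume x: "x \<in> ball 0 \<epsilon>" "\<forall>i. i \<notin> B - {k} \<longrightarrow> x $ i = 0" "\<forall>s<m'. H s x = 0"
    then have xU: "x \<in> U" by (simp add: U_def)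
    show "x = 0"
    proof (rule ccontr)
      assume "x \<noteq> 0"
      \<comment> \<open>This index differs from \<open>k\<close>, since \<open>x $ k = 0\<close>. So
        \<open>upd k x \<zeta>\<close> is nonzero for each \<open>\<zeta>\<close>, and the members
        of the family cannot all vanish there; this makes \<open>P \<zeta>\<close> a nonzero
        polynomial.\<close>
      then obtain i where i: "x $ i \<noteq> 0" by (auto simp: cart_eq_iff)
      obtain \<zeta>s where \<zeta>s: "disc_zeros (\<lambda>w. F a0 (upd k x w)) r S \<zeta>s" "length \<zeta>s = d" using d[OF xU] by blast
      have \<zeta>S: "\<zeta> \<in> S" if "\<zeta> \<in> set \<zeta>s" for \<zeta>
        using \<zeta>s(1) that S(3) unfolding disc_zeros_def by (meson ball_subset_cball subsetD)
      define P where "P \<zeta> = (\<Sum>a<m. Polynomial.monom (F a (upd k x \<zeta>)) a)" for \<zeta>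
      have coeff_P: "Polynomial.coeff (P \<zeta>) a = (if a < m then F a (upd k x \<zeta>) else 0)" for \<zeta> a
        by (simp add: P_def coeff_sum)
      have "P \<zeta> \<noteq> 0" if "\<zeta> \<in> set \<zeta>s" for \<zeta>
      proof
        assume P0: "P \<zeta> = 0"
        have "F a (upd k x \<zeta>) = 0" if "a < m" for a
          using coeff_P[of \<zeta> a] that P0 by simp
        moreover have "upd k x \<zeta> \<in> ball 0 \<delta>" using inV[OF xU \<zeta>S[OF that]] by (simp add: V_def)
        moreover have "upd k x \<zeta> $ i = 0" if "i \<notin> B" for i
          using that k x(2) by (auto simp: upd_nth)
        ultimately have "upd k x \<zeta> = 0" using iso by blast
        moreover have "upd k x \<zeta> $ i = x $ i" using i x(2) by (auto simp: upd_nth)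
        ultimately show False using i by simp
      qed
      moreover have "Polynomial.degree (P \<zeta>) \<le> m" for \<zeta>
        by (rule degree_le) (simp add: coeff_P)
      ultimately obtain s where s: "s < m'" "\<And>\<zeta>. \<zeta> \<in> set \<zeta>s \<Longrightarrow> poly (P \<zeta>) (of_nat s) \<noteq> 0"
        using exists_nat_not_root[of \<zeta>s P m] \<zeta>s(2) by (auto simp: m'_def)
      have "\<exists>\<zeta>\<in>set \<zeta>s. g s (upd k x \<zeta>) = 0"
        by (rule hankel_eq_0_imp_common_zero[OF S(1,3) r(1) holomorphic_on_upd[OF FV[OF a0] inV[OF xU]]
              holomorphic_on_upd[OF g inV[OF xU]] \<zeta>s(1)])
           (use x(3) s(1) \<zeta>s(2) in \<open>auto simp: H_def\<close>)
      with s(2) show False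
        by (auto simp: P_def g_def poly_sum poly_monom mult.commute)
    qed
  qed
  moreover have "\<exists>c. (\<forall>a<m. holomorphic_near (c a) 0) \<and> (\<forall>\<^sub>F x in nhds 0. H s x = (\<Sum>a<m. c a x * F a x))" for s
  proof -
    define W where "W = {x\<in>U. norm (x $ k) < r}"
    from hankel_in_ideal[OF FV[OF a0] g U(1) S(1,3) r(1) inV nzU d, of s]
    obtain p q where pq: "cdiff_on p W" "cdiff_on q W"
      "\<And>x. x \<in> W \<Longrightarrow> H s x = g s x * p x - F a0 x * q x"
      unfolding W_def H_def by blast
    have W: "open W" unfolding W_def by (rule open_norm_nth_less[OF U(1)])
    have W0: "0 \<in> W" using r \<epsilon> by (simp add: W_def U_def)
    define c where "c a x = of_nat s ^ a * p x - (if a = a0 then q x else 0)" for a x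
    have "cdiff_on (c a) W" for a
      unfolding c_def by (cases "a = a0") (auto intro!: cdiff_on_intros pq(1,2))
    then have "holomorphic_near (c a) 0" for a
      using holomorphic_near_if_cdiff_on[OF _ W W0] by blast
    moreover have "\<forall>\<^sub>F x in nhds 0. H s x = (\<Sum>a<m. c a x * F a x)"
      unfolding eventually_nhds
    proof (intro exI[of _ W] conjI ballI W W0)
      fix x assume "x \<in> W"
      then have "H s x = g s x * p x - F a0 x * q x" by (rule pq)
      also have "F a0 x * q x = (\<Sum>a<m. (if a = a0 then q x else 0) * F a x)"
        using a0 by (simp add: if_distrib[of "\<lambda>t. t * _"] cong: if_cong)
      also have "g s x * p x = (\<Sum>a<m. of_nat s ^ a * p x * F a x)"
        unfolding g_def sum_distrib_right by (simp add: mult_ac)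
      finally show "H s x = (\<Sum>a<m. c a x * F a x)"
        by (simp add: c_def left_diff_distrib sum_subtractf)
    qed
    ultimately show ?thesis by blast
  qed
  ultimately show ?thesis by blast
qed

section \<open>Germs\<close>

lemma holomorphic_near_rep_germ: "holomorphic_near (rep_germ g) 0"
  using Quotient3_rep_reflp[OF Quotient3_germ, of g] by (simp add: germ_rel_def)

lemma rep_germ_abs_germ: "holomorphic_near f 0 \<Longrightarrow> \<forall>\<^sub>F x in nhds 0. rep_germ (abs_germ f) x = f x"
  using Quotient3_rep_abs[OF Quotient3_germ, of f] by (simp add: germ_rel_def)

lemma germ_eq_iff: "f = g \<longleftrightarrow> (\<forall>\<^sub>F x in nhds 0. rep_germ f x = rep_germ g x)"
  using Quotient3_rel_rep[OF Quotient3_germ, of f g] by (simp add: germ_rel_def holomorphic_near_rep_germ)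

lemma abs_germ_eqI:
  assumes "holomorphic_near f 0" "\<forall>\<^sub>F x in nhds 0. f x = rep_germ g x"
  shows "abs_germ f = g"
  unfolding germ_eq_iff using rep_germ_abs_germ[OF assms(1)] assms(2) by eventually_elim simp

lemma rep_germ_const: "\<forall>\<^sub>F x in nhds 0. rep_germ (const_germ c) x = c"
  using rep_germ_abs_germ[OF holomorphic_near_const] by (simp add: const_germ_def)

lemma rep_germ_zero: "\<forall>\<^sub>F x in nhds 0. rep_germ 0 x = 0"
  using rep_germ_abs_germ[OF holomorphic_near_const] by (simp add: zero_germ_def)

lemma rep_germ_one: "\<forall>\<^sub>F x in nhds 0. rep_germ 1 x = 1"
  using rep_germ_abs_germ[OF holomorphic_near_const] by (simp add: one_germ_def)

lemma rep_germ_add: "\<forall>\<^sub>F x in nhds 0. rep_germ (f + g) x = rep_germ f x + rep_germ g x"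
  using rep_germ_abs_germ[OF holomorphic_near_add[OF holomorphic_near_rep_germ[of f] holomorphic_near_rep_germ[of g]]]
  by (simp add: plus_germ_def)

lemma rep_germ_mult: "\<forall>\<^sub>F x in nhds 0. rep_germ (f * g) x = rep_germ f x * rep_germ g x"
  using rep_germ_abs_germ[OF holomorphic_near_mult[OF holomorphic_near_rep_germ[of f] holomorphic_near_rep_germ[of g]]]
  by (simp add: times_germ_def)

lemma rep_germ_uminus: "\<forall>\<^sub>F x in nhds 0. rep_germ (- f) x = - rep_germ f x"
  using rep_germ_abs_germ[OF holomorphic_near_uminus[OF holomorphic_near_rep_germ[of f]]]
  by (simp add: uminus_germ_def)

lemma rep_germ_power: "\<forall>\<^sub>F x in nhds 0. rep_germ (f ^ m) x = rep_germ f x ^ m"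
proof (induction m)
  case 0
  show ?case using rep_germ_one by simp
next
  case (Suc m)
  show ?case using Suc.IH rep_germ_mult[of f "f ^ m"] by eventually_elim simp
qed

lemma rep_germ_sum: "\<forall>\<^sub>F x in nhds 0. rep_germ (\<Sum>i\<in>I. f i) x = (\<Sum>i\<in>I. rep_germ (f i) x)"
proof (induction I rule: infinite_finite_induct)
  case (insert i I)
  show ?case using insert.IH rep_germ_add[of "f i" "\<Sum>i\<in>I. f i"]
    by eventually_elim (use insert.hyps in simp)
qed (use rep_germ_zero in simp_all)

lemma rep_germ_partial: "\<forall>\<^sub>F x in nhds 0. rep_germ (partial_germ i f) x = partial_deriv i (rep_germ f) x"
  using rep_germ_abs_germ[OF holomorphic_near_partial_deriv[OF holomorphic_near_rep_germ[of f]]]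
  by (simp add: partial_germ_def)

lemmas rep_germ_at_0 =
  rep_germ_const[THEN eventually_nhds_x_imp_x] rep_germ_zero[THEN eventually_nhds_x_imp_x]
  rep_germ_one[THEN eventually_nhds_x_imp_x] rep_germ_add[THEN eventually_nhds_x_imp_x]
  rep_germ_mult[THEN eventually_nhds_x_imp_x] rep_germ_uminus[THEN eventually_nhds_x_imp_x]
  rep_germ_power[THEN eventually_nhds_x_imp_x] rep_germ_sum[THEN eventually_nhds_x_imp_x]

lemma rep_germ_cdiff_on:
  obtains \<delta> where "\<delta> > 0" "cdiff_on (rep_germ g) (ball 0 \<delta>)"
  using holomorphic_near_rep_germ[of g] by (auto simp: holomorphic_near_eq)

lemma germ_unit:
  assumes "rep_germ g 0 \<noteq> 0"
  obtains h where "g * h = 1"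
proof -
  obtain \<delta> where \<delta>: "\<delta> > 0" "cdiff_on (rep_germ g) (ball 0 \<delta>)" by (rule rep_germ_cdiff_on)
  have "isCont (rep_germ g) 0"
    using cdiff_on_imp_continuous_on[OF \<delta>(2)] \<delta>(1) by (simp add: continuous_on_eq_continuous_at)
  then obtain e where e: "e > 0" "\<And>x. dist 0 x < e \<Longrightarrow> rep_germ g x \<noteq> 0"
    using continuous_at_avoid[of 0 "rep_germ g" 0] assms by auto
  define U where "U = ball (0::complex^'a) (min e \<delta>)"
  have U: "open U" "0 \<in> U" using e \<delta> by (auto simp: U_def)
  have nz: "rep_germ g x \<noteq> 0" if "x \<in> U" for x using that e by (auto simp: U_def)
  have "cdiff_on (\<lambda>x. 1 / rep_germ g x) U"
    by (intro cdiff_on_divide cdiff_on_const cdiff_on_subset[OF \<delta>(2)] nz) (auto simp: U_def)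
  then have h: "holomorphic_near (\<lambda>x. 1 / rep_germ g x) 0" by (rule holomorphic_near_if_cdiff_on[OF _ U])
  have "\<forall>\<^sub>F x in nhds 0. x \<in> U" using U by (simp add: eventually_nhds_in_open)
  with rep_germ_abs_germ[OF h] rep_germ_mult[of g "abs_germ (\<lambda>x. 1 / rep_germ g x)"] rep_germ_one
  have "\<forall>\<^sub>F x in nhds 0. rep_germ (g * abs_germ (\<lambda>x. 1 / rep_germ g x)) x = rep_germ 1 x"
    by eventually_elim (simp add: nz)
  then have "g * abs_germ (\<lambda>x. 1 / rep_germ g x) = 1" by (simp add: germ_eq_iff)
  with that show ?thesis by blast
qed

section \<open>Coordinate germs, substitution of zero, and division by a coordinate\<close>

definition coord :: "'n::finite \<Rightarrow> 'n germ"
  where "coord i = abs_germ (\<lambda>x. x $ i)"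

lemma rep_germ_coord: "\<forall>\<^sub>F x in nhds 0. rep_germ (coord i) x = x $ i"
  unfolding coord_def
  by (intro rep_germ_abs_germ holomorphic_near_if_cdiff_on[OF cdiff_on_component, of UNIV]) auto

lemma rep_germ_coord_0: "rep_germ (coord i) 0 = 0"
  using rep_germ_coord[THEN eventually_nhds_x_imp_x] by simp

lemma eventually_upd_0:
  assumes "\<forall>\<^sub>F x in nhds 0. P x"
  shows "\<forall>\<^sub>F x in nhds 0. P (upd k x 0)"
proof -
  obtain d where d: "d > 0" "\<And>x. norm x < d \<Longrightarrow> P x"
    using assms by (auto simp: eventually_nhds_metric)
  have "P (upd k x 0)" if "norm x < d" for x
    by (rule d) (use that norm_upd_le[of k x 0] in simp)
  with d(1) show ?thesis by (auto simp: eventually_nhds_metric)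
qed

lemma holomorphic_near_upd_0:
  assumes "holomorphic_near f 0"
  shows "holomorphic_near (\<lambda>x. f (upd k x 0)) 0"
proof -
  obtain \<delta> where \<delta>: "\<delta> > 0" "cdiff_on f (ball 0 \<delta>)" using assms by (auto simp: holomorphic_near_eq)
  have "cdiff_on (\<lambda>x. f (upd k x 0)) (ball 0 \<delta>)"
  proof (rule cdiff_on_upd[OF \<delta>(2)])
    show "upd k x 0 \<in> ball 0 \<delta>" if "x \<in> ball 0 \<delta>" for x
      using that norm_upd_le[of k x 0] by simp
  qed
  with \<delta>(1) show ?thesis by (auto simp: holomorphic_near_eq)
qed

definition subst0 :: "'n::finite \<Rightarrow> 'n germ \<Rightarrow> 'n germ"
  where "subst0 k f = abs_germ (\<lambda>x. rep_germ f (upd k x 0))"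

lemma rep_germ_subst0: "\<forall>\<^sub>F x in nhds 0. rep_germ (subst0 k f) x = rep_germ f (upd k x 0)"
  unfolding subst0_def by (intro rep_germ_abs_germ holomorphic_near_upd_0 holomorphic_near_rep_germ)

lemma subst0_add: "subst0 k (f + g) = subst0 k f + subst0 k g"
  unfolding germ_eq_iff
  using rep_germ_subst0[of k "f + g"] rep_germ_subst0[of k f] rep_germ_subst0[of k g]
    eventually_upd_0[OF rep_germ_add[of f g], of k] rep_germ_add[of "subst0 k f" "subst0 k g"]
  by eventually_elim simp

lemma subst0_mult: "subst0 k (f * g) = subst0 k f * subst0 k g"
  unfolding germ_eq_iff
  using rep_germ_subst0[of k "f * g"] rep_germ_subst0[of k f] rep_germ_subst0[of k g]
    eventually_upd_0[OF rep_germ_mult[of f g], of k] rep_germ_mult[of "subst0 k f" "subst0 k g"]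
  by eventually_elim simp

lemma subst0_coord: "subst0 k (coord i) = (if i = k then 0 else coord i)"
  unfolding germ_eq_iff
  using rep_germ_subst0[of k "coord i"] eventually_upd_0[OF rep_germ_coord[of i], of k] rep_germ_coord[of i] rep_germ_zero
  by eventually_elim (simp add: upd_nth)

lemma subst0_zero: "subst0 k 0 = 0"
  using subst0_add[of k 0 0] by simp

lemma subst0_power: "m > 0 \<Longrightarrow> subst0 k (f ^ m) = subst0 k f ^ m"
proof (induction m rule: nat_induct_non_zero)
  case (Suc m)
  then show ?case by (simp add: subst0_mult)
qed simp

lemma subst0_sum: "subst0 k (\<Sum>i\<in>I. f i) = (\<Sum>i\<in>I. subst0 k (f i))"
  by (induction I rule: infinite_finite_induct) (simp_all add: subst0_zero subst0_add)

text \<open>The Cauchy kernels for \<open>x $ k\<close> and for 0 differ by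
  \<open>x $ k / (w * (w - x $ k))\<close>. The factor \<open>x $ k\<close> leaves the integral, and
  what remains is holomorphic on the hyperplane as well.\<close>

lemma hadamard:
  obtains q where "f = subst0 k f + coord k * q"
proof -
  obtain \<delta> where \<delta>: "\<delta> > 0" "cdiff_on (rep_germ f) (ball 0 \<delta>)" by (rule rep_germ_cdiff_on)
  define F where "F = rep_germ f"
  define r where "r = \<delta> / 2"
  define U where "U = ball (0::complex^'a) r"
  have r: "r > 0" and U: "open U" "0 \<in> U" using \<delta> by (auto simp: r_def U_def)
  have F: "cdiff_on F (ball 0 \<delta>)" using \<delta> by (simp add: F_def)
  have inV: "upd k x w \<in> ball 0 \<delta>" if "x \<in> U" "norm w \<le> r" for x w
    using norm_upd_le[of k x w] that by (auto simp: U_def r_def)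
  have xk: "norm (x $ k) < r" if "x \<in> U" for x
    using that Finite_Cartesian_Product.norm_nth_le[of x k] by (simp add: U_def)
  have nz: "w \<noteq> 0" "w \<noteq> x $ k" if "x \<in> U" "norm w = r" for x w
    using that r xk[of x] by auto
  define q where "q x = circ r (\<lambda>w. F (upd k x w) / (w * (w - x $ k))) / (2 * of_real pi * \<i>)" for x
  have "cdiff_on q U"
    unfolding q_def
  proof (rule cdiff_on_divide[OF _ cdiff_on_const], rule cdiff_on_contour_integral[OF U(1) r])
    show "cdiff_on (\<lambda>x. F (upd k x w) / (w * (w - x $ k))) U" if "w \<in> sphere 0 r" for w
      using that nz inV by (intro cdiff_on_intros cdiff_on_upd[OF F]) auto
    show "continuous_on (U \<times> sphere 0 r) (\<lambda>(x, w). F (upd k x w) / (w * (w - x $ k)))"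
      unfolding split_beta using nz inV
      by (intro continuous_intros continuous_on_compose2[OF cdiff_on_imp_continuous_on[OF F]]) auto
  qed simp
  then have q: "holomorphic_near q 0" by (rule holomorphic_near_if_cdiff_on[OF _ U])
  have eq: "F x = F (upd k x 0) + x $ k * q x" if x: "x \<in> U" for x
  proof -
    have hol: "(\<lambda>w. F (upd k x w)) holomorphic_on cball 0 r"
      by (rule holomorphic_on_upd[OF F]) (use inV[OF x] in auto)
    have cont: "continuous_on (sphere 0 r) (\<lambda>w. F (upd k x w))"
      by (rule continuous_on_subset[OF holomorphic_on_imp_continuous_on[OF hol]]) auto
    have z: "x $ k \<in> ball 0 r" "0 \<in> ball (0::complex) r" using xk[OF x] r by auto
    note c1 = contour_integral_cauchy[OF hol z(1)] and c2 = contour_integral_cauchy[OF hol z(2)]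
    have "2 * of_real pi * \<i> * F (upd k x (x $ k)) - 2 * of_real pi * \<i> * F (upd k x 0) =
      circ r (\<lambda>w. F (upd k x w) / (w - x $ k) - F (upd k x w) / (w - 0))"
      using contour_integral_unique[OF has_contour_integral_diff[OF c1 c2]] by simp
    also have "\<dots> = circ r (\<lambda>w. x $ k * (F (upd k x w) / (w * (w - x $ k))))"
      by (rule circ_cong[OF _ r]) (use nz[OF x] in \<open>simp add: divide_simps, simp add: algebra_simps\<close>)
    also have "\<dots> = x $ k * circ r (\<lambda>w. F (upd k x w) / (w * (w - x $ k)))"
      by (intro contour_integral_lmul circ_integrable r continuous_intros cont) (use nz[OF x] in auto)
    finally show ?thesis by (simp add: q_def upd_self field_simps)
  qed
  have "\<forall>\<^sub>F x in nhds 0. x \<in> U" using U by (simp add: eventually_nhds_in_open)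
  with rep_germ_add[of "subst0 k f" "coord k * abs_germ q"] rep_germ_mult[of "coord k" "abs_germ q"]
    rep_germ_coord[of k] rep_germ_abs_germ[OF q] rep_germ_subst0[of k f]
  have "\<forall>\<^sub>F x in nhds 0. rep_germ f x = rep_germ (subst0 k f + coord k * abs_germ q) x"
    by eventually_elim (simp add: eq[unfolded F_def])
  then have "f = subst0 k f + coord k * abs_germ q" by (simp add: germ_eq_iff)
  with that show ?thesis by blast
qed

text \<open>A representative of \<open>g\<close> vanishes off the hyperplane, and each point of the
  hyperplane is approached from outside along the direction of the \<open>k\<close>-th axis.\<close>

lemma coord_mult_eq_0:
  assumes "coord k * g = 0"
  shows "g = 0"
proof -
  obtain \<delta> where \<delta>: "\<delta> > 0" "cdiff_on (rep_germ g) (ball 0 \<delta>)" by (rule rep_germ_cdiff_on)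
  have "\<forall>\<^sub>F x in nhds 0. x $ k * rep_germ g x = 0"
    using rep_germ_mult[of "coord k" g] rep_germ_coord[of k] rep_germ_zero unfolding assms
    by eventually_elim simp
  then obtain e where e: "e > 0" "\<And>x. norm x < e \<Longrightarrow> x $ k * rep_germ g x = 0"
    by (auto simp: eventually_nhds_metric)
  define d where "d = min e \<delta>"
  have d: "d > 0" using e \<delta> by (simp add: d_def)
  have cont: "continuous_on (ball 0 d) (rep_germ g)"
    by (rule continuous_on_subset[OF cdiff_on_imp_continuous_on[OF \<delta>(2)]]) (simp add: d_def subset_ball)
  have "rep_germ g x = 0" if x: "x \<in> ball 0 d" for x
  proof -
    have lim: "((\<lambda>z. x + axis k z) \<longlongrightarrow> x + axis k 0) (at (0::complex))"
      by (intro tendsto_intros bounded_linear.tendsto[OF bounded_linear_axis_complex])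
    have x0: "x + axis k 0 = x" by (simp add: axis_zero)
    have "isCont (rep_germ g) x" using cont x by (simp add: continuous_on_eq_continuous_at)
    then have "((\<lambda>z. rep_germ g (x + axis k z)) \<longlongrightarrow> rep_germ g x) (at (0::complex))"
      by (rule isCont_tendsto_compose) (use lim x0 in simp)
    moreover have "\<forall>\<^sub>F z in at (0::complex). rep_germ g (x + axis k z) = 0"
    proof -
      have "\<forall>\<^sub>F z in at (0::complex). x + axis k z \<in> ball 0 d"
        using topological_tendstoD[OF lim open_ball, of 0 d] x by (simp add: x0)
      moreover have "\<forall>\<^sub>F z in at (0::complex). x $ k + z \<noteq> 0"
      proof (cases "x $ k = 0")
        case True
        then show ?thesis by (simp add: eventually_at_filter)
      next
        case False
        have "((\<lambda>z. x $ k + z) \<longlongrightarrow> x $ k + 0) (at (0::complex))" by (intro tendsto_intros)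
        with False show ?thesis using tendsto_imp_eventually_ne[of "\<lambda>z. x $ k + z" "x $ k" "at 0" 0] by simp
      qed
      ultimately show ?thesis
      proof eventually_elim
        case (elim z)
        have "(x + axis k z) $ k * rep_germ g (x + axis k z) = 0"
          using elim(1) by (intro e) (simp add: d_def)
        with elim(2) show ?case by (simp add: axis_def)
      qed
    qed
    then have "((\<lambda>z. rep_germ g (x + axis k z)) \<longlongrightarrow> 0) (at (0::complex))" by (rule tendsto_eventually)
    ultimately show ?thesis using tendsto_unique[OF trivial_limit_at] by blast
  qed
  then have "\<forall>\<^sub>F x in nhds 0. rep_germ g x = 0"
    using d unfolding eventually_nhds by (intro exI[of _ "ball 0 d"]) auto
  with rep_germ_zero show ?thesis unfolding germ_eq_iff by eventually_elim simp
qed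

text \<open>Setting the coordinate \<open>k\<close> to zero in a relation for
  \<open>coord k * h\<close> shows that the restricted coefficients combine to zero. By
  \<open>hadamard\<close> what is left of each coefficient is a multiple of \<open>coord k\<close>,
  and \<open>coord k\<close> can be cancelled.\<close>

lemma coord_powers_regular:
  fixes N :: "'n::finite \<Rightarrow> nat"
  assumes "k \<notin> I" "\<And>i. i \<in> I \<Longrightarrow> N i > 0" "coord k ^ m * g \<in> ideals.span ((\<lambda>i. coord i ^ N i) ` I)"
  shows "g \<in> ideals.span ((\<lambda>i. coord i ^ N i) ` I)"
  using assms(3)
proof (induction m arbitrary: g)
  case (Suc m)
  have 1: "h \<in> ideals.span ((\<lambda>i. coord i ^ N i) ` I)" if h: "coord k * h \<in> ideals.span ((\<lambda>i. coord i ^ N i) ` I)" for h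
  proof -
    obtain c where c: "coord k * h = (\<Sum>i\<in>I. c i * coord i ^ N i)"
      using span_imageE[OF finite h] .
    have "subst0 k (coord k * h) = 0" by (simp add: subst0_mult subst0_coord)
    then have "(\<Sum>i\<in>I. subst0 k (c i * coord i ^ N i)) = 0"
      unfolding c subst0_sum .
    moreover have "subst0 k (c i * coord i ^ N i) = subst0 k (c i) * coord i ^ N i" if "i \<in> I" for i
      using assms(1,2) that by (auto simp: subst0_mult subst0_power subst0_coord)
    ultimately have 0: "(\<Sum>i\<in>I. subst0 k (c i) * coord i ^ N i) = 0" by simp
    have "\<exists>q. c i = subst0 k (c i) + coord k * q" for i
      by (rule hadamard[of "c i" k]) blast
    then obtain q where q: "\<And>i. c i = subst0 k (c i) + coord k * q i" by metis
    have "(\<Sum>i\<in>I. c i * coord i ^ N i) = (\<Sum>i\<in>I. subst0 k (c i) * coord i ^ N i + coord k * (q i * coord i ^ N i))"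
      by (rule sum.cong[OF refl], subst q) (simp add: distrib_right mult.assoc)
    also have "\<dots> = coord k * (\<Sum>i\<in>I. q i * coord i ^ N i)"
      by (simp add: sum.distrib 0 sum_distrib_left)
    finally have "coord k * (h - (\<Sum>i\<in>I. q i * coord i ^ N i)) = 0"
      using c by (simp add: right_diff_distrib)
    then have "h = (\<Sum>i\<in>I. q i * coord i ^ N i)"
      using coord_mult_eq_0 by force
    also have "\<dots> \<in> ideals.span ((\<lambda>i. coord i ^ N i) ` I)"
      by (intro ideals.span_sum ideals.span_scale ideals.span_base) auto
    finally show ?thesis .
  qed
  have "coord k ^ m * (coord k * g) \<in> ideals.span ((\<lambda>i. coord i ^ N i) ` I)"
    using Suc.prems by (simp add: mult_ac)
  from 1[OF Suc.IH[OF this]] show ?case .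
qed simp

text \<open>Powers of the coordinates, enumerated in any order, are the regular sequence that
  \<open>koszul_relations\<close> asks for.\<close>

lemma germ_koszul_relations:
  fixes A g :: "'n::finite \<Rightarrow> 'n germ"
  assumes A: "\<And>i. coord i ^ N i \<in> ideals.span (range A)" "\<And>i. N i > 0"
    and rel: "(\<Sum>k\<in>UNIV. A k * g k) = 0"
  obtains v where "\<And>k m. v k m = - v m k" "\<And>k. v k k = 0" "\<And>k. g k = (\<Sum>m\<in>UNIV. A m * v k m)"
proof -
  obtain e :: "nat \<Rightarrow> 'n" where e: "bij_betw e {0..<CARD('n)} UNIV"
    using ex_bij_betw_nat_finite[of "UNIV :: 'n set"] by auto
  define y where "y j = coord (e j) ^ N (e j)" for j
  have im: "y ` {..<j} = (\<lambda>i. coord i ^ N i) ` (e ` {..<j})" for j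
    by (auto simp: y_def)
  show ?thesis
  proof (rule koszul_relations[of y A g])
    show "y j \<in> ideals.span (range A)" for j by (simp add: y_def A)
    fix j g assume j: "j < CARD('n)" and g: "y j * g \<in> ideals.span (y ` {..<j})"
    have "e j \<notin> e ` {..<j}"
      using e j unfolding bij_betw_def inj_on_def by force
    from coord_powers_regular[OF this A(2) g[unfolded im, unfolded y_def]]
    show "g \<in> ideals.span (y ` {..<j})" unfolding im .
  next
    fix v assume v: "\<And>k m. v k m = - v m k" "\<And>k. v k k = 0" "\<And>k. g k = (\<Sum>m\<in>UNIV. A m * v k m)"
    show thesis by (rule that[OF v])
  qed (rule rel)
qed

section \<open>The Nullstellensatz for isolated zeros\<close>

lemma cdiff_on_cong:
  assumes "cdiff_on f U" "open U" "\<And>x. x \<in> U \<Longrightarrow> f x = g x"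
  shows "cdiff_on g U"
  unfolding cdiff_on_def
proof
  fix x assume x: "x \<in> U"
  then obtain D where D: "has_complex_derivative_at f D x" using assms(1) by (auto simp: cdiff_on_def)
  then have "(g has_derivative D) (at x)"
    unfolding has_complex_derivative_at_def
    using has_derivative_transform_within_open[of f D x UNIV U g] assms(2,3) x by auto
  with D have "has_complex_derivative_at g D x" by (simp add: has_complex_derivative_at_def)
  then show "\<exists>D. has_complex_derivative_at g D x" by blast
qed

text \<open>The radius is existentially quantified, so the property depends only on the germs at the
  origin. This permits the passage from the functions produced by elimination to chosen
  representatives.\<close>

lemma isolated_family_cong:
  assumes "isolated_family B m F" "\<And>a. a < m \<Longrightarrow> \<forall>\<^sub>F x in nhds 0. F a x = F' a x"
  shows "isolated_family B m F'"
proof -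
  obtain \<delta> where \<delta>: "\<delta> > 0" and F: "\<And>a. a < m \<Longrightarrow> cdiff_on (F a) (ball 0 \<delta>)"
    and FB: "\<And>a x. a < m \<Longrightarrow> x \<in> ball 0 \<delta> \<Longrightarrow> F a (restr B x) = F a x"
    and iso: "\<And>x. x \<in> ball 0 \<delta> \<Longrightarrow> (\<And>i. i \<notin> B \<Longrightarrow> x $ i = 0) \<Longrightarrow> (\<And>a. a < m \<Longrightarrow> F a x = 0) \<Longrightarrow> x = 0"
    using assms(1) unfolding isolated_family_def by blast
  have "\<forall>\<^sub>F x in nhds 0. \<forall>a\<in>{..<m}. F a x = F' a x"
    by (rule eventually_ball_finite) (use assms(2) in auto)
  then obtain e where e: "e > 0" "\<And>x a. x \<in> ball 0 e \<Longrightarrow> a < m \<Longrightarrow> F a x = F' a x"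
    by (auto simp: eventually_nhds_metric)
  define \<eta> where "\<eta> = min \<delta> e"
  have \<eta>: "\<eta> > 0" "ball 0 \<eta> \<subseteq> ball (0::complex^'a) \<delta>" "ball 0 \<eta> \<subseteq> ball (0::complex^'a) e"
    using \<delta> e by (auto simp: \<eta>_def)
  show ?thesis
    unfolding isolated_family_def
  proof (intro exI[of _ \<eta>] conjI allI impI ballI \<eta>(1))
    show "cdiff_on (F' a) (ball 0 \<eta>)" if "a < m" for a
      by (rule cdiff_on_cong[OF cdiff_on_subset[OF F[OF that] \<eta>(2)]]) (use e that \<eta>(3) in auto)
    show "F' a (restr B x) = F' a x" if "a < m" "x \<in> ball 0 \<eta>" for a x
    proof -
      have "restr B x \<in> ball 0 e" "x \<in> ball 0 e" "x \<in> ball 0 \<delta>"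
        using that(2) \<eta>(2,3) norm_restr_le[of B x] by (auto simp: \<eta>_def)
      then show ?thesis using FB[OF that(1)] e(2)[OF _ that(1)] by metis
    qed
    show "x = 0" if "x \<in> ball 0 \<eta>" "\<forall>i. i \<notin> B \<longrightarrow> x $ i = 0" "\<forall>a<m. F' a x = 0" for x
      by (rule iso) (use that \<eta>(2,3) e(2)[of x] in auto)
  qed
qed

lemma eliminate_germ:
  fixes G :: "nat \<Rightarrow> 'n::finite germ"
  assumes fam: "isolated_family B m (\<lambda>a. rep_germ (G a))" and k: "k \<in> B"
  shows "\<exists>m' G'. isolated_family (B - {k}) m' (\<lambda>a. rep_germ (G' a)) \<and> (\<forall>s<m'. G' s \<in> ideals.span (G ` {..<m}))"
proof -
  obtain m' H where fam': "isolated_family (B - {k}) m' H"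
    and H: "\<And>s. s < m' \<Longrightarrow> \<exists>c. (\<forall>a<m. holomorphic_near (c a) 0) \<and>
      (\<forall>\<^sub>F x in nhds 0. H s x = (\<Sum>a<m. c a x * rep_germ (G a) x))"
    using eliminate_variable[OF fam k] by blast
  have hol: "holomorphic_near (H s) 0" if "s < m'" for s
    using fam' that unfolding isolated_family_def holomorphic_near_eq by blast
  have "isolated_family (B - {k}) m' (\<lambda>s. rep_germ (abs_germ (H s)))"
    by (rule isolated_family_cong[OF fam'])
       (use rep_germ_abs_germ[OF hol] in \<open>simp add: eq_commute\<close>)
  moreover have "abs_germ (H s) \<in> ideals.span (G ` {..<m})" if s: "s < m'" for s
  proof -
    obtain c where c: "\<And>a. a < m \<Longrightarrow> holomorphic_near (c a) 0"
      "\<forall>\<^sub>F x in nhds 0. H s x = (\<Sum>a<m. c a x * rep_germ (G a) x)"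
      using H[OF s] by blast
    have "\<forall>\<^sub>F x in nhds 0. \<forall>a\<in>{..<m}. rep_germ (abs_germ (c a) * G a) x = c a x * rep_germ (G a) x"
    proof (rule eventually_ball_finite, simp, rule ballI)
      fix a assume "a \<in> {..<m}"
      then have "holomorphic_near (c a) 0" using c by auto
      from rep_germ_abs_germ[OF this] rep_germ_mult[of "abs_germ (c a)" "G a"]
      show "\<forall>\<^sub>F x in nhds 0. rep_germ (abs_germ (c a) * G a) x = c a x * rep_germ (G a) x"
        by eventually_elim simp
    qed
    with c(2) rep_germ_sum[of "\<lambda>a. abs_germ (c a) * G a" "{..<m}"]
    have "\<forall>\<^sub>F x in nhds 0. H s x = rep_germ (\<Sum>a<m. abs_germ (c a) * G a) x"
      by eventually_elim simp
    then have "abs_germ (H s) = (\<Sum>a<m. abs_germ (c a) * G a)"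
      by (rule abs_germ_eqI[OF hol[OF s]])
    also have "\<dots> \<in> ideals.span (G ` {..<m})"
      by (intro ideals.span_sum ideals.span_scale ideals.span_base) auto
    finally show ?thesis .
  qed
  ultimately show ?thesis by (intro exI[of _ m'] exI[of _ "\<lambda>s. abs_germ (H s)"]) blast
qed

text \<open>Each new family lies in the ideal of the preceding one, so even the last family remains
  in the original ideal.\<close>

lemma eliminate_germs:
  fixes G :: "nat \<Rightarrow> 'n::finite germ"
  assumes fam: "isolated_family UNIV m (\<lambda>a. rep_germ (G a))"
  shows "\<exists>m' G'. isolated_family (- K) m' (\<lambda>a. rep_germ (G' a)) \<and> (\<forall>s<m'. G' s \<in> ideals.span (G ` {..<m}))"
proof -
  have "finite K" by simp
  then show ?thesis
  proof (induction K rule: finite_induct)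
    case empty
    show ?case using fam by (intro exI[of _ m] exI[of _ G]) (auto intro: ideals.span_base)
  next
    case (insert k K)
    then obtain m1 G1 where 1: "isolated_family (- K) m1 (\<lambda>a. rep_germ (G1 a))"
      "\<And>s. s < m1 \<Longrightarrow> G1 s \<in> ideals.span (G ` {..<m})" by blast
    obtain m2 G2 where 2: "isolated_family (- K - {k}) m2 (\<lambda>a. rep_germ (G2 a))"
      "\<And>s. s < m2 \<Longrightarrow> G2 s \<in> ideals.span (G1 ` {..<m1})"
      using eliminate_germ[OF 1(1), of k] insert.hyps by blast
    have "ideals.span (G1 ` {..<m1}) \<subseteq> ideals.span (G ` {..<m})"
      by (rule ideals.span_minimal) (use 1(2) in auto)
    moreover have "- K - {k} = - insert k K" by auto
    ultimately show ?case using 2 by (intro exI[of _ m2] exI[of _ G2]) auto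
  qed
qed

lemma isolated_zero_power_factor:
  fixes g :: "complex \<Rightarrow> complex"
  assumes g: "g holomorphic_on ball 0 \<delta>" and z0: "z0 \<in> ball 0 \<delta>" "g z0 \<noteq> 0"
  shows "\<exists>N \<rho> u. \<rho> > 0 \<and> u holomorphic_on ball 0 \<rho> \<and> u 0 \<noteq> 0 \<and> (\<forall>z\<in>ball 0 \<rho>. g z = z ^ N * u z)"
proof (cases "g 0 = 0")
  case False
  have "\<delta> > 0" using z0(1) by (simp add: le_less_trans[OF norm_ge_zero])
  with False g show ?thesis by (intro exI[of _ 0] exI[of _ \<delta>] exI[of _ g]) auto
next
  case True
  have \<delta>: "0 \<in> ball (0::complex) \<delta>" using z0(1) by (simp add: le_less_trans[OF norm_ge_zero])
  have nc: "\<not> g constant_on ball 0 \<delta>"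
    using True z0 \<delta> unfolding constant_on_def by metis
  show ?thesis
  proof (rule holomorphic_factor_zero_nonconstant[OF g open_ball connected_ball \<delta> True nc])
    fix u \<rho> N
    assume "0 < \<rho>" "u holomorphic_on ball 0 \<rho>" "\<And>w. w \<in> ball 0 \<rho> \<Longrightarrow> g w = (w - 0) ^ N * u w"
      "\<And>w. w \<in> ball 0 \<rho> \<Longrightarrow> u w \<noteq> 0"
    then show ?thesis by (intro exI[of _ N] exI[of _ \<rho>] exI[of _ u]) auto
  qed
qed

text \<open>Each coordinate gets its own elimination. Once all variables except the
  \<open>i\<close>-th are gone, some member depends on \<open>x $ i\<close> alone and does not
  vanish identically; it is a power of the coordinate times a unit.\<close>

lemma nullstellensatz_family:
  fixes G :: "nat \<Rightarrow> 'n::finite germ"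
  assumes fam: "isolated_family UNIV m (\<lambda>a. rep_germ (G a))"
  shows "\<exists>N. coord i ^ N \<in> ideals.span (G ` {..<m})"
proof -
  obtain m' G' where fam': "isolated_family (- (- {i})) m' (\<lambda>a. rep_germ (G' a))"
    and G': "\<And>s. s < m' \<Longrightarrow> G' s \<in> ideals.span (G ` {..<m})"
    using eliminate_germs[OF fam, of "- {i}"] by blast
  obtain \<delta> where \<delta>: "\<delta> > 0" and F: "\<And>a. a < m' \<Longrightarrow> cdiff_on (rep_germ (G' a)) (ball 0 \<delta>)"
    and FB: "\<And>a x. a < m' \<Longrightarrow> x \<in> ball 0 \<delta> \<Longrightarrow> rep_germ (G' a) (restr {i} x) = rep_germ (G' a) x"
    and iso: "\<And>x. x \<in> ball 0 \<delta> \<Longrightarrow> (\<And>j. j \<noteq> i \<Longrightarrow> x $ j = 0) \<Longrightarrow> (\<And>a. a < m' \<Longrightarrow> rep_germ (G' a) x = 0) \<Longrightarrow> x = 0"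
    using fam' unfolding isolated_family_def by auto
  have "\<exists>a<m'. rep_germ (G' a) (axis i (complex_of_real (\<delta> / 2))) \<noteq> 0"
  proof (rule isolated_family_axis[of \<delta> "{i}" m' "\<lambda>a. rep_germ (G' a)" i, OF \<delta>])
    fix x :: "complex^'n"
    assume "x \<in> ball 0 \<delta>" "\<And>j. j \<notin> {i} \<Longrightarrow> x $ j = 0" "\<And>a. a < m' \<Longrightarrow> rep_germ (G' a) x = 0"
    then show "x = 0" by (intro iso) auto
  qed simp
  then obtain a where a: "a < m'" "rep_germ (G' a) (axis i (complex_of_real (\<delta> / 2))) \<noteq> 0" by blast
  define g where "g z = rep_germ (G' a) (axis i z)" for z
  have "g holomorphic_on ball 0 \<delta>"
    unfolding g_def axis_eq_upd by (rule holomorphic_on_upd[OF F[OF a(1)]]) (simp add: axis_eq_upd[symmetric] norm_axis_complex)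
  moreover have "complex_of_real (\<delta> / 2) \<in> ball 0 \<delta>" "g (complex_of_real (\<delta> / 2)) \<noteq> 0"
    using \<delta> a(2) by (auto simp: g_def)
  ultimately have "\<exists>N \<rho> u. \<rho> > 0 \<and> u holomorphic_on ball 0 \<rho> \<and> u 0 \<noteq> 0 \<and> (\<forall>z\<in>ball 0 \<rho>. g z = z ^ N * u z)"
    by (rule isolated_zero_power_factor)
  then obtain N \<rho> u where u: "\<rho> > 0" "u holomorphic_on ball 0 \<rho>" "u 0 \<noteq> 0" "\<And>z. z \<in> ball 0 \<rho> \<Longrightarrow> g z = z ^ N * u z"
    by blast
  define W where "W = ball (0::complex^'n) (min \<rho> \<delta>)"
  have W: "open W" "0 \<in> W" using u \<delta> by (auto simp: W_def)
  have Wi: "x $ i \<in> ball 0 \<rho>" if "x \<in> W" for x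
    using that Finite_Cartesian_Product.norm_nth_le[of x i] by (auto simp: W_def)
  have "cdiff_on (\<lambda>x. u (x $ i)) W"
  proof (rule cdiff_on_compose_field[OF cdiff_on_component])
    show "u field_differentiable at (x $ i)" if "x \<in> W" for x
      using u(2) Wi[OF that] by (metis at_within_open holomorphic_on_def open_ball)
  qed
  then have hu: "holomorphic_near (\<lambda>x. u (x $ i)) 0" by (rule holomorphic_near_if_cdiff_on[OF _ W])
  define U where "U = abs_germ (\<lambda>x. u (x $ i))"
  have U: "\<forall>\<^sub>F x in nhds 0. rep_germ U x = u (x $ i)"
    unfolding U_def by (rule rep_germ_abs_germ[OF hu])
  have eq: "rep_germ (G' a) x = (x $ i) ^ N * u (x $ i)" if "x \<in> W" for x
  proof -
    have "restr {i} x = axis i (x $ i)"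
      by (simp add: cart_eq_iff restr_nth axis_def)
    then have "rep_germ (G' a) x = g (x $ i)"
      using FB[OF a(1), of x] that by (simp add: W_def g_def)
    with u(4)[OF Wi[OF that]] show ?thesis by simp
  qed
  have "\<forall>\<^sub>F x in nhds 0. x \<in> W" using W by (simp add: eventually_nhds_in_open)
  with U rep_germ_mult[of "coord i ^ N" U] rep_germ_power[of "coord i" N] rep_germ_coord[of i]
  have "\<forall>\<^sub>F x in nhds 0. rep_germ (G' a) x = rep_germ (coord i ^ N * U) x"
    by eventually_elim (simp add: eq)
  then have G'a: "G' a = coord i ^ N * U" by (simp add: germ_eq_iff)
  have "rep_germ U 0 \<noteq> 0" using U[THEN eventually_nhds_x_imp_x] u(3) by simp
  then obtain h where "U * h = 1" by (rule germ_unit)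
  then have "coord i ^ N = h * G' a" by (simp add: G'a mult.assoc mult.commute[of h])
  also have "\<dots> \<in> ideals.span (G ` {..<m})" by (intro ideals.span_scale G' a)
  finally show ?thesis by blast
qed

theorem nullstellensatz:
  fixes S :: "'n::finite germ set"
  assumes "isolated_common_zero S"
  shows "\<exists>N. coord i ^ N \<in> ideals.span S"
proof -
  have fin: "finite S" and ev: "\<forall>\<^sub>F x in nhds 0. (\<forall>f\<in>S. rep_germ f x = 0) \<longleftrightarrow> x = 0"
    using assms by (auto simp: isolated_common_zero_def)
  obtain G :: "nat \<Rightarrow> 'n germ" where "bij_betw G {0..<card S} S"
    using ex_bij_betw_nat_finite[OF fin] by blast
  then have G: "G ` {..<card S} = S" by (simp add: bij_betw_def atLeast0LessThan)
  have "\<forall>\<^sub>F x in nhds 0. \<forall>f\<in>S. \<exists>D. has_complex_derivative_at (rep_germ f) D x"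
    by (rule eventually_ball_finite[OF fin])
       (use holomorphic_near_rep_germ in \<open>auto simp: holomorphic_near_def\<close>)
  with ev have "\<forall>\<^sub>F x in nhds 0. ((\<forall>f\<in>S. rep_germ f x = 0) \<longleftrightarrow> x = 0) \<and> (\<forall>f\<in>S. \<exists>D. has_complex_derivative_at (rep_germ f) D x)"
    by eventually_elim blast
  then obtain \<delta> where \<delta>: "\<delta> > 0"
    "\<And>x. x \<in> ball 0 \<delta> \<Longrightarrow> ((\<forall>f\<in>S. rep_germ f x = 0) \<longleftrightarrow> x = 0) \<and> (\<forall>f\<in>S. \<exists>D. has_complex_derivative_at (rep_germ f) D x)"
    unfolding eventually_nhds_metric by (auto simp: dist_commute)
  have "isolated_family UNIV (card S) (\<lambda>a. rep_germ (G a))"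
    unfolding isolated_family_def
  proof (intro exI[of _ \<delta>] conjI allI impI ballI \<delta>(1))
    show "cdiff_on (rep_germ (G a)) (ball 0 \<delta>)" if "a < card S" for a
      using that \<delta>(2) G unfolding cdiff_on_def by blast
    show "rep_germ (G a) (restr UNIV x) = rep_germ (G a) x" for a x
      by (simp add: restr_def)
    show "x = 0" if "x \<in> ball 0 \<delta>" "\<forall>a<card S. rep_germ (G a) x = 0" for x
    proof -
      have "rep_germ f x = 0" if "f \<in> S" for f
      proof -
        have "f \<in> G ` {..<card S}" using that by (simp only: G)
        then obtain a where "a < card S" "f = G a" by auto
        with \<open>\<forall>a<card S. rep_germ (G a) x = 0\<close> show ?thesis by simp
      qed
      with \<delta>(2)[OF that(1)] show ?thesis by blast
    qed
  qed
  from nullstellensatz_family[OF this] show ?thesis by (simp add: G)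
qed

section \<open>Codimension\<close>

lemma const_germ_add: "const_germ (a + b) = const_germ a + const_germ b"
  by transfer (simp add: germ_rel_def holomorphic_near_const)

lemma const_germ_mult: "const_germ (a * b) = const_germ a * const_germ b"
  by transfer (simp add: germ_rel_def holomorphic_near_const)

lemma const_germ_1: "const_germ 1 = 1"
  by transfer (simp add: germ_rel_def holomorphic_near_const)

lemma const_germ_0: "const_germ 0 = 0"
  by transfer (simp add: germ_rel_def holomorphic_near_const)

interpretation cgerm: Vector_Spaces.vector_space "\<lambda>c (g::'n::finite germ). const_germ c * g"
  by unfold_locales (simp_all add: const_germ_add const_germ_mult const_germ_1 algebra_simps)

declare cgerm.scale_scale [simp del]

lemma subspace_if_ideal: "ideals.subspace I \<Longrightarrow> cgerm.subspace I"
  by (simp add: ideals.subspace_def cgerm.subspace_def)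

section \<open>Bases modulo a subspace and additivity of the codimension\<close>

definition lincomb :: "(nat \<Rightarrow> 'n::finite germ) \<Rightarrow> nat \<Rightarrow> (nat \<Rightarrow> complex) \<Rightarrow> 'n germ"
  where "lincomb b d c = (\<Sum>i<d. const_germ (c i) * b i)"

text \<open>A basis of \<open>J / I\<close> as a family on an initial segment of the naturals:
  families can be concatenated without any care for repeated elements.\<close>

definition basis_mod :: "'n::finite germ set \<Rightarrow> 'n germ set \<Rightarrow> nat \<Rightarrow> (nat \<Rightarrow> 'n germ) \<Rightarrow> bool"
  where "basis_mod J I d b \<longleftrightarrow> (\<forall>i<d. b i \<in> J) \<and> (\<forall>x\<in>J. \<exists>c. x - lincomb b d c \<in> I) \<and>
    (\<forall>c. lincomb b d c \<in> I \<longrightarrow> (\<forall>i<d. c i = 0))"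

definition codim :: "'n::finite germ set \<Rightarrow> 'n germ set \<Rightarrow> nat \<Rightarrow> bool"
  where "codim J I d \<longleftrightarrow> (\<exists>b. basis_mod J I d b)"

lemma lincomb_in_subspace: "cgerm.subspace J \<Longrightarrow> (\<And>i. i < d \<Longrightarrow> b i \<in> J) \<Longrightarrow> lincomb b d c \<in> J"
  unfolding lincomb_def by (intro cgerm.subspace_sum cgerm.subspace_scale) auto

lemma sum_lessThan_add: "(\<Sum>i<m + n. f i) = (\<Sum>i<m. f i) + (\<Sum>i<(n::nat). f (m + i) :: 'a::comm_monoid_add)"
  by (induction n) (simp_all add: add.assoc)

lemma codim_add:
  assumes KJ: "codim K J e" and JI: "codim J I d" and J: "cgerm.subspace J" and sub: "I \<subseteq> J" "J \<subseteq> K"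
  shows "codim K I (e + d)"
proof -
  obtain a where a: "\<And>i. i < e \<Longrightarrow> a i \<in> K" "\<And>x. x \<in> K \<Longrightarrow> \<exists>c. x - lincomb a e c \<in> J"
    "\<And>c i. lincomb a e c \<in> J \<Longrightarrow> i < e \<Longrightarrow> c i = 0"
    using KJ unfolding codim_def basis_mod_def by blast
  obtain b where b: "\<And>i. i < d \<Longrightarrow> b i \<in> J" "\<And>x. x \<in> J \<Longrightarrow> \<exists>c. x - lincomb b d c \<in> I"
    "\<And>c i. lincomb b d c \<in> I \<Longrightarrow> i < d \<Longrightarrow> c i = 0"
    using JI unfolding codim_def basis_mod_def by blast
  define ab where "ab i = (if i < e then a i else b (i - e))" for i
  have split: "lincomb ab (e + d) c = lincomb a e c + lincomb b d (\<lambda>i. c (e + i))" for c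
    by (simp add: lincomb_def sum_lessThan_add ab_def)
  have bJ: "lincomb b d c \<in> J" for c by (rule lincomb_in_subspace[OF J b(1)])
  have "basis_mod K I (e + d) ab"
    unfolding basis_mod_def
  proof (intro conjI allI impI ballI)
    show "ab i \<in> K" if "i < e + d" for i
      using that a(1) b(1) sub by (auto simp: ab_def)
    show "\<exists>c. x - lincomb ab (e + d) c \<in> I" if x: "x \<in> K" for x
    proof -
      obtain c where c: "x - lincomb a e c \<in> J" using a(2)[OF x] by blast
      obtain c' where c': "x - lincomb a e c - lincomb b d c' \<in> I" using b(2)[OF c] by blast
      have "lincomb ab (e + d) (\<lambda>i. if i < e then c i else c' (i - e)) = lincomb a e c + lincomb b d c'"
        unfolding split by (simp add: lincomb_def)
      with c' show ?thesis by (intro exI[of _ "\<lambda>i. if i < e then c i else c' (i - e)"]) (simp add: algebra_simps)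
    qed
    fix c i assume c: "lincomb ab (e + d) c \<in> I" and i: "i < e + d"
    have "lincomb ab (e + d) c - lincomb b d (\<lambda>i. c (e + i)) \<in> J"
      using c sub bJ by (intro cgerm.subspace_diff[OF J]) auto
    then have "lincomb a e c \<in> J" by (simp add: split)
    then have 0: "c i = 0" if "i < e" for i using a(3) that by blast
    then have "lincomb a e c = 0" by (simp add: lincomb_def const_germ_0)
    then have "lincomb b d (\<lambda>i. c (e + i)) \<in> I" using c by (simp add: split)
    then have 1: "c (e + i) = 0" if "i < d" for i using b(3) that by blast
    show "c i = 0"
    proof (cases "i < e")
      case False
      then show ?thesis using 1[of "i - e"] i by simp
    qed (rule 0)
  qed
  then show ?thesis unfolding codim_def by blast
qed

definition finite_codim :: "'n::finite germ set \<Rightarrow> bool"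
  where "finite_codim I \<longleftrightarrow> (\<exists>W. finite W \<and> (\<forall>x. \<exists>y\<in>cgerm.span W. x - y \<in> I))"

text \<open>\<open>J\<close> varies in the induction, because the elements of \<open>J\<close>
  congruent modulo \<open>I\<close> to the span of the smaller set form a subspace of their own. Its
  codimension in \<open>J\<close> is at most one: a multiple of one outside element cancels the
  coefficient of \<open>w\<close>.\<close>

lemma codim_exists:
  assumes "finite W" "cgerm.subspace I" "cgerm.subspace J" "I \<subseteq> J" "\<And>x. x \<in> J \<Longrightarrow> \<exists>y\<in>cgerm.span W. x - y \<in> I"
  shows "\<exists>d. codim J I d"
  using assms(1,3,4,5)
proof (induction W arbitrary: J rule: finite_induct)
  case empty
  then have "basis_mod J I 0 (\<lambda>_. 0)" by (auto simp: basis_mod_def lincomb_def)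
  then show ?case unfolding codim_def by blast
next
  case (insert w W)
  define J0 where "J0 = {x\<in>J. \<exists>y\<in>cgerm.span W. x - y \<in> I}"
  have J0: "cgerm.subspace J0"
    unfolding cgerm.subspace_def
  proof (intro conjI ballI allI)
    show "0 \<in> J0"
      unfolding J0_def using cgerm.subspace_0[OF insert.prems(1)] cgerm.subspace_0[OF assms(2)] cgerm.span_zero
      by (auto intro!: bexI[of _ 0])
    show "x + y \<in> J0" if xy: "x \<in> J0" "y \<in> J0" for x y
    proof -
      obtain x' y' where "x' \<in> cgerm.span W" "x - x' \<in> I" "y' \<in> cgerm.span W" "y - y' \<in> I"
        using xy by (auto simp: J0_def)
      moreover have "x + y - (x' + y') = (x - x') + (y - y')" by simp
      ultimately have "x' + y' \<in> cgerm.span W" "x + y - (x' + y') \<in> I"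
        by (simp_all only: cgerm.subspace_add[OF assms(2)] cgerm.span_add)
      then show ?thesis
        using xy cgerm.subspace_add[OF insert.prems(1)] unfolding J0_def by blast
    qed
    show "const_germ c * x \<in> J0" if x: "x \<in> J0" for c x
    proof -
      obtain x' where "x' \<in> cgerm.span W" "x - x' \<in> I" using x by (auto simp: J0_def)
      then have "const_germ c * x' \<in> cgerm.span W" "const_germ c * x - const_germ c * x' \<in> I"
        using cgerm.subspace_scale[OF assms(2), of "x - x'" c] cgerm.span_scale by (auto simp: algebra_simps)
      then show ?thesis
        using x cgerm.subspace_scale[OF insert.prems(1)] unfolding J0_def by blast
    qed
  qed
  have IJ0: "I \<subseteq> J0"
    using insert.prems(2) cgerm.span_zero unfolding J0_def by (auto intro!: bexI[of _ 0])
  obtain d0 where d0: "codim J0 I d0"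
    using insert.IH[OF J0 IJ0] by (auto simp: J0_def)
  show ?case
  proof (cases "J \<subseteq> J0")
    case True
    then have "J = J0" by (auto simp: J0_def)
    with d0 show ?thesis by blast
  next
    case False
    then obtain v where v: "v \<in> J" "v \<notin> J0" by blast
    obtain y k where vy: "y - const_germ k * w \<in> cgerm.span W" "v - y \<in> I"
      using insert.prems(3)[OF v(1)] by (auto simp: cgerm.span_insert)
    have "k \<noteq> 0"
    proof
      assume "k = 0"
      then have "y \<in> cgerm.span W" using vy by (simp add: const_germ_0)
      with v vy show False by (auto simp: J0_def)
    qed
    have "basis_mod J J0 1 (\<lambda>_. v)"
      unfolding basis_mod_def lincomb_def
    proof (intro conjI allI impI ballI)
      show "v \<in> J" by (rule v)
      fix x assume x: "x \<in> J"
      obtain z l where xz: "z - const_germ l * w \<in> cgerm.span W" "x - z \<in> I"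
        using insert.prems(3)[OF x] by (auto simp: cgerm.span_insert)
      define t where "t = l / k"
      have tk: "const_germ t * const_germ k = const_germ l" using \<open>k \<noteq> 0\<close> by (simp add: t_def flip: const_germ_mult)
      have "(z - const_germ l * w) - const_germ t * (y - const_germ k * w) \<in> cgerm.span W"
        by (intro cgerm.span_diff xz cgerm.span_scale vy)
      moreover have "(z - const_germ l * w) - const_germ t * (y - const_germ k * w) = z - const_germ t * y"
        by (simp add: right_diff_distrib mult.assoc[symmetric] tk)
      ultimately have "z - const_germ t * y \<in> cgerm.span W" by simp
      moreover have "(x - z) - const_germ t * (v - y) \<in> I"
        by (intro cgerm.subspace_diff[OF assms(2)] xz cgerm.subspace_scale[OF assms(2)] vy)
      then have "(x - const_germ t * v) - (z - const_germ t * y) \<in> I" by (simp add: algebra_simps)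
      moreover have "x - const_germ t * v \<in> J"
        by (intro cgerm.subspace_diff[OF insert.prems(1)] cgerm.subspace_scale[OF insert.prems(1)] x v)
      ultimately have "x - const_germ t * v \<in> J0" by (auto simp: J0_def)
      then show "\<exists>c. x - (\<Sum>i<1::nat. const_germ (c i) * v) \<in> J0" by (intro exI[of _ "\<lambda>_. t"]) simp
    next
      fix c :: "nat \<Rightarrow> complex" and i :: nat
      assume c: "(\<Sum>i<1. const_germ (c i) * v) \<in> J0" and i: "i < 1"
      show "c i = 0"
      proof (rule ccontr)
        assume "c i \<noteq> 0"
        then have "const_germ (1 / c i) * (const_germ (c i) * v) = v"
          by (simp add: mult.assoc[symmetric] const_germ_1 flip: const_germ_mult)
        moreover have "const_germ (1 / c i) * (const_germ (c i) * v) \<in> J0"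
          by (rule cgerm.subspace_scale[OF J0]) (use c i in simp)
        ultimately show False using v(2) by simp
      qed
    qed
    then have "codim J J0 1" unfolding codim_def by blast
    from codim_add[OF this d0 J0 IJ0] show ?thesis by (auto simp: J0_def)
  qed
qed

text \<open>\<open>R\<close> induces an isomorphism of \<open>A / A'\<close> onto
  \<open>T / T'\<close>. It is a relation and not a map, because an element of \<open>A\<close> may
  come from several vector fields with different images in \<open>T\<close>; only the classes are
  determined.\<close>

lemma codim_transport:
  assumes A: "codim A A' d"
    and R0: "R 0 0" and Radd: "\<And>x y x' y'. R x y \<Longrightarrow> R x' y' \<Longrightarrow> R (x + x') (y + y')"
    and Rscale: "\<And>c x y. R x y \<Longrightarrow> R (const_germ c * x) (const_germ c * y)"
    and RA: "\<And>x. x \<in> A \<Longrightarrow> \<exists>y\<in>T. R x y" and RT: "\<And>y. y \<in> T \<Longrightarrow> \<exists>x\<in>A. R x y"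
    and iff: "\<And>x y. R x y \<Longrightarrow> x \<in> A' \<longleftrightarrow> y \<in> T'"
  shows "codim T T' d"
proof -
  obtain a where a: "\<And>i. i < d \<Longrightarrow> a i \<in> A" "\<And>x. x \<in> A \<Longrightarrow> \<exists>c. x - lincomb a d c \<in> A'"
    "\<And>c i. lincomb a d c \<in> A' \<Longrightarrow> i < d \<Longrightarrow> c i = 0"
    using A unfolding codim_def basis_mod_def by blast
  have "\<exists>y. i < d \<longrightarrow> y \<in> T \<and> R (a i) y" for i using RA[OF a(1)] by blast
  then obtain b where b: "\<And>i. i < d \<Longrightarrow> b i \<in> T" "\<And>i. i < d \<Longrightarrow> R (a i) (b i)" by metis
  have R: "R (lincomb a d c) (lincomb b d c)" for c
    unfolding lincomb_def using b(2) by (induction d) (auto intro: R0 Radd Rscale)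
  have "basis_mod T T' d b"
    unfolding basis_mod_def
  proof (intro conjI allI impI ballI b(1))
    fix y assume "y \<in> T"
    then obtain x where x: "x \<in> A" "R x y" using RT by blast
    obtain c where c: "x - lincomb a d c \<in> A'" using a(2)[OF x(1)] by blast
    have "R (x + const_germ (- 1) * lincomb a d c) (y + const_germ (- 1) * lincomb b d c)"
      by (intro Radd Rscale x R)
    moreover have "const_germ (- 1) * z = - z" for z :: "'a germ"
      using cgerm.scale_minus_left[of 1 z] by (simp add: const_germ_1)
    ultimately have "R (x - lincomb a d c) (y - lincomb b d c)" by simp
    with c iff show "\<exists>c. y - lincomb b d c \<in> T'" by blast
  next
    fix c i assume "lincomb b d c \<in> T'" "i < d"
    then show "c i = 0" using iff[OF R] a(3) by blast
  qed
  then show ?thesis unfolding codim_def by blast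
qed

text \<open>A filtration by powers of the coordinate. To pass to the next power, take
  \<open>W\<close> together with \<open>coord k\<close> times the previous spanning set; at exponent
  \<open>N\<close> the power already belongs to the ideal and adds nothing.\<close>

lemma finite_codimI_coord:
  assumes fin: "finite_codim (ideals.span (insert (coord k) S))" and N: "coord k ^ N \<in> ideals.span S"
  shows "finite_codim (ideals.span S)"
proof -
  obtain W where W: "finite W" "\<And>x. \<exists>y\<in>cgerm.span W. x - y \<in> ideals.span (insert (coord k) S)"
    using fin unfolding finite_codim_def by blast
  have "finite_codim (ideals.span (insert (coord k ^ M) S))" for M
  proof (induction M)
    case 0
    have "x - 0 \<in> ideals.span (insert (coord k ^ 0) S)" for x :: "'a germ"
      using ideals.span_scale[OF ideals.span_base[of 1 "insert 1 S"], of x] by simp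
    then show ?case
      unfolding finite_codim_def using cgerm.span_zero by (intro exI[of _ "{}"]) blast
  next
    case (Suc M)
    then obtain V where V: "finite V" "\<And>x. \<exists>y\<in>cgerm.span V. x - y \<in> ideals.span (insert (coord k ^ M) S)"
      unfolding finite_codim_def by blast
    have mult: "coord k * y \<in> cgerm.span ((*) (coord k) ` V)" if "y \<in> cgerm.span V" for y
      using that
    proof (induction rule: cgerm.span_induct_alt)
      case base
      then show ?case by (simp add: cgerm.span_zero)
    next
      case (step c v y)
      have "coord k * v \<in> cgerm.span ((*) (coord k) ` V)"
        using step by (intro cgerm.span_base) auto
      then have "const_germ c * (coord k * v) + coord k * y \<in> cgerm.span ((*) (coord k) ` V)"
        using step by (intro cgerm.span_add cgerm.span_scale) auto
      then show ?case by (simp add: distrib_left mult.left_commute)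
    qed
    have "\<exists>z\<in>cgerm.span (W \<union> (*) (coord k) ` V). x - z \<in> ideals.span (insert (coord k ^ Suc M) S)" for x
    proof -
      obtain y where y: "y \<in> cgerm.span W" "x - y \<in> ideals.span (insert (coord k) S)" using W(2) by blast
      obtain x1 where x1: "x - y - x1 * coord k \<in> ideals.span S" using y(2) by (auto simp: ideals.span_insert)
      obtain y1 where y1: "y1 \<in> cgerm.span V" "x1 - y1 \<in> ideals.span (insert (coord k ^ M) S)" using V(2) by blast
      obtain x2 where x2: "x1 - y1 - x2 * coord k ^ M \<in> ideals.span S" using y1(2) by (auto simp: ideals.span_insert)
      have "(x - y - x1 * coord k) + coord k * (x1 - y1 - x2 * coord k ^ M) \<in> ideals.span S"
        by (intro ideals.span_add ideals.span_scale x1 x2)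
      then have "x - (y + coord k * y1) - x2 * coord k ^ Suc M \<in> ideals.span S"
        by (simp add: algebra_simps)
      then have "x - (y + coord k * y1) \<in> ideals.span (insert (coord k ^ Suc M) S)"
        by (auto simp: ideals.span_insert)
      moreover have "y + coord k * y1 \<in> cgerm.span (W \<union> (*) (coord k) ` V)"
        using y(1) mult[OF y1(1)] cgerm.span_mono[of W "W \<union> (*) (coord k) ` V"]
          cgerm.span_mono[of "(*) (coord k) ` V" "W \<union> (*) (coord k) ` V"]
        by (intro cgerm.span_add) auto
      ultimately show ?thesis by blast
    qed
    then show ?case unfolding finite_codim_def using W(1) V(1) by (intro exI[of _ "W \<union> (*) (coord k) ` V"]) blast
  qed
  moreover have "ideals.span (insert (coord k ^ N) S) = ideals.span S"
  proof (rule antisym)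
    show "ideals.span (insert (coord k ^ N) S) \<subseteq> ideals.span S"
      by (rule ideals.span_minimal) (use N ideals.span_superset in auto)
  qed (rule ideals.span_mono, auto)
  ultimately show ?thesis by metis
qed

lemma finite_codim_all_coords: "finite_codim (ideals.span (S \<union> range coord) :: 'n::finite germ set)"
proof -
  have sub: "ideals.span (range coord) \<subseteq> ideals.span (S \<union> range coord :: 'n germ set)"
    by (rule ideals.span_mono) auto
  \<comment> \<open>Division by one coordinate after the other; \<open>restr (- K)\<close> keeps
    track of those already set to zero. For \<open>K = UNIV\<close> only the value at the origin is
    left, so the constants span the quotient.\<close>
  have *: "\<exists>x'. x - x' \<in> ideals.span (coord ` K) \<and> (\<forall>\<^sub>F y in nhds 0. rep_germ x' y = rep_germ x (restr (- K) y))"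
    for x :: "'n germ" and K
  proof -
    have "finite K" by simp
    then show ?thesis
    proof (induction K rule: finite_induct)
      case empty
      show ?case by (intro exI[of _ x]) (simp add: restr_def)
    next
      case (insert k K)
      then obtain x' where x': "x - x' \<in> ideals.span (coord ` K)"
        "\<forall>\<^sub>F y in nhds 0. rep_germ x' y = rep_germ x (restr (- K) y)" by blast
      obtain q where q: "x' = subst0 k x' + coord k * q" by (rule hadamard)
      have "coord k * q \<in> ideals.span (coord ` insert k K)"
        by (subst mult.commute) (intro ideals.span_scale ideals.span_base, simp)
      moreover have "x - x' \<in> ideals.span (coord ` insert k K)"
        using x'(1) ideals.span_mono[of "coord ` K" "coord ` insert k K"] by auto
      ultimately have "(x - x') + coord k * q \<in> ideals.span (coord ` insert k K)"
        by (intro ideals.span_add)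
      moreover have "(x - x') + coord k * q = x - subst0 k x'"
        by (subst (1) q) (simp add: algebra_simps)
      ultimately have "x - subst0 k x' \<in> ideals.span (coord ` insert k K)" by simp
      moreover have "\<forall>\<^sub>F y in nhds 0. rep_germ (subst0 k x') y = rep_germ x (restr (- insert k K) y)"
        using rep_germ_subst0[of k x'] eventually_upd_0[OF x'(2), of k]
      proof eventually_elim
        case (elim y)
        have "restr (- K) (upd k y 0) = restr (- insert k K) y"
          by (simp add: cart_eq_iff restr_nth upd_nth)
        with elim show ?case by simp
      qed
      ultimately show ?case by blast
    qed
  qed
  have "\<exists>y\<in>cgerm.span {1}. x - y \<in> ideals.span (S \<union> range coord)" for x :: "'n germ"
  proof -
    obtain x' where x': "x - x' \<in> ideals.span (range coord)"
      "\<forall>\<^sub>F y in nhds 0. rep_germ x' y = rep_germ x (restr (- UNIV) y)" using *[of x UNIV] by blast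
    have "restr {} y = 0" for y :: "complex^'n" by (simp add: cart_eq_iff restr_nth)
    with x'(2) rep_germ_const[of "rep_germ x 0"] have "\<forall>\<^sub>F y in nhds 0. rep_germ x' y = rep_germ (const_germ (rep_germ x 0)) y"
      by (auto elim: eventually_elim2)
    then have "x' = const_germ (rep_germ x 0) * 1" by (simp add: germ_eq_iff)
    then have "x' \<in> cgerm.span {1}" using cgerm.span_scale[OF cgerm.span_base] by blast
    with x'(1) sub show ?thesis by blast
  qed
  then show ?thesis unfolding finite_codim_def by (intro exI[of _ "{1}"]) auto
qed

text \<open>Starting from the ideal with all coordinates adjoined, they are removed again one at a
  time.\<close>

lemma finite_codim_if_coord_powers:
  fixes S :: "'n::finite germ set"
  assumes "\<And>i. \<exists>N. coord i ^ N \<in> ideals.span S"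
  shows "finite_codim (ideals.span S)"
proof -
  have "finite K" for K :: "'n set" by simp
  then have "finite_codim (ideals.span (S \<union> coord ` K)) \<Longrightarrow> finite_codim (ideals.span S)" for K
  proof (induction K rule: finite_induct)
    case (insert k K)
    obtain N where "coord k ^ N \<in> ideals.span S" using assms by blast
    then have "coord k ^ N \<in> ideals.span (S \<union> coord ` K)"
      using ideals.span_mono[of S "S \<union> coord ` K"] by auto
    moreover have "S \<union> coord ` insert k K = insert (coord k) (S \<union> coord ` K)" by auto
    ultimately show ?case using insert finite_codimI_coord by metis
  qed simp
  from this[of UNIV] finite_codim_all_coords show ?thesis by blast
qed

text \<open>The powers with exponents 0 to \<open>d\<close> are \<open>d + 1\<close> elements of a
  \<open>d\<close>-dimensional quotient, hence dependent. The dependence is its lowest occurring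
  power times a germ that does not vanish at the origin.\<close>

lemma coord_power_in_ideal:
  fixes I :: "'n::finite germ set"
  assumes cod: "codim UNIV I d" and I: "ideals.subspace I"
  shows "\<exists>N>0. coord i ^ N \<in> I"
proof -
  obtain b where b: "\<And>x. \<exists>c. x - lincomb b d c \<in> I"
    using cod unfolding codim_def basis_mod_def by auto
  have "\<exists>c. coord i ^ j - lincomb b d c \<in> I" for j using b by blast
  then obtain c where c: "\<And>j. coord i ^ j - lincomb b d (c j) \<in> I" by metis
  \<comment> \<open>The zero row at \<open>l = d\<close> completes the coefficients to a square
    array of size \<open>d + 1\<close>; its determinant vanishes, and a kernel vector is the
    dependence.\<close>
  define E where "E l j = (if l < d then c j l else 0)" for l j
  have "mdet (Suc d) E = 0" by (rule mdet_zero_row[of d]) (simp_all add: E_def)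
  from mdet_eq_0_imp_kernel[OF this] obtain v where
    v: "\<exists>j<Suc d. v j \<noteq> 0" "\<And>l. l < Suc d \<Longrightarrow> (\<Sum>j<Suc d. E l j * v j) = 0" by blast
  have comb: "(\<Sum>j<Suc d. const_germ (v j) * coord i ^ j) \<in> I"
  proof -
    have "(\<Sum>j<Suc d. const_germ (v j) * lincomb b d (c j)) = (\<Sum>l<d. \<Sum>j<Suc d. const_germ (E l j * v j) * b l)"
      unfolding lincomb_def sum_distrib_left
      by (subst sum.swap) (intro sum.cong refl, simp add: E_def const_germ_mult mult_ac)
    also have "\<dots> = (\<Sum>l<d. const_germ (\<Sum>j<Suc d. E l j * v j) * b l)"
    proof (rule sum.cong[OF refl])
      fix l
      have "const_germ (sum g (A::nat set)) = (\<Sum>j\<in>A. const_germ (g j) :: 'n germ)" for g A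
        by (induction A rule: infinite_finite_induct) (simp_all add: const_germ_0 const_germ_add)
      then show "(\<Sum>j<Suc d. const_germ (E l j * v j) * b l) = const_germ (\<Sum>j<Suc d. E l j * v j) * b l"
        by (simp only: sum_distrib_right)
    qed
    also have "\<dots> = 0"
    proof (rule sum.neutral, rule ballI)
      fix l assume "l \<in> {..<d}"
      then have "(\<Sum>j<Suc d. E l j * v j) = 0" by (intro v(2)) auto
      then show "const_germ (\<Sum>j<Suc d. E l j * v j) * b l = 0" by (simp only: const_germ_0 mult_zero_left)
    qed
    finally have "(\<Sum>j<Suc d. const_germ (v j) * lincomb b d (c j)) = 0" .
    moreover have "(\<Sum>j<Suc d. const_germ (v j) * (coord i ^ j - lincomb b d (c j))) \<in> I"
      by (intro ideals.subspace_sum[OF I] ideals.subspace_scale[OF I] c)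
    ultimately show ?thesis by (simp only: right_diff_distrib sum_subtractf) simp
  qed
  define N where "N = (LEAST j. v j \<noteq> 0)"
  obtain j0 where j0: "j0 < Suc d" "v j0 \<noteq> 0" using v(1) by blast
  have vN: "v N \<noteq> 0" unfolding N_def using j0(2) by (rule LeastI)
  have "N \<le> j0" unfolding N_def using j0(2) by (rule Least_le)
  then have Nd: "N < Suc d" using j0(1) by simp
  have vlt: "v j = 0" if "j < N" for j using that not_less_Least unfolding N_def by blast
  define U where "U = (\<Sum>j\<in>{N..<Suc d}. const_germ (v j) * coord i ^ (j - N))"
  have "(\<Sum>j<Suc d. const_germ (v j) * coord i ^ j) = (\<Sum>j\<in>{N..<Suc d}. const_germ (v j) * coord i ^ j)"
    by (rule sum.mono_neutral_right) (auto simp: vlt const_germ_0)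
  also have "\<dots> = (\<Sum>j\<in>{N..<Suc d}. coord i ^ N * (const_germ (v j) * coord i ^ (j - N)))"
    by (intro sum.cong refl) (simp add: mult.left_commute flip: power_add)
  finally have eq: "(\<Sum>j<Suc d. const_germ (v j) * coord i ^ j) = coord i ^ N * U"
    by (simp only: U_def sum_distrib_left)
  have "rep_germ U 0 = (\<Sum>j\<in>{N..<Suc d}. v j * 0 ^ (j - N))"
    unfolding U_def by (simp only: rep_germ_at_0 rep_germ_coord_0)
  also have "\<dots> = (\<Sum>j\<in>{N}. v j * 0 ^ (j - N))"
    by (rule sum.mono_neutral_right) (use Nd in auto)
  finally have "rep_germ U 0 \<noteq> 0" using vN by simp
  then obtain h where h: "U * h = 1" by (rule germ_unit)
  \<comment> \<open>The additional factor makes the exponent positive even if \<open>N\<close> is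
    0.\<close>
  have "coord i ^ Suc N = (h * coord i) * (coord i ^ N * U)"
  proof -
    have "(h * coord i) * (coord i ^ N * U) = coord i ^ Suc N * (U * h)" by (simp add: mult_ac)
    then show ?thesis by (simp only: h mult_1_right)
  qed
  also have "\<dots> \<in> I" using comb unfolding eq by (rule ideals.subspace_scale[OF I])
  finally show ?thesis by blast
qed

section \<open>Comparison with the dimension of the quotient ring\<close>

lemma const_germ_uminus: "const_germ (- a) = - const_germ a"
  by transfer (simp add: germ_rel_def holomorphic_near_const)

lemma germ_ring_simps:
  "carrier \<O> = UNIV" "x \<otimes>\<^bsub>\<O>\<^esub> y = x * y" "x \<oplus>\<^bsub>\<O>\<^esub> y = x + y" "\<one>\<^bsub>\<O>\<^esub> = 1" "\<zero>\<^bsub>\<O>\<^esub> = 0"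
  by (simp_all add: ring_of_type_algebra_def)

lemma ring_germ: "Ring.ring (\<O> :: 'n::finite germ ring)"
  by (rule ring_from_type_algebra)

lemma ideal_germ_iff: "Ideal.ideal I (\<O> :: 'n::finite germ ring) \<longleftrightarrow> ideals.subspace I"
proof
  assume "Ideal.ideal I (\<O> :: 'n germ ring)"
  then interpret Ideal.ideal I "\<O> :: 'n germ ring" .
  show "ideals.subspace I"
    using additive_subgroup.zero_closed[OF additive_subgroup_axioms] additive_subgroup.a_closed[OF additive_subgroup_axioms]
      I_l_closed
    unfolding ideals.subspace_def by (simp add: germ_ring_simps)
next
  assume I: "ideals.subspace I"
  interpret Ring.ring "\<O> :: 'n germ ring" by (rule ring_germ)
  show "Ideal.ideal I (\<O> :: 'n germ ring)"
  proof (rule idealI[OF ring_germ])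
    show "subgroup I (add_monoid (\<O> :: 'n germ ring))"
    proof (rule add.subgroupI)
      show "\<ominus>\<^bsub>\<O>\<^esub> a \<in> I" if "a \<in> I" for a
      proof -
        have "\<ominus>\<^bsub>\<O>\<^esub> a = - a"
          by (rule minus_equality) (simp_all add: germ_ring_simps)
        then show ?thesis using ideals.subspace_neg[OF I that] by simp
      qed
    qed (use ideals.subspace_0[OF I] ideals.subspace_add[OF I] in \<open>auto simp: germ_ring_simps\<close>)
  qed (use ideals.subspace_scale[OF I] in \<open>auto simp: germ_ring_simps mult.commute\<close>)
qed

lemma Idl_germ: "Idl\<^bsub>(\<O> :: 'n::finite germ ring)\<^esub> S = ideals.span S"
  by (simp add: genideal_def ideal_germ_iff ideals.span_def hull_def conj_commute)

context
  fixes I :: "'n::finite germ set"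
  assumes I: "ideals.subspace I" and proper: "1 \<notin> I"
begin

interpretation I: Ideal.ideal I "\<O> :: 'n germ ring"
  using I by (simp add: ideal_germ_iff)

abbreviation coset :: "'n germ \<Rightarrow> 'n germ set"
  where "coset x \<equiv> I +>\<^bsub>\<O>\<^esub> x"

abbreviation constants :: "'n germ set set"
  where "constants \<equiv> range (\<lambda>c. coset (const_germ c))"

lemma coset_eq_iff: "coset x = coset y \<longleftrightarrow> x - y \<in> I"
proof -
  have c: "coset x = {h + x |h. h \<in> I}" for x
    by (auto simp: a_r_coset_def' germ_ring_simps)
  show ?thesis
  proof
    assume "coset x = coset y"
    moreover have "x \<in> coset x" using ideals.subspace_0[OF I] by (force simp: c)
    ultimately obtain h where "h \<in> I" "x = h + y" by (auto simp: c)
    then show "x - y \<in> I" by simp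
  next
    assume xy: "x - y \<in> I"
    show "coset x = coset y"
      unfolding c
    proof safe
      fix h assume h: "h \<in> I"
      show "\<exists>h'. h + x = h' + y \<and> h' \<in> I"
        using ideals.subspace_add[OF I h xy] by (intro exI[of _ "h + (x - y)"]) simp
      show "\<exists>h'. h + y = h' + x \<and> h' \<in> I"
        using ideals.subspace_diff[OF I h xy] by (intro exI[of _ "h - (x - y)"]) simp
    qed
  qed
qed

lemma Quot_germ_simps:
  "carrier (\<O> Quot I) = range coset" "\<zero>\<^bsub>\<O> Quot I\<^esub> = coset 0" "\<one>\<^bsub>\<O> Quot I\<^esub> = coset 1"
  "coset x \<oplus>\<^bsub>\<O> Quot I\<^esub> coset y = coset (x + y)" "coset x \<otimes>\<^bsub>\<O> Quot I\<^esub> coset y = coset (x * y)"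
proof -
  show "carrier (\<O> Quot I) = range coset"
    by (auto simp: FactRing_def A_RCOSETS_def' germ_ring_simps)
  show "\<zero>\<^bsub>\<O> Quot I\<^esub> = coset 0"
    by (auto simp: FactRing_def a_r_coset_def' germ_ring_simps)
  show "\<one>\<^bsub>\<O> Quot I\<^esub> = coset 1"
    by (simp add: FactRing_def germ_ring_simps)
  show "coset x \<oplus>\<^bsub>\<O> Quot I\<^esub> coset y = coset (x + y)"
    using I.a_rcos_sum[of x y] by (simp add: FactRing_def germ_ring_simps)
  show "coset x \<otimes>\<^bsub>\<O> Quot I\<^esub> coset y = coset (x * y)"
    using I.rcoset_mult_add[of x y] by (simp add: FactRing_def germ_ring_simps)
qed

interpretation Q: Ring.ring "\<O> Quot I"
  by (rule I.quotient_is_ring)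

text \<open>Properness of \<open>I\<close> enters here: the image of the complex numbers is a field
  only in a nonzero ring. The uniqueness of the dimension rests on this.\<close>

lemma subfield_constants: "subfield constants (\<O> Quot I)"
proof -
  define C where "C = (ring_of_type_algebra :: complex ring)"
  have C: "carrier C = UNIV" "x \<otimes>\<^bsub>C\<^esub> y = x * y" "x \<oplus>\<^bsub>C\<^esub> y = x + y" "\<one>\<^bsub>C\<^esub> = 1" for x y
    by (simp_all add: C_def ring_of_type_algebra_def)
  interpret C: Ring.field C unfolding C_def by (rule field_from_type_algebra)
  have "ring_hom_ring C (\<O> Quot I) (\<lambda>c. coset (const_germ c))"
    by (rule ring_hom_ringI[OF C.ring_axioms Q.ring_axioms])
       (simp_all add: C Quot_germ_simps const_germ_mult const_germ_add const_germ_1)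
  then interpret h: ring_hom_ring C "\<O> Quot I" "\<lambda>c. coset (const_germ c)" .
  have "\<one>\<^bsub>\<O> Quot I\<^esub> \<noteq> \<zero>\<^bsub>\<O> Quot I\<^esub>"
    using proper by (simp add: Quot_germ_simps coset_eq_iff)
  from h.img_is_subfield(2)[OF C.carrier_is_subfield this] show ?thesis by (simp add: C)
qed

text \<open>\<open>dimension\<close> is defined inductively by adding one vector at a time; on the
  side of \<open>lincomb\<close> this is one more summand.\<close>

lemma line_extension_coset:
  "Q.line_extension constants (coset (b n)) (coset ` range (lincomb b n)) = coset ` range (lincomb b (Suc n))"
proof (intro equalityI subsetI)
  fix u assume "u \<in> Q.line_extension constants (coset (b n)) (coset ` range (lincomb b n))"
  then obtain k c where "u = coset (const_germ k * b n + lincomb b n c)"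
    by (auto simp: Q.line_extension_mem_iff Quot_germ_simps)
  moreover have "const_germ k * b n + lincomb b n c = lincomb b (Suc n) (c(n := k))"
    by (simp add: lincomb_def add.commute)
  ultimately show "u \<in> coset ` range (lincomb b (Suc n))" by auto
next
  fix u assume "u \<in> coset ` range (lincomb b (Suc n))"
  then obtain c where "u = coset (lincomb b (Suc n) c)" by auto
  moreover have "lincomb b (Suc n) c = const_germ (c n) * b n + lincomb b n c"
    by (simp add: lincomb_def add.commute)
  ultimately have "u = coset (const_germ (c n)) \<otimes>\<^bsub>\<O> Quot I\<^esub> coset (b n) \<oplus>\<^bsub>\<O> Quot I\<^esub> coset (lincomb b n c)"
    by (simp add: Quot_germ_simps)
  then show "u \<in> Q.line_extension constants (coset (b n)) (coset ` range (lincomb b n))"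
    unfolding Q.line_extension_mem_iff by blast
qed

lemma dimension_if_codim:
  assumes "codim UNIV I d"
  shows "Q.dimension d constants (carrier (\<O> Quot I))"
proof -
  obtain b where b: "\<And>x. \<exists>c. x - lincomb b d c \<in> I" "\<And>c i. lincomb b d c \<in> I \<Longrightarrow> i < d \<Longrightarrow> c i = 0"
    using assms unfolding codim_def basis_mod_def by blast
  have "Q.dimension n constants (coset ` range (lincomb b n))" if "n \<le> d" for n
    using that
  proof (induction n)
    case 0
    have "coset ` range (lincomb b 0) = {\<zero>\<^bsub>\<O> Quot I\<^esub>}"
      by (auto simp: lincomb_def Quot_germ_simps)
    then show ?case by (simp add: Q.zero_dim)
  next
    case (Suc n)
    have "coset (b n) \<notin> coset ` range (lincomb b n)"
    proof
      assume "coset (b n) \<in> coset ` range (lincomb b n)"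
      then obtain c where c: "b n - lincomb b n c \<in> I" by (auto simp: coset_eq_iff)
      define c' where "c' i = (if i < n then - c i else if i = n then 1 else 0)" for i
      have "lincomb b d c' = lincomb b (Suc n) c'"
        unfolding lincomb_def using Suc.prems
        by (intro sum.mono_neutral_right) (auto simp: c'_def const_germ_0)
      also have "\<dots> = lincomb b n (\<lambda>i. - c i) + b n"
        by (simp add: lincomb_def c'_def const_germ_1)
      also have "lincomb b n (\<lambda>i. - c i) = - lincomb b n c"
        by (simp add: lincomb_def const_germ_uminus sum_negf)
      finally have "lincomb b d c' \<in> I" using c by simp
      then have "c' n = 0" using b(2) Suc.prems by auto
      then show False by (simp add: c'_def)
    qed
    moreover have "coset (b n) \<in> carrier (\<O> Quot I)" by (simp add: Quot_germ_simps)
    ultimately have "Q.dimension (Suc n) constants (Q.line_extension constants (coset (b n)) (coset ` range (lincomb b n)))"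
      using Suc by (intro Q.Suc_dim) auto
    then show ?case by (simp only: line_extension_coset)
  qed
  from this[of d] have "Q.dimension d constants (coset ` range (lincomb b d))" by simp
  moreover have "coset ` range (lincomb b d) = carrier (\<O> Quot I)"
  proof -
    have "coset x \<in> coset ` range (lincomb b d)" for x
      using b(1)[of x] by (auto simp: coset_eq_iff image_iff)
    then show ?thesis by (auto simp: Quot_germ_simps)
  qed
  ultimately show ?thesis by simp
qed

lemma codim_if_dimension:
  assumes "Q.dimension d constants (carrier (\<O> Quot I))"
  shows "codim UNIV I d"
proof -
  \<comment> \<open>The basis is rebuilt along the derivation of \<open>dimension\<close>. The field
    is an argument of that predicate, so its value is carried through the induction as an
    equation.\<close>
  have "\<exists>b. E = coset ` range (lincomb b n) \<and> (\<forall>c. lincomb b n c \<in> I \<longrightarrow> (\<forall>i<n. c i = 0))"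
    if "Q.dimension n K E" "K = constants" for n K E
    using that
  proof (induction rule: Q.dimension.induct)
    case (zero_dim K)
    show ?case by (intro exI[of _ "\<lambda>_. 0"]) (auto simp: lincomb_def Quot_germ_simps)
  next
    case (Suc_dim v E n K)
    then obtain b where b: "E = coset ` range (lincomb b n)" "\<And>c i. lincomb b n c \<in> I \<Longrightarrow> i < n \<Longrightarrow> c i = 0"
      by blast
    obtain w where w: "v = coset w" using Suc_dim.hyps(1) by (auto simp: Quot_germ_simps)
    define b' where "b' = b(n := w)"
    have b': "lincomb b' n = lincomb b n" "b' n = w"
      by (auto simp: lincomb_def b'_def fun_eq_iff)
    have "Q.line_extension K v E = coset ` range (lincomb b' (Suc n))"
      using line_extension_coset[of b' n] by (simp add: b' w b(1) Suc_dim.prems)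
    moreover have "c i = 0" if c: "lincomb b' (Suc n) c \<in> I" and i: "i < Suc n" for c i
    proof -
      have sum: "lincomb b' (Suc n) c = lincomb b n c + const_germ (c n) * w"
        using b' by (simp add: lincomb_def fun_eq_iff)
      have "c n = 0"
      proof (rule ccontr)
        assume cn: "c n \<noteq> 0"
        have "const_germ (1 / c n) * (lincomb b n c + const_germ (c n) * w) \<in> I"
          using c unfolding sum by (rule ideals.subspace_scale[OF I])
        moreover have "const_germ (1 / c n) * lincomb b n c = - lincomb b n (\<lambda>i. - c i / c n)"
          by (simp add: lincomb_def sum_distrib_left sum_negf[symmetric] const_germ_uminus mult.assoc[symmetric] flip: const_germ_mult)
        moreover have "const_germ (1 / c n) * (const_germ (c n) * w) = w"
          using cn by (simp add: mult.assoc[symmetric] const_germ_1 flip: const_germ_mult)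
        ultimately have "w - lincomb b n (\<lambda>i. - c i / c n) \<in> I" by (simp add: distrib_left)
        then have "v \<in> E" unfolding w b(1) by (auto simp: coset_eq_iff image_iff)
        with Suc_dim.hyps(2) show False by blast
      qed
      moreover have "lincomb b n c \<in> I" using c \<open>c n = 0\<close> by (simp add: sum const_germ_0)
      ultimately show ?thesis using b(2) i by (cases "i = n") auto
    qed
    ultimately show ?case by (intro exI[of _ b']) blast
  qed
  from this[OF assms refl] obtain b where b: "carrier (\<O> Quot I) = coset ` range (lincomb b d)"
    "\<forall>c. lincomb b d c \<in> I \<longrightarrow> (\<forall>i<d. c i = 0)" by blast
  have "\<exists>c. x - lincomb b d c \<in> I" for x
  proof -
    have "coset x \<in> coset ` range (lincomb b d)" unfolding b(1)[symmetric] by (simp add: Quot_germ_simps)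
    then show ?thesis by (auto simp: coset_eq_iff)
  qed
  with b(2) show ?thesis unfolding codim_def basis_mod_def by blast
qed

lemma quot_dim_eq_if_codim:
  assumes "codim UNIV I d"
  shows "quot_dim I = enat d"
proof -
  note d = dimension_if_codim[OF assms]
  have "(THE d. Q.dimension d constants (carrier (\<O> Quot I))) = d"
    using d Q.dimension_is_inj[OF subfield_constants] by blast
  with d show ?thesis by (auto simp: quot_dim_def Let_def)
qed

lemma codim_if_quot_dim_finite:
  assumes "quot_dim I < \<infinity>"
  shows "\<exists>d. codim UNIV I d"
  using assms codim_if_dimension by (auto simp: quot_dim_def Let_def split: if_splits)

end

section \<open>The index formula\<close>

lemma partial_germ_mult: "partial_germ i (f * g) = f * partial_germ i g + partial_germ i f * g"
proof -
  have "\<forall>\<^sub>F x in nhds 0. \<exists>D. has_complex_derivative_at (rep_germ f) D x"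
    and "\<forall>\<^sub>F x in nhds 0. \<exists>D. has_complex_derivative_at (rep_germ g) D x"
    using holomorphic_near_rep_germ by (auto simp: holomorphic_near_def)
  then have "\<forall>\<^sub>F x in nhds 0. partial_deriv i (\<lambda>x. rep_germ f x * rep_germ g x) x
      = rep_germ f x * partial_deriv i (rep_germ g) x + partial_deriv i (rep_germ f) x * rep_germ g x"
  proof eventually_elim
    case (elim x)
    then obtain D E where D: "has_complex_derivative_at (rep_germ f) D x"
      and E: "has_complex_derivative_at (rep_germ g) E x" by blast
    have "has_complex_derivative_at (\<lambda>x. rep_germ f x * rep_germ g x)
        (\<lambda>v. rep_germ f x * E v + D v * rep_germ g x) x"
      using D E unfolding has_complex_derivative_at_def
      by (auto simp: distrib_left mult_ac intro: has_derivative_mult[THEN has_derivative_eq_rhs])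
    from partial_deriv_eq(2)[OF this, of i] partial_deriv_eq(2)[OF D, of i] partial_deriv_eq(2)[OF E, of i]
    show ?case by simp
  qed
  with rep_germ_partial[of i "f * g"] partial_deriv_cong_eventually[OF rep_germ_mult[of f g], of i]
    rep_germ_add[of "f * partial_germ i g" "partial_germ i f * g"]
    rep_germ_mult[of f "partial_germ i g"] rep_germ_mult[of "partial_germ i f" g]
    rep_germ_partial[of i f] rep_germ_partial[of i g]
  have "\<forall>\<^sub>F x in nhds 0. rep_germ (partial_germ i (f * g)) x =
      rep_germ (f * partial_germ i g + partial_germ i f * g) x"
    by eventually_elim simp
  then show ?thesis by (simp add: germ_eq_iff)
qed

lemma contract_add: "contract \<omega> (\<xi> + \<eta>) = contract \<omega> \<xi> + contract \<omega> \<eta>"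
  by (simp add: contract_def distrib_left sum.distrib)

lemma contract_diff: "contract \<omega> (\<xi> - \<eta>) = contract \<omega> \<xi> - contract \<omega> \<eta>"
  by (simp add: contract_def right_diff_distrib sum_subtractf)

lemma contract_zero: "contract \<omega> 0 = 0"
  by (simp add: contract_def)

lemma contract_scale: "contract \<omega> (\<chi> i. a * \<xi> $ i) = a * contract \<omega> \<xi>"
  by (simp add: contract_def sum_distrib_left mult_ac)

lemma contract_differential_mult:
  "contract (differential (f * g)) \<xi> = f * contract (differential g) \<xi> + contract (differential f) \<xi> * g"
  unfolding contract_def differential_def sum_distrib_left sum_distrib_right sum.distrib[symmetric]
  by (rule sum.cong) (simp_all add: partial_germ_mult algebra_simps)

lemma contract_image: "range (contract \<omega>) = ideals.span (range (\<lambda>i. \<omega> $ i))"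
proof (intro equalityI subsetI)
  fix x assume "x \<in> range (contract \<omega>)"
  then obtain \<xi> where "x = (\<Sum>i\<in>UNIV. \<xi> $ i * \<omega> $ i)" by (auto simp: contract_def mult.commute)
  also have "\<dots> \<in> ideals.span (range (\<lambda>i. \<omega> $ i))"
    by (intro ideals.span_sum ideals.span_scale ideals.span_base) auto
  finally show "x \<in> ideals.span (range (\<lambda>i. \<omega> $ i))" .
next
  fix x assume "x \<in> ideals.span (range (\<lambda>i. \<omega> $ i))"
  then obtain c where "x = (\<Sum>i\<in>UNIV. c i * \<omega> $ i)" by (rule span_imageE[OF finite])
  then have "x = contract \<omega> (\<chi> i. c i)" by (simp add: contract_def mult.commute)
  then show "x \<in> range (contract \<omega>)" by blast
qed

lemma rep_germ_span_at_0:
  assumes "\<And>f. f \<in> S \<Longrightarrow> rep_germ f 0 = 0" "x \<in> ideals.span S"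
  shows "rep_germ x 0 = 0"
  using assms(2)
  by (induction rule: ideals.span_induct_alt) (simp_all add: rep_germ_at_0 assms(1))

lemma one_notin_span:
  assumes "isolated_common_zero S"
  shows "1 \<notin> ideals.span S"
proof
  assume "1 \<in> ideals.span S"
  moreover have "\<forall>f\<in>S. rep_germ f 0 = 0"
    using assms eventually_nhds_x_imp_x unfolding isolated_common_zero_def by blast
  ultimately have "rep_germ (1 :: 'a germ) 0 = 0" using rep_germ_span_at_0 by blast
  then show False by (simp add: rep_germ_at_0)
qed

section \<open>Vector fields tangent to the hypersurface and the comparison of the two
  quotients\<close>

context
  fixes \<omega> :: "'n::finite one_form" and X :: "(complex^'n) set" and \<phi> :: "'n germ"
  assumes reduced: "reduced_equation X \<phi>"
begin

abbreviation minors :: "'n germ set"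
  where "minors \<equiv> {partial_germ j \<phi> * \<omega> $ k - partial_germ k \<phi> * \<omega> $ j | j k. j \<noteq> k}"

abbreviation A :: "'n germ set"
  where "A \<equiv> ideals.span (range (\<lambda>i. \<omega> $ i))"

abbreviation T :: "'n germ set"
  where "T \<equiv> ideals.span (insert \<phi> (range (\<lambda>i. partial_germ i \<phi>)))"

abbreviation G :: "'n germ set"
  where "G \<equiv> ideals.span (insert \<phi> minors)"

abbreviation L :: "'n germ set"
  where "L \<equiv> contract \<omega> ` log_vector_fields X"

lemma vanishing_ideal_eq: "vanishing_ideal X = ideals.span {\<phi>}"
  using reduced by (simp add: reduced_equation_def Idl_germ)

text \<open>By the Leibniz rule, tangency need only be tested on the generator of the vanishing
  ideal.\<close>

lemma log_vector_fields_iff: "\<xi> \<in> log_vector_fields X \<longleftrightarrow> contract (differential \<phi>) \<xi> \<in> ideals.span {\<phi>}"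
proof
  assume "\<xi> \<in> log_vector_fields X"
  then show "contract (differential \<phi>) \<xi> \<in> ideals.span {\<phi>}"
    by (auto simp: log_vector_fields_def vanishing_ideal_eq ideals.span_base)
next
  assume \<xi>: "contract (differential \<phi>) \<xi> \<in> ideals.span {\<phi>}"
  have "contract (differential h) \<xi> \<in> ideals.span {\<phi>}" if "h \<in> ideals.span {\<phi>}" for h
  proof -
    obtain a where "h = a * \<phi>" using \<open>h \<in> ideals.span {\<phi>}\<close> by (auto simp: ideals.span_singleton)
    then show ?thesis
      using \<xi> unfolding \<open>h = a * \<phi>\<close> contract_differential_mult
      by (auto intro: ideals.span_add ideals.span_scale ideals.span_base)
  qed
  then show "\<xi> \<in> log_vector_fields X"
    by (simp add: log_vector_fields_def vanishing_ideal_eq)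
qed

lemma subspace_log: "ideals.subspace L"
  unfolding ideals.subspace_def
proof (intro conjI ballI allI)
  have "0 \<in> log_vector_fields X"
    by (simp add: log_vector_fields_iff contract_zero ideals.span_zero)
  then show "0 \<in> L"
    using contract_zero[of \<omega>] by (metis image_eqI)
  show "x + y \<in> L"
    if xy: "x \<in> L" "y \<in> L" for x y
  proof -
    obtain \<xi> \<eta> where *: "\<xi> \<in> log_vector_fields X" "x = contract \<omega> \<xi>" "\<eta> \<in> log_vector_fields X" "y = contract \<omega> \<eta>"
      using xy by blast
    then have "\<xi> + \<eta> \<in> log_vector_fields X"
      by (simp add: log_vector_fields_iff contract_add ideals.span_add)
    moreover have "x + y = contract \<omega> (\<xi> + \<eta>)" using * by (simp add: contract_add)
    ultimately show ?thesis by blast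
  qed
  show "c * x \<in> L" if x: "x \<in> L" for c x
  proof -
    obtain \<xi> where *: "\<xi> \<in> log_vector_fields X" "x = contract \<omega> \<xi>" using x by blast
    then have "(\<chi> i. c * \<xi> $ i) \<in> log_vector_fields X"
      by (simp add: log_vector_fields_iff contract_scale ideals.span_scale)
    moreover have "c * x = contract \<omega> (\<chi> i. c * \<xi> $ i)" using * by (simp add: contract_scale)
    ultimately show ?thesis by blast
  qed
qed

text \<open>Each minor is the value of \<open>differential \<phi>\<close> on a vector field with
  just the two components \<open>\<omega> $ k\<close> and \<open>- \<omega> $ j\<close>, and
  \<open>\<omega>\<close> annihilates such a field.\<close>

lemma span_minors_decompose:
  assumes "y \<in> G"
  obtains a \<kappa> where "contract \<omega> \<kappa> = 0" "y = a * \<phi> + contract (differential \<phi>) \<kappa>"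
proof -
  have "\<exists>a \<kappa>. contract \<omega> \<kappa> = 0 \<and> y = a * \<phi> + contract (differential \<phi>) \<kappa>"
    using assms
  proof (induction rule: ideals.span_induct_alt)
    case base
    show ?case by (intro exI[of _ 0]) (simp add: contract_zero)
  next
    case (step c x y)
    obtain a \<kappa> where a: "contract \<omega> \<kappa> = 0" "y = a * \<phi> + contract (differential \<phi>) \<kappa>" using step by blast
    have "\<exists>b \<mu>. contract \<omega> \<mu> = 0 \<and> x = b * \<phi> + contract (differential \<phi>) \<mu>"
    proof (cases "x = \<phi>")
      case True
      then show ?thesis by (intro exI[of _ 1] exI[of _ 0]) (simp add: contract_zero)
    next
      case False
      then obtain j k where jk: "j \<noteq> k" "x = partial_germ j \<phi> * \<omega> $ k - partial_germ k \<phi> * \<omega> $ j"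
        using step by auto
      define \<eta> where "\<eta> = (\<chi> i. if i = j then \<omega> $ k else if i = k then - \<omega> $ j else 0)"
      have contr: "contract \<alpha> \<eta> = \<alpha> $ j * \<omega> $ k - \<alpha> $ k * \<omega> $ j" for \<alpha>
      proof -
        have "contract \<alpha> \<eta> = (\<Sum>i\<in>{j, k}. \<alpha> $ i * \<eta> $ i)"
          unfolding contract_def by (rule sum.mono_neutral_right) (auto simp: \<eta>_def)
        then show ?thesis using jk(1) by (simp add: \<eta>_def)
      qed
      show ?thesis
        by (intro exI[of _ 0] exI[of _ \<eta>]) (simp add: contr jk(2) differential_def mult.commute)
    qed
    then obtain b \<mu> where b: "contract \<omega> \<mu> = 0" "x = b * \<phi> + contract (differential \<phi>) \<mu>" by blast
    have "contract \<omega> ((\<chi> i. c * \<mu> $ i) + \<kappa>) = 0"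
      by (simp add: contract_add contract_scale a b)
    moreover have "c * x + y = (c * b + a) * \<phi> + contract (differential \<phi>) ((\<chi> i. c * \<mu> $ i) + \<kappa>)"
      by (simp add: contract_add contract_scale a b algebra_simps)
    ultimately show ?case by blast
  qed
  with that show ?thesis by blast
qed

text \<open>Adding the double sum to its transpose gives twice the value as a combination of minors.
  Halving by a constant germ spares an order on the indices.\<close>

lemma differential_kernel_in_minors:
  assumes "\<And>k m. v k m = - v m k" "\<And>k. v k k = 0" "\<And>k. \<kappa> $ k = (\<Sum>m\<in>UNIV. \<omega> $ m * v k m)"
  shows "contract (differential \<phi>) \<kappa> \<in> G"
proof -
  define s where "s = contract (differential \<phi>) \<kappa>"
  have s: "s = (\<Sum>k\<in>UNIV. \<Sum>m\<in>UNIV. partial_germ k \<phi> * \<omega> $ m * v k m)"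
    unfolding s_def contract_def by (simp add: differential_def assms(3) sum_distrib_left mult.assoc)
  also have "\<dots> = (\<Sum>m\<in>UNIV. \<Sum>k\<in>UNIV. partial_germ k \<phi> * \<omega> $ m * v k m)"
    by (rule sum.swap)
  also have "\<dots> = (\<Sum>k\<in>UNIV. \<Sum>m\<in>UNIV. - (partial_germ m \<phi> * \<omega> $ k * v k m))"
    by (intro sum.cong refl) (subst assms(1), simp)
  finally have s': "s = (\<Sum>k\<in>UNIV. \<Sum>m\<in>UNIV. - (partial_germ m \<phi> * \<omega> $ k * v k m))" .
  have "s + s = (\<Sum>k\<in>UNIV. \<Sum>m\<in>UNIV. partial_germ k \<phi> * \<omega> $ m * v k m) +
      (\<Sum>k\<in>UNIV. \<Sum>m\<in>UNIV. - (partial_germ m \<phi> * \<omega> $ k * v k m))"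
    by (rule arg_cong2[where f="(+)", OF s s'])
  also have "\<dots> = (\<Sum>k\<in>UNIV. \<Sum>m\<in>UNIV. v k m * (partial_germ k \<phi> * \<omega> $ m - partial_germ m \<phi> * \<omega> $ k))"
    unfolding sum.distrib[symmetric] by (intro sum.cong refl) (simp add: algebra_simps)
  also have "\<dots> \<in> G"
  proof (intro ideals.span_sum)
    fix k m
    show "v k m * (partial_germ k \<phi> * \<omega> $ m - partial_germ m \<phi> * \<omega> $ k) \<in> G"
    proof (cases "k = m")
      case True
      then show ?thesis by (simp add: ideals.span_zero)
    next
      case False
      then show ?thesis by (intro ideals.span_scale ideals.span_base) blast
    qed
  qed
  finally have "const_germ (1 / 2) * (s + s) \<in> G"
    by (rule ideals.span_scale)
  moreover have "const_germ (1 / 2) * (s + s) = s"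
  proof -
    have "const_germ (1 / 2) * (s + s) = const_germ (1 / 2 + 1 / 2) * s"
      unfolding const_germ_add by (simp only: distrib_left distrib_right)
    then show ?thesis by (simp add: const_germ_1)
  qed
  ultimately show ?thesis by (simp add: s_def)
qed

lemma codim_log_eq_codim_minors:
  assumes A: "codim UNIV A \<mu>"
    and e: "codim A L e"
  shows "codim T G e"
proof -
  have "\<exists>N>0. coord i ^ N \<in> A" for i
    by (rule coord_power_in_ideal[OF A]) (rule ideals.subspace_span)
  then obtain N where N: "\<And>i. coord i ^ N i \<in> A" "\<And>i. N i > 0" by metis
  have ker: "contract (differential \<phi>) \<kappa> \<in> G" if "contract \<omega> \<kappa> = 0" for \<kappa>
  proof -
    have rel: "(\<Sum>k\<in>UNIV. \<omega> $ k * \<kappa> $ k) = 0" using that by (simp add: contract_def)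
    show ?thesis
    proof (rule germ_koszul_relations[OF N rel])
      fix v assume "\<And>k m. v k m = - v m k" "\<And>k. v k k = 0" "\<And>k. \<kappa> $ k = (\<Sum>m\<in>UNIV. \<omega> $ m * v k m)"
      then show ?thesis by (rule differential_kernel_in_minors)
    qed
  qed
  have \<phi>_sub: "ideals.span {\<phi>} \<subseteq> G"
    by (rule ideals.span_mono) auto
  \<comment> \<open>The summand \<open>a * \<phi>\<close> lets the second component range over all
    of \<open>T\<close> instead of only the ideal of the partial derivatives.\<close>
  define R where "R x y \<longleftrightarrow> (\<exists>\<xi> a. x = contract \<omega> \<xi> \<and> y = contract (differential \<phi>) \<xi> + a * \<phi>)" for x y
  have d_range: "range (contract (differential \<phi>)) = ideals.span (range (\<lambda>i. partial_germ i \<phi>))"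
    unfolding contract_image by (simp add: differential_def)
  show ?thesis
  proof (rule codim_transport[OF e, of R])
    show "R 0 0" unfolding R_def by (intro exI[of _ 0]) (simp add: contract_zero)
    show "R (x + x') (y + y')" if RR: "R x y" "R x' y'" for x y x' y'
    proof -
      obtain \<xi> a \<xi>' a' where "x = contract \<omega> \<xi>" "y = contract (differential \<phi>) \<xi> + a * \<phi>"
        "x' = contract \<omega> \<xi>'" "y' = contract (differential \<phi>) \<xi>' + a' * \<phi>"
        using RR unfolding R_def by blast
      then show ?thesis
        unfolding R_def by (intro exI[of _ "\<xi> + \<xi>'"] exI[of _ "a + a'"]) (simp add: contract_add algebra_simps)
    qed
    show "R (const_germ c * x) (const_germ c * y)" if RR: "R x y" for c x y
    proof -
      obtain \<xi> a where "x = contract \<omega> \<xi>" "y = contract (differential \<phi>) \<xi> + a * \<phi>"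
        using RR unfolding R_def by blast
      then show ?thesis
        unfolding R_def
        by (intro exI[of _ "\<chi> i. const_germ c * \<xi> $ i"] exI[of _ "const_germ c * a"]) (simp add: contract_scale algebra_simps)
    qed
    show "\<exists>y\<in>T. R x y"
      if x: "x \<in> A" for x
    proof -
      obtain \<xi> where \<xi>: "x = contract \<omega> \<xi>" using x unfolding contract_image[symmetric] by blast
      have "contract (differential \<phi>) \<xi> \<in> ideals.span (range (\<lambda>i. partial_germ i \<phi>))"
        unfolding d_range[symmetric] by blast
      also have "\<dots> \<subseteq> T"
        by (rule ideals.span_mono) auto
      finally show ?thesis
        unfolding R_def using \<xi> by (intro bexI[of _ "contract (differential \<phi>) \<xi>"] exI[of _ \<xi>] exI[of _ 0]) auto
    qed
    show "\<exists>x\<in>A. R x y"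
      if y: "y \<in> T" for y
    proof -
      obtain a where "y - a * \<phi> \<in> ideals.span (range (\<lambda>i. partial_germ i \<phi>))"
        using y by (auto simp: ideals.span_insert)
      then obtain \<xi> where "y - a * \<phi> = contract (differential \<phi>) \<xi>" unfolding d_range[symmetric] by blast
      then have "R (contract \<omega> \<xi>) y" unfolding R_def by (intro exI[of _ \<xi>] exI[of _ a]) (simp add: algebra_simps)
      then show ?thesis unfolding contract_image[symmetric] by blast
    qed
    \<comment> \<open>Koszul exactness is used only from \<open>L\<close> to \<open>G\<close>; the
      converse rests on the decomposition of the elements of \<open>G\<close>.\<close>
    show "x \<in> L \<longleftrightarrow> y \<in> G" if RR: "R x y" for x y
    proof -
      obtain \<xi> a where xy: "x = contract \<omega> \<xi>" "y = contract (differential \<phi>) \<xi> + a * \<phi>"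
        using RR unfolding R_def by blast
      have a\<phi>: "b * \<phi> \<in> ideals.span {\<phi>}" for b by (intro ideals.span_scale ideals.span_base) simp
      show ?thesis
      proof
        assume "x \<in> L"
        then obtain \<eta> where \<eta>: "\<eta> \<in> log_vector_fields X" "contract \<omega> \<xi> = contract \<omega> \<eta>" by (auto simp: xy)
        have "contract (differential \<phi>) (\<xi> - \<eta>) \<in> G"
          by (rule ker) (simp add: contract_diff \<eta>)
        moreover have "contract (differential \<phi>) \<eta> + a * \<phi> \<in> ideals.span {\<phi>}"
          using \<eta>(1) a\<phi> by (auto simp: log_vector_fields_iff intro: ideals.span_add)
        then have "contract (differential \<phi>) \<eta> + a * \<phi> \<in> G"
          using \<phi>_sub by blast
        ultimately have "contract (differential \<phi>) (\<xi> - \<eta>) + (contract (differential \<phi>) \<eta> + a * \<phi>)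
            \<in> G"
          by (rule ideals.span_add)
        then show "y \<in> G" by (simp add: xy contract_diff)
      next
        assume "y \<in> G"
        then obtain b \<kappa> where \<kappa>: "contract \<omega> \<kappa> = 0" "y = b * \<phi> + contract (differential \<phi>) \<kappa>"
          by (rule span_minors_decompose)
        have "contract (differential \<phi>) (\<xi> - \<kappa>) = (b - a) * \<phi>"
          using \<kappa>(2) by (simp add: xy contract_diff algebra_simps)
        then have "\<xi> - \<kappa> \<in> log_vector_fields X" using a\<phi> by (simp add: log_vector_fields_iff)
        moreover have "x = contract \<omega> (\<xi> - \<kappa>)" by (simp add: xy contract_diff \<kappa>)
        ultimately show "x \<in> L" by blast
      qed
    qed
  qed
qed

lemma minors_subset: "G \<subseteq> T"
proof (rule ideals.span_minimal)
  have "partial_germ j \<phi> * \<omega> $ k - partial_germ k \<phi> * \<omega> $ j \<in> T" for j k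
    by (subst (1 2) mult.commute) (intro ideals.span_diff ideals.span_scale ideals.span_base, auto)
  then show "insert \<phi> minors \<subseteq> T"
    by (auto intro: ideals.span_base)
qed (rule ideals.subspace_span)

end

theorem theorem1:
  fixes \<omega> :: "'n::finite one_form" and X :: "(complex^'n) set" and \<phi> :: "'n germ"
  assumes "CARD('n) \<ge> 2"
    and "isolated_common_zero (range (\<lambda>i. \<omega> $ i))"
    and "hypersurface_germ X"
    and "reduced_equation X \<phi>"
    and "isolated_common_zero (insert \<phi> (range (\<lambda>i. partial_germ i \<phi>)))"
    and "not_invariant \<omega> X"
  shows "ereal_of_enat (bruce_roberts_number \<omega> X) =
    ereal_of_enat (gsv_index \<omega> \<phi>) + ereal_of_enat (milnor_number \<omega>) - ereal_of_enat (tjurina_number \<phi>)"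
proof -
  define A where "A = ideals.span (range (\<lambda>i. \<omega> $ i))"
  define T where "T = ideals.span (insert \<phi> (range (\<lambda>i. partial_germ i \<phi>)))"
  define G where "G = ideals.span (insert \<phi> {partial_germ j \<phi> * \<omega> $ k - partial_germ k \<phi> * \<omega> $ j | j k. j \<noteq> k})"
  define L where "L = contract \<omega> ` log_vector_fields X"
  have sub: "ideals.subspace A" "ideals.subspace T" "ideals.subspace G" "ideals.subspace L"
    unfolding A_def T_def G_def L_def by (rule ideals.subspace_span ideals.subspace_span ideals.subspace_span subspace_log[OF assms(4)])+
  have LA: "L \<subseteq> A" unfolding L_def A_def contract_image[symmetric] by blast
  have GT: "G \<subseteq> T" unfolding G_def T_def by (rule minors_subset[OF assms(4)])
  have proper: "1 \<notin> A" "1 \<notin> T" using one_notin_span assms(2,5) by (auto simp: A_def T_def)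
  then have proper': "1 \<notin> L" "1 \<notin> G" using LA GT by auto
  have "quot_dim L < \<infinity>" using assms(6) by (simp add: not_invariant_def bruce_roberts_number_def L_def)
  then obtain d where "codim UNIV L d" using codim_if_quot_dim_finite[OF sub(4) proper'(1)] by blast
  then obtain b where b: "\<And>x. \<exists>c. x - lincomb b d c \<in> L" unfolding codim_def basis_mod_def by blast
  \<comment> \<open>Since \<open>L\<close> is contained in \<open>A\<close>, one finite set spanning
    everything modulo \<open>L\<close> yields both the finite colength of \<open>A\<close> and the
    finite codimension of \<open>L\<close> in \<open>A\<close>.\<close>
  define W where "W = b ` {..<d}"
  have W: "finite W" "\<exists>y\<in>cgerm.span W. x - y \<in> L" for x
  proof -
    have "lincomb b d c \<in> cgerm.span W" for c
      unfolding W_def by (rule lincomb_in_subspace[OF cgerm.subspace_span]) (auto intro: cgerm.span_base)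
    then show "\<exists>y\<in>cgerm.span W. x - y \<in> L" using b[of x] by blast
  qed (simp add: W_def)
  obtain \<mu> where \<mu>: "codim UNIV A \<mu>"
    using codim_exists[OF W(1) subspace_if_ideal[OF sub(1)] cgerm.subspace_UNIV subset_UNIV] W(2) LA by blast
  obtain e where e: "codim A L e"
    using codim_exists[OF W(1) subspace_if_ideal[OF sub(4)] subspace_if_ideal[OF sub(1)] LA W(2)] by blast
  have "codim T G e"
    using codim_log_eq_codim_minors[OF assms(4)] \<mu> e unfolding A_def T_def G_def L_def by blast
  \<comment> \<open>The isolated singularity of \<open>X\<close> puts a power of every coordinate
    into \<open>T\<close>.\<close>
  moreover have "finite_codim T"
    unfolding T_def by (rule finite_codim_if_coord_powers) (rule nullstellensatz[OF assms(5)])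
  then obtain V where V: "finite V" "\<And>x. \<exists>y\<in>cgerm.span V. x - y \<in> T"
    unfolding finite_codim_def by blast
  obtain \<tau> where \<tau>: "codim UNIV T \<tau>"
    using codim_exists[OF V(1) subspace_if_ideal[OF sub(2)] cgerm.subspace_UNIV subset_UNIV] V(2) by blast
  ultimately have "codim UNIV G (\<tau> + e)"
    using codim_add[OF \<tau> _ subspace_if_ideal[OF sub(2)] GT subset_UNIV] by blast
  then have gsv: "gsv_index \<omega> \<phi> = enat (\<tau> + e)"
    using quot_dim_eq_if_codim[OF sub(3) proper'(2)] by (simp add: gsv_index_def Idl_germ G_def)
  have "codim UNIV L (\<mu> + e)"
    by (rule codim_add[OF \<mu> e subspace_if_ideal[OF sub(1)] LA subset_UNIV])
  then have br: "bruce_roberts_number \<omega> X = enat (\<mu> + e)"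
    using quot_dim_eq_if_codim[OF sub(4) proper'(1)] by (simp add: bruce_roberts_number_def L_def)
  have mil: "milnor_number \<omega> = enat \<mu>"
    using quot_dim_eq_if_codim[OF sub(1) proper(1) \<mu>] by (simp add: milnor_number_def Idl_germ A_def)
  have tj: "tjurina_number \<phi> = enat \<tau>"
    using quot_dim_eq_if_codim[OF sub(2) proper(2) \<tau>] by (simp add: tjurina_number_def Idl_germ T_def)
  \<comment> \<open>What remains is \<open>\<mu> + e = (\<tau> + e) + \<mu> - \<tau>\<close>. All
    four numbers are finite, so the subtraction of extended reals is the ordinary one.\<close>
  show ?thesis by (simp add: gsv br mil tj)
qed

end
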